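(* Let $\lambda_1\le\rho<(\lambda_1+\lambda_2)/2$, $\varepsilon=\frac{\lambda_1^{-1}-\rho^{-1}}{\lambda_1^{-1}-\lambda_2^{-1}}$, $\mathrm{gap}=(\lambda_2-\lambda_1)/\lambda_2$, $\kappa_\nu=\nu_{\max}/\nu_{\min}$, $\sigma=\frac{u_1^{\mathsf T}Au_1}{u_1^{\mathsf T}Bu_1}$. When $\varepsilon$ is sufficiently small, $\varrho>\rho$ holds. If moreover $\cos\vartheta$ is small (which guarantees $\bigl(\frac{8\lambda_2}{\lambda_2-\lambda_1}\cos\vartheta+\sqrt{2\varepsilon}\bigr)^2\le\frac12$), then $$\mu_B\ge\frac{2\nu_{\min}\lambda_1}{\sigma}\Bigl(1-\frac{\lambda_1}{\lambda_2}\Bigr)\Bigl(1-\mathcal O\bigl(\kappa_\nu(\mathrm{gap}^{-2}\cos^2\vartheta+\varepsilon)\bigr)\Bigr),$$ $$L_B\le\frac{2\nu_{\max}\lambda_1}{\sigma}\Bigl(1-\frac{\lambda_1}{\lambda_n}\Bigr)\Bigl(1+\mathcal O\bigl(\sigma\nu_{\min}^{-1}(\mathrm{gap}^{-2}\cos^2\vartheta+\varepsilon)\bigr)\Bigr),$$ so that $\mathrm{Rq}_B$ is $\mu_B$-geodesically convex and $L_B$-Lipschitz smooth on $\mathcal X_B$, and the condition number of the problem $\min_{x\in\mathcal S^{n-1}}\mathrm{Rq}_B(x)$ satisfies $$\kappa_B=\frac{L_B}{\mu_B}\le\kappa_\nu\,\frac{1-\lambda_1/\lambda_n}{1-\lambda_1/\lambda_2}\Bigl(1+\mathcal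 O\bigl(\kappa_\nu(\mathrm{gap}^{-2}\cos^2\vartheta+\varepsilon)\bigr)\Bigr).$$
   Context: $A,M,B\in\mathbb{R}^{n\times n}$ are symmetric positive definite; $0<\lambda_1<\lambda_2\le\dots\le\lambda_n$ are the eigenvalues of $(A,M)$, $Au_1=\lambda_1Mu_1$; $\nu_{\min},\nu_{\max}$ are the extreme eigenvalues of $B^{-1}A$. $A_B=B^{-1/2}AB^{-1/2}$, $M_B=B^{-1/2}MB^{-1/2}$, $\mathrm{Rq}_B(x)=\frac{x^{\mathsf T}A_Bx}{x^{\mathsf T}M_Bx}$, $u_B=B^{1/2}u_1/\|B^{1/2}u_1\|$. $\mathcal S^{n-1}$ is the Euclidean unit sphere and $\mathcal X_B=\{x\in\mathcal S^{n-1}:x^{\mathsf T}u_B>0,\ \mathrm{Rq}_B(x)\le\rho\}$. Over nonzero vectors, with $\|x\|_{A_B}=(x^{\mathsf T}A_Bx)^{1/2}$: $\vartheta=\inf_{\mathrm{Rq}_B(x)\le\rho}\inf_{v^{\mathsf T}x=0}\arccos\frac{|v^{\mathsf T}A_Bx|}{\|v\|_{A_B}\|x\|_{A_B}}$, $\varrho=\inf_{\mathrm{Rq}_B(x)\le\rho}\inf_{v^{\mathsf T}x=0}\mathrm{Rq}_B(v)$, and $\varsigma_{\max},\varsigma_{\min}$ are the maximum and minimum of $x^{\mathsf T}A_Bx/x^{\mathsf T}x$ over $\mathrm{Rq}_B(x)\le\rho$. Further $$C_{\mathcal X}=\tfrac{8\nu_{\max}\rho}{\varsigma_{\min}}\Bigl(\tfrac{\rho-\lambda_1}{\lambda_1}+\bigl(\tfrac{\rho-\lambda_1}{\lambda_1}\bigr)^{1/2}\cos\vartheta\Bigr),\quad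 \mu_B=\tfrac{2\nu_{\min}\lambda_1}{\varsigma_{\max}}\bigl(1-\tfrac{\rho}{\varrho}\bigr)-C_{\mathcal X},\quad L_B=\tfrac{2\nu_{\max}\rho}{\varsigma_{\min}}\bigl(1-\tfrac{\lambda_1}{\lambda_n}\bigr)+C_{\mathcal X}.$$ A differentiable $f$ on a geodesically convex $\mathcal X\subset\mathcal S^{n-1}$ (on which the logarithmic maps $\log_x$ are well defined) is $\mu$-geodesically convex if $\mu>0$ and $f(y)\ge f(x)+\langle\mathrm{grad}f(x),\log_x(y)\rangle+\frac\mu2\|\log_x(y)\|^2$ for all $x,y\in\mathcal X$, and $L$-Lipschitz smooth if $f(y)\le f(x)+\langle\mathrm{grad}f(x),\log_x(y)\rangle+\frac L2\|\log_x(y)\|^2$ for all $x,y\in\mathcal X$. Convention: $\mathcal O(q)$ denotes a quantity bounded in absolute value by an absolute constant times $q$; "sufficiently small" for $\varepsilon$ and $\cos\vartheta$ means below a threshold that may depend on $\kappa_\nu$ and $\mathrm{gap}$. *)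

theory Defs
  imports "Jordan_Normal_Form.Spectral_Radius" "Jordan_Normal_Form.Gauss_Jordan_Elimination"
begin

text \<open>
  Matrices and vectors are those of Jordan_Normal_Form, so that the dimension is an ordinary natural
  number and absolute constants can be quantified before it.
\<close>

definition spd :: "nat \<Rightarrow> real mat \<Rightarrow> bool" where
  "spd n A \<longleftrightarrow> A \<in> carrier_mat n n \<and> transpose_mat A = A \<and>
     (\<forall>x \<in> carrier_vec n. x \<noteq> 0\<^sub>v n \<longrightarrow> x \<bullet> (A *\<^sub>v x) > 0)"

definition mat_inv :: "real mat \<Rightarrow> real mat" where
  "mat_inv A = the (mat_inverse A)"

definition spd_sqrt :: "nat \<Rightarrow> real mat \<Rightarrow> real mat" where
  "spd_sqrt n B = (THE R. spd n R \<and> R * R = B)"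

definition precond :: "nat \<Rightarrow> real mat \<Rightarrow> real mat \<Rightarrow> real mat" where
  "precond n B A = mat_inv (spd_sqrt n B) * A * mat_inv (spd_sqrt n B)"

text \<open>
  The numbers l 1, ..., l n are the eigenvalues of the pencil (A, M) with multiplicity: they are
  the roots of the polynomial det (A - t M), whose leading coefficient is (-1)^n det M.
\<close>

definition pencil_eigenvalues :: "nat \<Rightarrow> real mat \<Rightarrow> real mat \<Rightarrow> (nat \<Rightarrow> real) \<Rightarrow> bool" where
  "pencil_eigenvalues n A M l \<longleftrightarrow> (\<forall>t. det (A - t \<cdot>\<^sub>m M) = det M * (\<Prod>i=1..n. l i - t))"

definition quad :: "real mat \<Rightarrow> real vec \<Rightarrow> real" where
  "quad A x = x \<bullet> (A *\<^sub>v x)"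

definition rq :: "real mat \<Rightarrow> real mat \<Rightarrow> real vec \<Rightarrow> real" where
  "rq A M x = quad A x / quad M x"

definition mnorm :: "real mat \<Rightarrow> real vec \<Rightarrow> real" where
  "mnorm A x = sqrt (quad A x)"

definition vnorm :: "real vec \<Rightarrow> real" where
  "vnorm x = sqrt (x \<bullet> x)"

definition usphere :: "nat \<Rightarrow> real vec set" where
  "usphere n = {x \<in> carrier_vec n. vnorm x = 1}"

definition sublevel :: "nat \<Rightarrow> real mat \<Rightarrow> real mat \<Rightarrow> real \<Rightarrow> real vec set" where
  "sublevel n A M \<rho> = {x \<in> carrier_vec n. x \<noteq> 0\<^sub>v n \<and> rq A M x \<le> \<rho>}"

definition orth :: "nat \<Rightarrow> real vec \<Rightarrow> real vec set" where
  "orth n x = {v \<in> carrier_vec n. v \<noteq> 0\<^sub>v n \<and> v \<bullet> x = 0}"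

definition min_angle :: "nat \<Rightarrow> real mat \<Rightarrow> real mat \<Rightarrow> real \<Rightarrow> real" where
  "min_angle n A M \<rho> = (INF x \<in> sublevel n A M \<rho>. INF v \<in> orth n x.
     arccos (\<bar>v \<bullet> (A *\<^sub>v x)\<bar> / (mnorm A v * mnorm A x)))"

definition orth_rq_inf :: "nat \<Rightarrow> real mat \<Rightarrow> real mat \<Rightarrow> real \<Rightarrow> real" where
  "orth_rq_inf n A M \<rho> = (INF x \<in> sublevel n A M \<rho>. INF v \<in> orth n x. rq A M v)"

text \<open>
  The following supremum and infimum are a maximum and a minimum when A and M are positive definite
  and the sublevel set is nonempty: both quotients are continuous and homogeneous of degree 0, so
  that one may restrict to the unit vectors of the sublevel set, which form a compact set.
\<close>

definition sublevel_max :: "nat \<Rightarrow> real mat \<Rightarrow> real mat \<Rightarrow> real \<Rightarrow> real" where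
  "sublevel_max n A M \<rho> = (SUP x \<in> sublevel n A M \<rho>. quad A x / (x \<bullet> x))"

definition sublevel_min :: "nat \<Rightarrow> real mat \<Rightarrow> real mat \<Rightarrow> real \<Rightarrow> real" where
  "sublevel_min n A M \<rho> = (INF x \<in> sublevel n A M \<rho>. quad A x / (x \<bullet> x))"

definition sphere_sublevel ::
  "nat \<Rightarrow> real mat \<Rightarrow> real mat \<Rightarrow> real vec \<Rightarrow> real \<Rightarrow> real vec set" where
  "sphere_sublevel n A M u \<rho> = {x \<in> usphere n. x \<bullet> u > 0 \<and> rq A M x \<le> \<rho>}"

text \<open>
  Exponential and logarithmic maps of the unit sphere. The logarithm is meaningful for y different
  from -x; division by zero makes sphere_exp x 0 = x and sphere_log x x = 0.
\<close>

definition sphere_exp :: "real vec \<Rightarrow> real vec \<Rightarrow> real vec" where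
  "sphere_exp x v = cos (vnorm v) \<cdot>\<^sub>v x + (sin (vnorm v) / vnorm v) \<cdot>\<^sub>v v"

definition sphere_log :: "real vec \<Rightarrow> real vec \<Rightarrow> real vec" where
  "sphere_log x y = (let p = y - (x \<bullet> y) \<cdot>\<^sub>v x in (arccos (x \<bullet> y) / vnorm p) \<cdot>\<^sub>v p)"

text \<open>
  Geodesic convexity includes that no two points of the set are antipodal, so that every logarithm
  is defined and the minimizing geodesic between two points is unique.
\<close>

definition geod_convex_set :: "nat \<Rightarrow> real vec set \<Rightarrow> bool" where
  "geod_convex_set n X \<longleftrightarrow> X \<subseteq> usphere n \<and>
     (\<forall>x\<in>X. \<forall>y\<in>X. y \<noteq> - x \<and> (\<forall>t\<in>{0..1}. sphere_exp x (t \<cdot>\<^sub>v sphere_log x y) \<in> X))"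

text \<open>
  g is the Riemannian gradient at x of the restriction of f to the sphere: g is tangent at x, and f
  is differentiable at x along the sphere with differential given by the inner product with g.
\<close>

definition has_sphere_grad :: "nat \<Rightarrow> (real vec \<Rightarrow> real) \<Rightarrow> real vec \<Rightarrow> real vec \<Rightarrow> bool" where
  "has_sphere_grad n f x g \<longleftrightarrow> g \<in> carrier_vec n \<and> g \<bullet> x = 0 \<and>
     (\<forall>e>0. \<exists>d>0. \<forall>y\<in>usphere n. vnorm (y - x) < d \<longrightarrow>
        \<bar>f y - f x - g \<bullet> (y - x)\<bar> \<le> e * vnorm (y - x))"

definition geod_convex_fun :: "nat \<Rightarrow> real vec set \<Rightarrow> (real vec \<Rightarrow> real) \<Rightarrow> real \<Rightarrow> bool" where
  "geod_convex_fun n X f \<mu> \<longleftrightarrow> geod_convex_set n X \<and> \<mu> > 0 \<and>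
     (\<forall>x\<in>X. \<exists>g. has_sphere_grad n f x g \<and>
        (\<forall>y\<in>X. f y \<ge> f x + g \<bullet> sphere_log x y + \<mu> / 2 * (vnorm (sphere_log x y))\<^sup>2))"

definition geod_smooth_fun :: "nat \<Rightarrow> real vec set \<Rightarrow> (real vec \<Rightarrow> real) \<Rightarrow> real \<Rightarrow> bool" where
  "geod_smooth_fun n X f L \<longleftrightarrow> geod_convex_set n X \<and>
     (\<forall>x\<in>X. \<exists>g. has_sphere_grad n f x g \<and>
        (\<forall>y\<in>X. f y \<le> f x + g \<bullet> sphere_log x y + L / 2 * (vnorm (sphere_log x y))\<^sup>2))"

end

theory Submission
  imports Defs
begin

text \<open>
  Write P and Q for the preconditioned matrices and decompose vectors P-orthogonally as
  x = c u + z along the lowest eigenvector u. The sublevel condition then says that z carries at most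
  the fraction \<open>\<epsilon>\<close> of the P-energy of x, and applying the angle \<open>\<theta>\<close> to vectors Euclidean-orthogonal
  to u shows that z and u are almost Euclidean-orthogonal. This controls \<open>\<varsigma>\<close> and \<open>\<varrho>\<close>. Along a great
  circle with unit tangent v at x, the second derivative of the Rayleigh quotient is
  2 / Q(x) (P(v) - Rq(x) Q(v)) up to a cross term that involves the residual of x, and this residual is
  at most of order \<open>((\<rho> - \<lambda>\<^sub>1) / \<lambda>\<^sub>1)^(1/2)\<close> in the dual norm of P; so the second derivative lies between
  \<open>\<mu>\<^sub>B\<close> and \<open>L\<^sub>B\<close>, and Taylor's formula gives both inequalities. The set is geodesically convex because
  P - \<open>\<rho>\<close> Q has only one nonpositive direction.
\<close>

subsection \<open>The spectral theorem for real symmetric matrices\<close>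

text \<open>Two difficulties shape the estimates. First, \<open>orq > \<rho>\<close> must follow
  from the smallness of \<epsilon> alone, with nothing known about \<theta>. The bounds for
  \<open>orq\<close> are therefore stated for a number k in place of cos \<theta>: the value 1 - a /
  (2 b), which the condition number of P yields, serves this claim, and k = cos \<theta> serves the
  sharp bound for \<open>\<mu>B\<close>. Second, the leading term of \<open>\<mu>B\<close> carries
  the factor gap, so each additive error has to be bounded by gap times something small. For the
  terms in (\<rho> - l1) / l1 this factor comes from \<epsilon> gap = 1 - l1 / \<rho>; for the mixed
  term with cos \<theta> it is forced by the arithmetic-geometric mean inequality, and there
  gap^(-2) arises. The two error scales have different sources: \<open>CX\<close> contains b and is
  compared in \<open>\<mu>B\<close> with a leading term containing a, whence b / a; in
  \<open>LB\<close> the leading term contains b as well, and the factor \<sigma> / a comes from the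
  lower bound for \<open>smin\<close>.\<close>

lemma mat_eq_on_vecI:
  assumes A: "A \<in> carrier_mat n m" and B: "B \<in> carrier_mat n m"
    and eq: "\<And>x. x \<in> carrier_vec m \<Longrightarrow> A *\<^sub>v x = B *\<^sub>v (x :: real vec)"
  shows "A = B"
proof (rule eq_matI)
  fix i j assume i: "i < dim_row B" and j: "j < dim_col B"
  have "(A *\<^sub>v unit_vec m j) $ i = (B *\<^sub>v unit_vec m j) $ i"
    using eq[of "unit_vec m j"] by simp
  then show "A $$ (i, j) = B $$ (i, j)" using i j A B by simp
qed (use A B in auto)

lemma symmetric_scalar_prod:
  assumes A: "A \<in> carrier_mat n n" and S: "A\<^sup>T = A"
    and x: "x \<in> carrier_vec n" and y: "y \<in> carrier_vec n"
  shows "x \<bullet> (A *\<^sub>v y) = y \<bullet> (A *\<^sub>v (x :: real vec))"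
proof -
  have "x \<bullet> (A *\<^sub>v y) = (A *\<^sub>v x) \<bullet> y"
    using transpose_vec_mult_scalar[OF A y x] unfolding S by simp
  also have "\<dots> = y \<bullet> (A *\<^sub>v x)" by (rule comm_scalar_prod) (use A x y in auto)
  finally show ?thesis .
qed

lemma scalar_prod_self_nonneg: "x \<bullet> (x :: real vec) \<ge> 0"
  unfolding scalar_prod_def by (auto intro: sum_nonneg)

lemma scalar_prod_self_pos:
  assumes "(x :: real vec) \<in> carrier_vec n" "x \<noteq> 0\<^sub>v n"
  shows "x \<bullet> x > 0"
proof -
  obtain i where i: "i < n" "x $ i \<noteq> 0"
    using assms by (metis eq_vecI carrier_vecD index_zero_vec)
  have "0 < x $ i * x $ i" using i(2) by (metis not_real_square_gt_zero)
  also have "\<dots> \<le> (\<Sum>j\<in>{0..<n}. x $ j * x $ j)"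
    by (rule member_le_sum) (use i in auto)
  finally show ?thesis unfolding scalar_prod_def using assms by simp
qed

text \<open>Take a complex eigenvector a + i b with eigenvalue k. Equating b (A a) with a (A b) by
  symmetry gives Im k (a a + b b) = 0, so k is real, and whichever of a and b is nonzero is a real
  eigenvector.\<close>

lemma symmetric_real_eigenvector:
  fixes A :: "real mat"
  assumes A: "A \<in> carrier_mat n n" and S: "A\<^sup>T = A" and n: "n > 0"
  shows "\<exists>v e. v \<in> carrier_vec n \<and> v \<noteq> 0\<^sub>v n \<and> A *\<^sub>v v = e \<cdot>\<^sub>v v"
proof -
  define C where "C = map_mat complex_of_real A"
  have C: "C \<in> carrier_mat n n" using A by (simp add: C_def)
  obtain k where "k \<in> spectrum C" using spectrum_non_empty[OF C n] by auto
  then obtain w where w: "w \<in> carrier_vec n" "w \<noteq> 0\<^sub>v n" "C *\<^sub>v w = k \<cdot>\<^sub>v w"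
    using C unfolding spectrum_def eigenvalue_def eigenvector_def by auto
  define a where "a = map_vec Re w"
  define b where "b = map_vec Im w"
  have a: "a \<in> carrier_vec n" and b: "b \<in> carrier_vec n" using w(1) by (auto simp: a_def b_def)
  have dims: "dim_vec w = n" "dim_vec a = n" "dim_vec b = n" "dim_row A = n" "dim_col A = n"
    using w a b A by auto
  have ev: "(\<Sum>j\<in>{0..<n}. complex_of_real (A $$ (i, j)) * w $ j) = k * w $ i" if "i < n" for i
  proof -
    have "(C *\<^sub>v w) $ i = (k \<cdot>\<^sub>v w) $ i" using w(3) by simp
    then show ?thesis using that dims by (simp add: C_def scalar_prod_def)
  qed
  have Aa: "A *\<^sub>v a = Re k \<cdot>\<^sub>v a - Im k \<cdot>\<^sub>v b"
  proof (rule eq_vecI)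
    fix i assume "i < dim_vec (Re k \<cdot>\<^sub>v a - Im k \<cdot>\<^sub>v b)"
    then have i: "i < n" using dims by simp
    have "Re (\<Sum>j\<in>{0..<n}. complex_of_real (A $$ (i, j)) * w $ j) = Re (k * w $ i)"
      using ev[OF i] by simp
    then show "(A *\<^sub>v a) $ i = (Re k \<cdot>\<^sub>v a - Im k \<cdot>\<^sub>v b) $ i"
      using i dims by (simp add: scalar_prod_def a_def b_def)
  qed (use dims in auto)
  have Ab: "A *\<^sub>v b = Im k \<cdot>\<^sub>v a + Re k \<cdot>\<^sub>v b"
  proof (rule eq_vecI)
    fix i assume "i < dim_vec (Im k \<cdot>\<^sub>v a + Re k \<cdot>\<^sub>v b)"
    then have i: "i < n" using dims by simp
    have "Im (\<Sum>j\<in>{0..<n}. complex_of_real (A $$ (i, j)) * w $ j) = Im (k * w $ i)"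
      using ev[OF i] by simp
    then show "(A *\<^sub>v b) $ i = (Im k \<cdot>\<^sub>v a + Re k \<cdot>\<^sub>v b) $ i"
      using i dims by (simp add: scalar_prod_def a_def b_def)
  qed (use dims in auto)
  have ab: "b \<bullet> a = a \<bullet> b" by (rule comm_scalar_prod[OF b a])
  have "b \<bullet> (A *\<^sub>v a) = a \<bullet> (A *\<^sub>v b)" by (rule symmetric_scalar_prod[OF A S b a])
  then have eq: "Im k * (a \<bullet> a + b \<bullet> b) = 0"
    unfolding Aa Ab using a b ab
    by (simp add: scalar_prod_minus_distrib[OF b] scalar_prod_add_distrib[OF a] algebra_simps)
  have nz: "a \<noteq> 0\<^sub>v n \<or> b \<noteq> 0\<^sub>v n"
  proof (rule ccontr)
    assume "\<not> ?thesis"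
    then have z: "a = 0\<^sub>v n" "b = 0\<^sub>v n" by auto
    have "w $ i = 0" if "i < n" for i
    proof -
      have "a $ i = 0" "b $ i = 0" using z that by auto
      then show ?thesis using that dims by (simp add: a_def b_def complex_eq_iff)
    qed
    then have "w = 0\<^sub>v n" using dims by (intro eq_vecI) auto
    with w(2) show False by simp
  qed
  then have "a \<bullet> a + b \<bullet> b > 0"
    using scalar_prod_self_pos[OF a] scalar_prod_self_pos[OF b]
      scalar_prod_self_nonneg[of a] scalar_prod_self_nonneg[of b] by fastforce
  with eq have im: "Im k = 0" by auto
  have "A *\<^sub>v a = Re k \<cdot>\<^sub>v a" "A *\<^sub>v b = Re k \<cdot>\<^sub>v b"
    unfolding Aa Ab im using a b by auto
  with nz a b show ?thesis by blast
qed

section \<open>Diagonal matrices, reflections and orthogonal diagonalization\<close>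

definition diagm :: "nat \<Rightarrow> (nat \<Rightarrow> real) \<Rightarrow> real mat" where
  "diagm n d = mat n n (\<lambda>(i, j). if i = j then d i else 0)"

lemma diagm_carrier [simp]: "diagm n d \<in> carrier_mat n n"
  by (simp add: diagm_def)

lemma dim_row_diagm [simp]: "dim_row (diagm n d) = n" "dim_col (diagm n d) = n"
  by (simp_all add: diagm_def)

lemma diagm_mult_vec_index:
  assumes "x \<in> carrier_vec n" "i < n"
  shows "(diagm n d *\<^sub>v x) $ i = d i * x $ i"
proof -
  have "(diagm n d *\<^sub>v x) $ i = (\<Sum>j\<in>{0..<n}. (if i = j then d i else 0) * x $ j)"
    using assms by (simp add: diagm_def scalar_prod_def)
  also have "\<dots> = (\<Sum>j\<in>{0..<n}. if i = j then d i * x $ j else 0)"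
    by (rule sum.cong) auto
  also have "\<dots> = d i * x $ i" using assms by simp
  finally show ?thesis .
qed

lemma transpose_diagm [simp]: "(diagm n d)\<^sup>T = diagm n d"
  by (rule eq_matI) (auto simp: diagm_def)

lemma diagm_mult: "diagm n c * diagm n d = diagm n (\<lambda>i. c i * d i)"
proof (rule mat_eq_on_vecI)
  fix x :: "real vec" assume x: "x \<in> carrier_vec n"
  have "diagm n c *\<^sub>v (diagm n d *\<^sub>v x) = diagm n (\<lambda>i. c i * d i) *\<^sub>v x"
    by (rule eq_vecI) (use x in \<open>auto simp: diagm_mult_vec_index dim_row_diagm
      mult_mat_vec_carrier[OF diagm_carrier x] simp del: index_mult_mat_vec\<close>)
  then show "(diagm n c * diagm n d) *\<^sub>v x = diagm n (\<lambda>i. c i * d i) *\<^sub>v x"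
    using x by (simp add: assoc_mult_mat_vec[OF diagm_carrier diagm_carrier])
qed (auto intro: mult_carrier_mat)

lemma quad_diagm:
  assumes "x \<in> carrier_vec n"
  shows "quad (diagm n d) x = (\<Sum>i<n. d i * (x $ i)\<^sup>2)"
proof -
  have "quad (diagm n d) x = (\<Sum>i\<in>{0..<n}. x $ i * (diagm n d *\<^sub>v x) $ i)"
    unfolding quad_def scalar_prod_def by (simp add: diagm_def)
  also have "\<dots> = (\<Sum>i\<in>{0..<n}. d i * (x $ i)\<^sup>2)"
    by (rule sum.cong) (use assms in \<open>auto simp: diagm_mult_vec_index power2_eq_square simp del: index_mult_mat_vec\<close>)
  finally show ?thesis by (simp add: atLeast0LessThan)
qed

text \<open>The reflection in the hyperplane orthogonal to v - e, where e is the first unit vector,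
  exchanges the unit vectors e and v. Being symmetric and an involution, it is an orthogonal matrix
  with first column v.\<close>

lemma householder:
  fixes v :: "real vec"
  assumes v: "v \<in> carrier_vec n" and vv: "v \<bullet> v = 1" and n: "n > 0"
  shows "\<exists>H. H \<in> carrier_mat n n \<and> H\<^sup>T = H \<and> H * H = 1\<^sub>m n \<and> H *\<^sub>v unit_vec n 0 = v"
proof (cases "v = unit_vec n 0")
  case True
  then show ?thesis by (intro exI[of _ "1\<^sub>m n"]) auto
next
  case False
  define e :: "real vec" where "e = unit_vec n 0"
  define w where "w = v - e"
  have e: "e \<in> carrier_vec n" and w: "w \<in> carrier_vec n" using v by (auto simp: e_def w_def)
  have wn: "w \<noteq> 0\<^sub>v n"
  proof
    assume "w = 0\<^sub>v n"
    then have "v $ i = e $ i" if "i < n" for i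
      using that v e unfolding w_def by (metis carrier_vecD index_minus_vec(1) index_zero_vec(1) right_minus_eq)
    then have "v = e" using v e by (intro eq_vecI) auto
    with False show False by (simp add: e_def)
  qed
  have ww: "w \<bullet> w > 0" by (rule scalar_prod_self_pos[OF w wn])
  have ve: "v \<bullet> e = v $ 0" "e \<bullet> v = v $ 0" "e \<bullet> e = 1" using v n by (auto simp: e_def)
  have ww2: "w \<bullet> w = 2 - 2 * v $ 0" "w \<bullet> e = v $ 0 - 1"
    unfolding w_def using v e ve vv
    by (simp_all add: scalar_prod_minus_distrib[of _ n] minus_scalar_prod_distrib[of _ n])
  define H where "H = mat n n (\<lambda>(i, j). (if i = j then 1 else 0) - 2 * w $ i * w $ j / (w \<bullet> w))"
  have H: "H \<in> carrier_mat n n" by (simp add: H_def)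
  have Hx: "H *\<^sub>v x = x - (2 * (w \<bullet> x) / (w \<bullet> w)) \<cdot>\<^sub>v w" if x: "x \<in> carrier_vec n" for x
  proof (rule eq_vecI)
    fix i assume "i < dim_vec (x - (2 * (w \<bullet> x) / (w \<bullet> w)) \<cdot>\<^sub>v w)"
    then have i: "i < n" using w by simp
    have "(H *\<^sub>v x) $ i = (\<Sum>j\<in>{0..<n}. ((if i = j then 1 else 0) - 2 * w $ i * w $ j / (w \<bullet> w)) * x $ j)"
      using i x by (simp add: H_def scalar_prod_def)
    also have "\<dots> = (\<Sum>j\<in>{0..<n}. (if i = j then x $ j else 0) - 2 * w $ i / (w \<bullet> w) * (w $ j * x $ j))"
      by (rule sum.cong) (auto simp: algebra_simps)
    also have "\<dots> = x $ i - 2 * w $ i / (w \<bullet> w) * (w \<bullet> x)"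
      using i x by (simp add: sum_subtractf scalar_prod_def sum_distrib_left)
    finally show "(H *\<^sub>v x) $ i = (x - (2 * (w \<bullet> x) / (w \<bullet> w)) \<cdot>\<^sub>v w) $ i"
      using i x w by (simp add: field_simps)
  qed (use w in \<open>auto simp: H_def\<close>)
  have "H *\<^sub>v e = v"
  proof -
    have "2 * (w \<bullet> e) / (w \<bullet> w) = -1" using ww unfolding ww2 by (simp add: field_simps)
    then have "H *\<^sub>v e = e - (-1) \<cdot>\<^sub>v w" using Hx[OF e] by simp
    also have "\<dots> = v" unfolding w_def by (rule eq_vecI) (use v e in auto)
    finally show ?thesis .
  qed
  moreover have "H * H = 1\<^sub>m n"
  proof (rule mat_eq_on_vecI)
    fix x :: "real vec" assume x: "x \<in> carrier_vec n"
    define c where "c = 2 * (w \<bullet> x) / (w \<bullet> w)"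
    have c: "x - c \<cdot>\<^sub>v w \<in> carrier_vec n" using x w by simp
    have "w \<bullet> (x - c \<cdot>\<^sub>v w) = - (w \<bullet> x)"
      using ww w x by (simp add: scalar_prod_minus_distrib[of _ n] c_def)
    then have "H *\<^sub>v (H *\<^sub>v x) = (x - c \<cdot>\<^sub>v w) - (- c) \<cdot>\<^sub>v w"
      using Hx[OF c] unfolding Hx[OF x] c_def[symmetric] by (simp add: c_def)
    also have "\<dots> = x" by (rule eq_vecI) (use x w in auto)
    finally show "H * H *\<^sub>v x = 1\<^sub>m n *\<^sub>v x" using x H by (simp add: assoc_mult_mat_vec[OF H H])
  qed (use H in auto)
  moreover have "H\<^sup>T = H" by (rule eq_matI) (auto simp: H_def)
  ultimately show ?thesis using H unfolding e_def by blast
qed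

text \<open>Deflation: conjugating by a reflection that sends the first unit vector to a unit
  eigenvector makes the first column of the matrix vanish off the diagonal. By symmetry the first
  row does too, and the induction hypothesis diagonalizes the remaining block.\<close>

theorem symmetric_spectral:
  fixes A :: "real mat"
  assumes "A \<in> carrier_mat n n" "A\<^sup>T = A"
  shows "\<exists>U d. U \<in> carrier_mat n n \<and> U\<^sup>T * U = 1\<^sub>m n \<and> U * U\<^sup>T = 1\<^sub>m n \<and> U\<^sup>T * A * U = diagm n d"
  using assms
proof (induction n arbitrary: A)
  case 0
  show ?case
    by (intro exI[of _ "1\<^sub>m 0"]) (use 0 in \<open>auto intro!: eq_matI simp: diagm_def\<close>)
next
  case (Suc n)
  let ?N = "Suc n"
  from symmetric_real_eigenvector[OF Suc.prems] obtain v0 e where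
    v0: "v0 \<in> carrier_vec ?N" "v0 \<noteq> 0\<^sub>v ?N" "A *\<^sub>v v0 = e \<cdot>\<^sub>v v0" by auto
  have A: "A \<in> carrier_mat ?N ?N" and S: "A\<^sup>T = A" using Suc.prems by auto
  define v where "v = (1 / sqrt (v0 \<bullet> v0)) \<cdot>\<^sub>v v0"
  have v: "v \<in> carrier_vec ?N" using v0 by (simp add: v_def)
  have vv: "v \<bullet> v = 1"
    using v0 scalar_prod_self_pos[OF v0(1,2)] by (simp add: v_def)
  have Av: "A *\<^sub>v v = e \<cdot>\<^sub>v v"
    unfolding v_def using v0 A by (simp add: mult_mat_vec smult_smult_assoc mult.commute)
  obtain H where H: "H \<in> carrier_mat ?N ?N" "H\<^sup>T = H" "H * H = 1\<^sub>m ?N" "H *\<^sub>v unit_vec ?N 0 = v"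
    using householder[OF v vv] by auto
  define K where "K = H * A * H"
  have K: "K \<in> carrier_mat ?N ?N" using H A by (simp add: K_def)
  have KS: "K\<^sup>T = K"
    unfolding K_def using H A S
    by (simp add: transpose_mult[of _ ?N ?N _ ?N] assoc_mult_mat[of _ ?N ?N _ ?N _ ?N])
  have Ke: "K *\<^sub>v unit_vec ?N 0 = e \<cdot>\<^sub>v unit_vec ?N 0"
  proof -
    have "H *\<^sub>v v = H * H *\<^sub>v unit_vec ?N 0"
      unfolding H(4)[symmetric] by (rule assoc_mult_mat_vec[symmetric, OF H(1) H(1)]) simp
    then have "H *\<^sub>v v = unit_vec ?N 0" unfolding H(3) by simp
    moreover have "K *\<^sub>v unit_vec ?N 0 = H *\<^sub>v (A *\<^sub>v v)"
      unfolding K_def using H A by (simp add: assoc_mult_mat_vec[of _ ?N ?N _ ?N])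
    ultimately show ?thesis using H v by (simp add: Av mult_mat_vec[of _ ?N ?N])
  qed
  have K0: "K $$ (i, 0) = (if i = 0 then e else 0)" if "i < ?N" for i
  proof -
    have "(K *\<^sub>v unit_vec ?N 0) $ i = (e \<cdot>\<^sub>v unit_vec ?N 0) $ i" using Ke by simp
    then show ?thesis using that K by simp
  qed
  have K0': "K $$ (0, j) = (if j = 0 then e else 0)" if "j < ?N" for j
    using K0[OF that] KS K that by (metis carrier_matD index_transpose_mat(1) zero_less_Suc)
  define L where "L = mat n n (\<lambda>(i, j). K $$ (Suc i, Suc j))"
  have L: "L \<in> carrier_mat n n" by (simp add: L_def)
  have "L\<^sup>T = L"
  proof (rule eq_matI)
    fix i j assume "i < dim_row L" "j < dim_col L"
    then show "L\<^sup>T $$ (i, j) = L $$ (i, j)"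
      using KS K L by (simp add: L_def) (metis Suc_less_eq carrier_matD index_transpose_mat(1))
  qed (use L in auto)
  with Suc.IH[OF L] obtain V d where V: "V \<in> carrier_mat n n" "V\<^sup>T * V = 1\<^sub>m n" "V * V\<^sup>T = 1\<^sub>m n"
    "V\<^sup>T * L * V = diagm n d" by auto
  let ?bl = "\<lambda>X Y. four_block_mat X (0\<^sub>m 1 n) (0\<^sub>m n 1) Y"
  define E where "E = mat 1 1 (\<lambda>_. e)"
  have E: "E \<in> carrier_mat 1 1" by (simp add: E_def)
  have KB: "K = ?bl E L"
    by (rule eq_matI) (use K K0 K0' in \<open>auto simp: L_def E_def\<close>)
  define W where "W = ?bl (1\<^sub>m 1) V"
  have bl_carrier: "?bl X Y \<in> carrier_mat ?N ?N" if "X \<in> carrier_mat 1 1" "Y \<in> carrier_mat n n" for X Y :: "real mat"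
    using four_block_carrier_mat[OF that] by simp
  have bl_mult: "?bl X Y * ?bl X' Y' = ?bl (X * X') (Y * Y')"
    if "X \<in> carrier_mat 1 1" "Y \<in> carrier_mat n n" "X' \<in> carrier_mat 1 1" "Y' \<in> carrier_mat n n" for X Y X' Y' :: "real mat"
    using that by (subst mult_four_block_mat[of _ 1 1 _ n _ n _ _ 1 _ n]) auto
  have WT: "W\<^sup>T = ?bl (1\<^sub>m 1) V\<^sup>T"
    unfolding W_def using V by (subst transpose_four_block_mat[of _ 1 1 _ n _ n]) auto
  have W: "W \<in> carrier_mat ?N ?N" unfolding W_def by (rule bl_carrier) (use V in auto)
  have WW: "W\<^sup>T * W = 1\<^sub>m ?N" "W * W\<^sup>T = 1\<^sub>m ?N"
    unfolding WT unfolding W_def using V by (simp_all add: bl_mult plus_1_eq_Suc del: One_nat_def)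
  have WKW: "W\<^sup>T * K * W = diagm ?N (\<lambda>i. if i = 0 then e else d (i - 1))"
  proof -
    have "W\<^sup>T * K * W = ?bl E (diagm n d)"
      unfolding WT KB unfolding W_def using V E L by (simp add: bl_mult del: One_nat_def)
    also have "\<dots> = diagm ?N (\<lambda>i. if i = 0 then e else d (i - 1))"
      by (rule eq_matI) (auto simp: diagm_def E_def)
    finally show ?thesis .
  qed
  define U where "U = H * W"
  have UT: "U\<^sup>T = W\<^sup>T * H" unfolding U_def using H W by (simp add: transpose_mult[of _ ?N ?N _ ?N])
  have WTc: "W\<^sup>T \<in> carrier_mat ?N ?N" using W by simp
  have U: "U \<in> carrier_mat ?N ?N" using H W by (simp add: U_def)
  have HHW: "H * (H * W) = W"
    using assoc_mult_mat[OF H(1) H(1) W] H(3) W by simp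
  have "U\<^sup>T * U = W\<^sup>T * (H * (H * W))"
    unfolding UT unfolding U_def using H(1) W WTc by (simp add: assoc_mult_mat[of _ ?N ?N _ ?N _ ?N])
  then have 1: "U\<^sup>T * U = 1\<^sub>m ?N" unfolding HHW using WW by simp
  have "U * U\<^sup>T = H * (W * W\<^sup>T) * H"
    unfolding UT unfolding U_def using H(1) W WTc by (simp add: assoc_mult_mat[of _ ?N ?N _ ?N _ ?N])
  then have 2: "U * U\<^sup>T = 1\<^sub>m ?N" using H WW by simp
  have "U\<^sup>T * A * U = W\<^sup>T * K * W"
    unfolding UT K_def unfolding U_def using H(1) W WTc A by (simp add: assoc_mult_mat[of _ ?N ?N _ ?N _ ?N])
  with WKW 1 2 U show ?case by metis
qed

section \<open>Inverses, congruences and square roots of positive definite matrices\<close>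

lemma mult_inverse_vec:
  fixes A :: "real mat"
  assumes "A \<in> carrier_mat n n" "B \<in> carrier_mat n n" "A * B = 1\<^sub>m n" "x \<in> carrier_vec n"
  shows "A *\<^sub>v (B *\<^sub>v x) = x"
  using assoc_mult_mat_vec[OF assms(1,2,4)] assms(3,4) by simp

lemma mult_mat_zero_vec: "A \<in> carrier_mat n m \<Longrightarrow> A *\<^sub>v 0\<^sub>v m = (0\<^sub>v n :: real vec)"
  by (rule eq_vecI) auto

lemma quad_congruence:
  assumes T: "T \<in> carrier_mat n n" and A: "A \<in> carrier_mat n n" and y: "y \<in> carrier_vec n"
  shows "quad (T\<^sup>T * A * T) y = quad A (T *\<^sub>v y)"
proof -
  have "(T\<^sup>T * A * T) *\<^sub>v y = T\<^sup>T *\<^sub>v (A *\<^sub>v (T *\<^sub>v y))"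
    using T A y by (simp add: assoc_mult_mat_vec[of _ n n _ n])
  then show ?thesis
    unfolding quad_def using T A y transpose_vec_mult_scalar[of T n n y "A *\<^sub>v (T *\<^sub>v y)"]
      comm_scalar_prod[of y n "T\<^sup>T *\<^sub>v (A *\<^sub>v (T *\<^sub>v y))"]
      comm_scalar_prod[of "T *\<^sub>v y" n "A *\<^sub>v (T *\<^sub>v y)"] by simp
qed

lemma quad_one: "x \<in> carrier_vec n \<Longrightarrow> quad (1\<^sub>m n) x = x \<bullet> x"
  by (simp add: quad_def)

lemma spdD:
  assumes "spd n A"
  shows "A \<in> carrier_mat n n" "A\<^sup>T = A"
    "\<And>x. x \<in> carrier_vec n \<Longrightarrow> x \<noteq> 0\<^sub>v n \<Longrightarrow> quad A x > 0"
  using assms by (auto simp: spd_def quad_def)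

text \<open>A kernel vector would contradict definiteness; hence the determinant is nonzero and the
  option under \<open>the\<close> in \<open>mat_inv\<close> is not \<open>None\<close>.\<close>

lemma spd_mat_inv:
  assumes "spd n A"
  shows "A * mat_inv A = 1\<^sub>m n" "mat_inv A * A = 1\<^sub>m n" "mat_inv A \<in> carrier_mat n n"
proof -
  note A = spdD[OF assms]
  have "det A \<noteq> 0"
  proof
    assume "det A = 0"
    then obtain v where v: "v \<in> carrier_vec n" "v \<noteq> 0\<^sub>v n" "A *\<^sub>v v = 0\<^sub>v n"
      using det_0_iff_vec_prod_zero[OF A(1)] by auto
    then show False using A(3)[OF v(1,2)] by (simp add: quad_def)
  qed
  then have "A \<in> Units (ring_mat TYPE(real) n ())" by (rule det_non_zero_imp_unit[OF A(1)])
  then obtain B where "mat_inverse A = Some B" using mat_inverse(1)[OF A(1), where b = "()"] by (cases "mat_inverse A") auto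
  with mat_inverse(2)[OF A(1) this] show "A * mat_inv A = 1\<^sub>m n" "mat_inv A * A = 1\<^sub>m n"
    "mat_inv A \<in> carrier_mat n n" by (auto simp: mat_inv_def)
qed

lemma inverse_unique:
  fixes A :: "real mat"
  assumes A: "A \<in> carrier_mat n n" and X: "X \<in> carrier_mat n n" and Y: "Y \<in> carrier_mat n n"
    and "X * A = 1\<^sub>m n" "A * Y = 1\<^sub>m n"
  shows "X = Y"
proof -
  have "X * A * Y = X * (A * Y)" by (rule assoc_mult_mat[OF X A Y])
  then show ?thesis using assms by simp
qed

lemma spd_mat_inv_symmetric:
  assumes "spd n A"
  shows "(mat_inv A)\<^sup>T = mat_inv A"
proof (rule inverse_unique[of A n])
  note A = spdD[OF assms] and I = spd_mat_inv[OF assms]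
  show "(mat_inv A)\<^sup>T * A = 1\<^sub>m n"
    using transpose_mult[OF A(1) I(3)] A(2) I(1) by simp
qed (use spdD[OF assms] spd_mat_inv[OF assms] in auto)

lemma orthogonal_column:
  fixes U :: "real mat"
  assumes U: "U \<in> carrier_mat n n" "U\<^sup>T * U = 1\<^sub>m n" and i: "i < n"
  shows "U *\<^sub>v unit_vec n i \<noteq> 0\<^sub>v n"
proof
  assume z: "U *\<^sub>v unit_vec n i = 0\<^sub>v n"
  have "unit_vec n i = U\<^sup>T *\<^sub>v (U *\<^sub>v unit_vec n i)"
    using mult_inverse_vec[of "U\<^sup>T" n U "unit_vec n i"] U by simp
  also have "\<dots> = 0\<^sub>v n" unfolding z by (rule mult_mat_zero_vec) (use U in simp)
  finally show False using i unit_vec_nonzero[of i n] by auto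
qed

lemma diagm_unit_vec: "i < n \<Longrightarrow> diagm n d *\<^sub>v unit_vec n i = d i \<cdot>\<^sub>v unit_vec n i"
  by (rule eq_vecI) (auto simp: diagm_def)

lemma orthogonal_diag_eq:
  fixes A U :: "real mat"
  assumes A: "A \<in> carrier_mat n n" and U: "U \<in> carrier_mat n n" "U * U\<^sup>T = 1\<^sub>m n"
    and D: "U\<^sup>T * A * U = D"
  shows "A = U * D * U\<^sup>T"
proof -
  have "U * D * U\<^sup>T = (U * U\<^sup>T) * A * (U * U\<^sup>T)"
    unfolding D[symmetric] using A U(1) by (simp add: assoc_mult_mat[of _ n n _ n _ n])
  then show ?thesis using U A by simp
qed

text \<open>Replace the eigenvalues by their square roots in an orthonormal eigenbasis. Existence
  and uniqueness are both needed because \<open>spd_sqrt\<close> is a definite description.\<close>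

lemma spd_has_sqrt:
  assumes "spd n B"
  shows "\<exists>R. spd n R \<and> R * R = B"
proof -
  note B = spdD[OF assms]
  obtain U d where U: "U \<in> carrier_mat n n" "U\<^sup>T * U = 1\<^sub>m n" "U * U\<^sup>T = 1\<^sub>m n"
    and D: "U\<^sup>T * B * U = diagm n d"
    using symmetric_spectral[OF B(1,2)] by auto
  have UT: "U\<^sup>T \<in> carrier_mat n n" using U by simp
  have d: "d i > 0" if "i < n" for i
  proof -
    have "quad (diagm n d) (unit_vec n i) = quad B (U *\<^sub>v unit_vec n i)"
      unfolding D[symmetric] by (rule quad_congruence) (use U B in auto)
    moreover have "quad B (U *\<^sub>v unit_vec n i) > 0"
      by (rule B(3)) (use U orthogonal_column[OF U(1,2) that] in auto)
    moreover have "quad (diagm n d) (unit_vec n i) = d i"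
      using that by (simp add: quad_def diagm_unit_vec)
    ultimately show ?thesis by simp
  qed
  define E where "E = diagm n (\<lambda>i. sqrt (d i))"
  have E: "E \<in> carrier_mat n n" "E\<^sup>T = E" by (simp_all add: E_def)
  have EE: "E * E = diagm n d"
    unfolding E_def diagm_mult using d by (auto intro!: eq_matI simp: diagm_def less_imp_le)
  define R where "R = U * E * U\<^sup>T"
  have R: "R \<in> carrier_mat n n" using U E by (simp add: R_def)
  have "R * R = U * E * (U\<^sup>T * U) * E * U\<^sup>T"
    unfolding R_def using U(1) UT E(1) by (simp add: assoc_mult_mat[of _ n n _ n _ n])
  also have "\<dots> = U * (E * E) * U\<^sup>T"
    unfolding U(2) using U(1) UT E(1) by (simp add: assoc_mult_mat[of _ n n _ n _ n])
  also have "\<dots> = B" unfolding EE by (rule orthogonal_diag_eq[OF B(1) U(1,3) D, symmetric])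
  finally have RR: "R * R = B" .
  have RT: "R\<^sup>T = R"
    unfolding R_def using U(1) UT E by (simp add: transpose_mult[of _ n n _ n] assoc_mult_mat[of _ n n _ n _ n])
  have "quad R x > 0" if x: "x \<in> carrier_vec n" "x \<noteq> 0\<^sub>v n" for x
  proof -
    define y where "y = U\<^sup>T *\<^sub>v x"
    have y: "y \<in> carrier_vec n" using UT x by (simp add: y_def)
    have "U *\<^sub>v y = x" using mult_inverse_vec[OF U(1) UT U(3) x(1)] by (simp add: y_def)
    then have "y \<noteq> 0\<^sub>v n" using x mult_mat_zero_vec[OF U(1)] by metis
    then obtain i where i: "i < n" "y $ i \<noteq> 0" using y by (metis eq_vecI carrier_vecD index_zero_vec)
    have "quad R x = quad E y"
      using quad_congruence[of "U\<^sup>T" n E x] UT x E unfolding R_def y_def by simp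
    also have "\<dots> = (\<Sum>i<n. sqrt (d i) * (y $ i)\<^sup>2)" unfolding E_def by (rule quad_diagm[OF y])
    also have "\<dots> > 0" by (rule sum_pos2[of _ i]) (use i d in \<open>auto simp: less_imp_le\<close>)
    finally show ?thesis .
  qed
  with R RT RR show ?thesis by (auto simp: spd_def quad_def)
qed

text \<open>If R and S are square roots of the same matrix, then an eigenvector v of R - S with
  eigenvalue e satisfies e (v R v + v S v) = v (R (R - S) + (R - S) S) v = 0.\<close>

lemma spd_sqrt_unique:
  assumes R: "spd n R" and S: "spd n S" and eq: "R * R = S * S"
  shows "R = S"
proof -
  note R' = spdD[OF R] and S' = spdD[OF S]
  define D where "D = R - S"
  have D: "D \<in> carrier_mat n n" unfolding D_def by (rule minus_carrier_mat[OF S'(1)])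
  have DT: "D\<^sup>T = D" unfolding D_def using R' S' by (simp add: transpose_minus[of _ n n])
  obtain U d where U: "U \<in> carrier_mat n n" "U\<^sup>T * U = 1\<^sub>m n" "U * U\<^sup>T = 1\<^sub>m n"
    and Dg: "U\<^sup>T * D * U = diagm n d"
    using symmetric_spectral[OF D DT] by auto
  have UT: "U\<^sup>T \<in> carrier_mat n n" using U by simp
  have DU: "D * U = U * diagm n d"
  proof -
    have "U * diagm n d = U * U\<^sup>T * (D * U)"
      unfolding Dg[symmetric] using U(1) UT D by (simp add: assoc_mult_mat[of _ n n _ n _ n])
    then show ?thesis using U D by simp
  qed
  have d0: "d i = 0" if i: "i < n" for i
  proof -
    define v where "v = U *\<^sub>v unit_vec n i"
    have v: "v \<in> carrier_vec n" "v \<noteq> 0\<^sub>v n"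
      using U orthogonal_column[OF U(1,2) i] by (auto simp: v_def)
    have "D *\<^sub>v v = D * U *\<^sub>v unit_vec n i" unfolding v_def using D U(1) by (simp add: assoc_mult_mat_vec[of _ n n _ n])
    also have "\<dots> = U *\<^sub>v (d i \<cdot>\<^sub>v unit_vec n i)"
      unfolding DU using U(1) by (simp add: assoc_mult_mat_vec[of _ n n _ n] diagm_unit_vec[OF i])
    also have "\<dots> = d i \<cdot>\<^sub>v v" unfolding v_def using U(1) by (simp add: mult_mat_vec[of _ n n])
    finally have Dv: "D *\<^sub>v v = d i \<cdot>\<^sub>v v" .
    have Rv: "R *\<^sub>v v \<in> carrier_vec n" and Sv: "S *\<^sub>v v \<in> carrier_vec n" using R' S' v by auto
    have Dv': "D *\<^sub>v v = R *\<^sub>v v - S *\<^sub>v v"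
      unfolding D_def by (rule minus_mult_distrib_mat_vec) (use R' S' v in auto)
    have "R *\<^sub>v (R *\<^sub>v v) = S *\<^sub>v (S *\<^sub>v v)"
      using arg_cong[OF eq, of "\<lambda>X. X *\<^sub>v v"] R' S' v by (simp add: assoc_mult_mat_vec[of _ n n _ n])
    then have sq: "(R *\<^sub>v v) \<bullet> (R *\<^sub>v v) = (S *\<^sub>v v) \<bullet> (S *\<^sub>v v)"
      using symmetric_scalar_prod[OF R'(1,2) v(1) Rv] symmetric_scalar_prod[OF S'(1,2) v(1) Sv] by simp
    have cm: "(S *\<^sub>v v) \<bullet> (R *\<^sub>v v) = (R *\<^sub>v v) \<bullet> (S *\<^sub>v v)" by (rule comm_scalar_prod[OF Sv Rv])
    have "(R *\<^sub>v v + S *\<^sub>v v) \<bullet> (R *\<^sub>v v - S *\<^sub>v v) = 0"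
      using Rv Sv sq cm by (simp add: scalar_prod_minus_distrib[of _ n] add_scalar_prod_distrib[of _ n])
    moreover have "R *\<^sub>v v - S *\<^sub>v v = d i \<cdot>\<^sub>v v" using Dv Dv' by simp
    ultimately have "d i * ((R *\<^sub>v v) \<bullet> v + (S *\<^sub>v v) \<bullet> v) = 0"
      using Rv Sv v by (simp add: add_scalar_prod_distrib[of _ n] distrib_left)
    moreover have "(R *\<^sub>v v) \<bullet> v > 0" "(S *\<^sub>v v) \<bullet> v > 0"
      using R'(3)[OF v] S'(3)[OF v] comm_scalar_prod[OF v(1) Rv] comm_scalar_prod[OF v(1) Sv]
      by (simp_all add: quad_def)
    ultimately show ?thesis by auto
  qed
  have Z: "diagm n d = 0\<^sub>m n n" by (rule eq_matI) (use d0 in \<open>auto simp: diagm_def\<close>)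
  have "D = U * diagm n d * U\<^sup>T" by (rule orthogonal_diag_eq[OF D U(1,3) Dg])
  also have "\<dots> = 0\<^sub>m n n" unfolding Z using U UT by simp
  finally have "R - S = 0\<^sub>m n n" by (simp add: D_def)
  then have "R - S + S = S" using S' by simp
  moreover have "R - S + S = R" by (rule eq_matI) (use R' S' in auto)
  ultimately show ?thesis by simp
qed

lemma spd_sqrt:
  assumes "spd n B"
  shows "spd n (spd_sqrt n B)" "spd_sqrt n B * spd_sqrt n B = B"
proof -
  have "\<exists>!R. spd n R \<and> R * R = B" using spd_has_sqrt[OF assms] spd_sqrt_unique by blast
  from theI'[OF this] show "spd n (spd_sqrt n B)" "spd_sqrt n B * spd_sqrt n B = B"
    unfolding spd_sqrt_def by auto
qed

subsection \<open>Eigenvalues of symmetric definite pencils\<close>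

text \<open>With R the square root of M, an orthogonal U diagonalizes R^(-1) A R^(-1). Then T =
  R^(-1) U has M-orthonormal columns that are eigenvectors of the pencil, and its inverse is U^T
  R.\<close>

lemma simultaneous_diagonalization:
  fixes A :: "real mat"
  assumes A: "A \<in> carrier_mat n n" "A\<^sup>T = A" and "spd n M"
  shows "\<exists>T T' d. T \<in> carrier_mat n n \<and> T' \<in> carrier_mat n n \<and> T * T' = 1\<^sub>m n \<and> T' * T = 1\<^sub>m n \<and>
    T\<^sup>T * A * T = diagm n d \<and> T\<^sup>T * M * T = 1\<^sub>m n"
proof -
  define R where "R = spd_sqrt n M"
  have "spd n R" and RR: "R * R = M" using spd_sqrt[OF assms(3)] by (auto simp: R_def)
  note R = spdD[OF this(1)]
  define X where "X = mat_inv R"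
  have X: "X \<in> carrier_mat n n" "X\<^sup>T = X" "R * X = 1\<^sub>m n" "X * R = 1\<^sub>m n"
    using spd_mat_inv[OF \<open>spd n R\<close>] spd_mat_inv_symmetric[OF \<open>spd n R\<close>] by (auto simp: X_def)
  define K where "K = X * A * X"
  have K: "K \<in> carrier_mat n n" using X A by (simp add: K_def)
  have KT: "K\<^sup>T = K"
    unfolding K_def using X A by (simp add: transpose_mult[of _ n n _ n] assoc_mult_mat[of _ n n _ n _ n])
  obtain U d where U: "U \<in> carrier_mat n n" "U\<^sup>T * U = 1\<^sub>m n" "U * U\<^sup>T = 1\<^sub>m n"
    and D: "U\<^sup>T * K * U = diagm n d" using symmetric_spectral[OF K KT] by auto
  have UT: "U\<^sup>T \<in> carrier_mat n n" using U by simp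
  have TT: "(X * U)\<^sup>T = U\<^sup>T * X" using X U by (simp add: transpose_mult[of _ n n _ n])
  have "(X * U)\<^sup>T * A * (X * U) = diagm n d"
    unfolding TT D[symmetric] K_def using X(1) U(1) UT A(1) by (simp add: assoc_mult_mat[of _ n n _ n _ n])
  moreover have "(X * U)\<^sup>T * M * (X * U) = U\<^sup>T * (X * R) * (R * X) * U"
    unfolding TT RR[symmetric] using X(1) U(1) UT R(1) by (simp add: assoc_mult_mat[of _ n n _ n _ n])
  then have "(X * U)\<^sup>T * M * (X * U) = 1\<^sub>m n" using X U UT by simp
  moreover have "(X * U) * (U\<^sup>T * R) = X * (U * U\<^sup>T) * R" "(U\<^sup>T * R) * (X * U) = U\<^sup>T * (R * X) * U"
    using X(1) U(1) UT R(1) by (simp_all add: assoc_mult_mat[of _ n n _ n _ n])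
  then have "(X * U) * (U\<^sup>T * R) = 1\<^sub>m n" "(U\<^sup>T * R) * (X * U) = 1\<^sub>m n" using X U UT R by simp_all
  moreover have "X * U \<in> carrier_mat n n" "U\<^sup>T * R \<in> carrier_mat n n" using X U UT R by auto
  ultimately show ?thesis by blast
qed

lemma det_diagm: "det (diagm n d) = (\<Prod>i<n. d i)"
proof -
  have "det (diagm n d) = prod_list (diag_mat (diagm n d))"
    by (rule det_upper_triangular[of _ n]) (auto simp: diagm_def)
  also have "\<dots> = (\<Prod>i<n. d i)"
    by (simp add: diag_mat_def prod.list_conv_set_nth diagm_def atLeast0LessThan)
  finally show ?thesis .
qed

lemma prod_sub_eq_0_iff:
  fixes f :: "'a \<Rightarrow> real"
  assumes "finite I"
  shows "(\<Prod>i\<in>I. f i - t) = 0 \<longleftrightarrow> (\<exists>i\<in>I. f i = t)"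
  using assms by (auto simp: prod_zero_iff)

text \<open>At t = a the common factor vanishes and cannot be divided out pointwise, so the
  cancellation is done between polynomials, which form an integral domain.\<close>

lemma prod_sub_eq_cancel:
  fixes f :: "'a \<Rightarrow> real" and g :: "'b \<Rightarrow> real"
  assumes "finite I" "finite J" and i: "i0 \<in> I" "j0 \<in> J" "f i0 = a" "g j0 = a"
    and eq: "\<And>t. (\<Prod>i\<in>I. f i - t) = (\<Prod>j\<in>J. g j - t)"
  shows "(\<Prod>i\<in>I - {i0}. f i - t) = (\<Prod>j\<in>J - {j0}. g j - t)"
proof -
  define p where "p = (\<Prod>i\<in>I - {i0}. [:f i, -1:])"
  define q where "q = (\<Prod>j\<in>J - {j0}. [:g j, -1:])"
  have "(a - t) * poly p t = (a - t) * poly q t" for t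
    using eq[of t] assms(1,2) i prod.remove[of I i0 "\<lambda>i. f i - t"] prod.remove[of J j0 "\<lambda>j. g j - t"]
    unfolding p_def q_def poly_prod by simp
  then have "poly ([:a, -1:] * p) t = poly ([:a, -1:] * q) t" for t
    unfolding poly_mult by simp
  then have "[:a, -1:] * p = [:a, -1:] * q" by (simp only: poly_eq_poly_eq_iff[symmetric] fun_eq_iff) blast
  then have "p = q" by (metis mult_left_cancel pCons_eq_0_iff zero_neq_neg_one)
  then have "poly p t = poly q t" by simp
  then show ?thesis by (simp add: p_def q_def poly_prod)
qed

text \<open>In the coordinates y given by T, the forms become the sums of d i y_i^2 and of y_i^2,
  and the numbers d i are the eigenvalues l j with the same multiplicities. As l 1 is simple, u has
  a single nonzero coordinate, and orthogonality to A u removes exactly that coordinate from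
  x.\<close>

lemma pencil_bounds:
  assumes A: "spd n A" and M: "spd n M" and n: "2 \<le> n"
    and ev: "pencil_eigenvalues n A M l" and l12: "l 1 < l 2"
    and mono: "\<And>i j. 1 \<le> i \<Longrightarrow> i \<le> j \<Longrightarrow> j \<le> n \<Longrightarrow> l i \<le> l j"
    and u: "u \<in> carrier_vec n" "u \<noteq> 0\<^sub>v n" "A *\<^sub>v u = l 1 \<cdot>\<^sub>v (M *\<^sub>v u)"
    and x: "x \<in> carrier_vec n"
  shows "l 1 * quad M x \<le> quad A x" "quad A x \<le> l n * quad M x"
    "x \<bullet> (A *\<^sub>v u) = 0 \<Longrightarrow> l 2 * quad M x \<le> quad A x"
proof -
  note A' = spdD[OF A] and M' = spdD[OF M]
  obtain T T' d where T: "T \<in> carrier_mat n n" "T' \<in> carrier_mat n n" "T * T' = 1\<^sub>m n" "T' * T = 1\<^sub>m n"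
    and TA: "T\<^sup>T * A * T = diagm n d" and TM: "T\<^sup>T * M * T = 1\<^sub>m n"
    using simultaneous_diagonalization[OF A'(1,2) M] by blast
  have TT: "T\<^sup>T \<in> carrier_mat n n" using T by simp
  \<comment> \<open>This factor turns the leading coefficient det M of the characteristic polynomial
    of the pencil into 1.\<close>
  have dM: "det T * det T * det M = 1"
    using arg_cong[OF TM, of det] T TT M'(1) by (simp add: det_mult[of _ n] det_transpose[of _ n] mult_ac)
  have chr: "(\<Prod>i<n. d i - t) = (\<Prod>i=1..n. l i - t)" for t
  proof -
    have "T\<^sup>T * (A - t \<cdot>\<^sub>m M) * T = T\<^sup>T * A * T - t \<cdot>\<^sub>m (T\<^sup>T * M * T)"
      using T TT A'(1) M'(1)
      by (simp add: mult_minus_distrib_mat[of _ n n _ n] minus_mult_distrib_mat[of _ n n _ _ n]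
          mult_smult_distrib[of _ n n _ n] mult_smult_assoc_mat[of _ n n _ n])
    also have "\<dots> = diagm n (\<lambda>i. d i - t)"
      unfolding TA TM by (rule eq_matI) (auto simp: diagm_def)
    finally have *: "det (T\<^sup>T * (A - t \<cdot>\<^sub>m M) * T) = (\<Prod>i<n. d i - t)" by (simp add: det_diagm)
    have AM: "A - t \<cdot>\<^sub>m M \<in> carrier_mat n n" by (rule minus_carrier_mat) (use M' in simp)
    have "(\<Prod>i<n. d i - t) = det T * det T * det (A - t \<cdot>\<^sub>m M)"
      unfolding *[symmetric] det_mult[OF mult_carrier_mat[OF TT AM] T(1)] det_mult[OF TT AM]
        det_transpose[OF T(1)] by (simp add: mult_ac)
    also have "\<dots> = det T * det T * det M * (\<Prod>i=1..n. l i - t)"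
      using ev unfolding pencil_eigenvalues_def by simp
    finally show ?thesis using dM by simp
  qed
  have dl: "\<exists>j\<in>{1..n}. l j = d i" if "i < n" for i
    using chr[of "d i"] that prod_sub_eq_0_iff[of "{..<n}" d "d i"] prod_sub_eq_0_iff[of "{1..n}" l "d i"]
    by auto
  obtain i0 where i0: "i0 < n" "d i0 = l 1"
    using chr[of "l 1"] n prod_sub_eq_0_iff[of "{..<n}" d "l 1"] prod_sub_eq_0_iff[of "{1..n}" l "l 1"]
    by auto
  \<comment> \<open>After one factor with root l 1 is removed on each side, every remaining root on
    the right is some l j with j \<ge> 2. This is where multiplicities count.\<close>
  have d2: "l 2 \<le> d i" if i: "i < n" "i \<noteq> i0" for i
  proof -
    have "(\<Prod>i\<in>{..<n} - {i0}. d i - t) = (\<Prod>j\<in>{1..n} - {1}. l j - t)" for t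
      by (rule prod_sub_eq_cancel[of _ _ _ _ _ "l 1"]) (use i0 n chr in auto)
    from this[of "d i"] have "(\<Prod>j\<in>{1..n} - {1}. l j - d i) = 0"
      using i prod_sub_eq_0_iff[of "{..<n} - {i0}" d "d i"] by auto
    then have "\<exists>j\<in>{1..n} - {1}. l j = d i" by (rule prod_sub_eq_0_iff[THEN iffD1, rotated]) simp
    then obtain j where "j \<in> {1..n} - {1}" "l j = d i" by blast
    then show ?thesis using mono[of 2 j] by auto
  qed
  define y where "y = T' *\<^sub>v x"
  have y: "y \<in> carrier_vec n" using T x by (simp add: y_def)
  have xy: "x = T *\<^sub>v y" using mult_inverse_vec[OF T(1-3) x] by (simp add: y_def)
  have qA: "quad A x = (\<Sum>i<n. d i * (y $ i)\<^sup>2)"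
    using quad_congruence[OF T(1) A'(1) y] quad_diagm[OF y, of d] unfolding TA xy by simp
  have qM: "quad M x = (\<Sum>i<n. (y $ i)\<^sup>2)"
  proof -
    have "quad M x = y \<bullet> y"
      using quad_congruence[OF T(1) M'(1) y] quad_one[OF y] unfolding TM xy by simp
    then show ?thesis using y by (simp add: scalar_prod_def power2_eq_square atLeast0LessThan)
  qed
  have d_bounds: "l 1 \<le> d i \<and> d i \<le> l n" if "i < n" for i
    using dl[OF that] mono by (metis atLeastAtMost_iff order_refl)
  show "l 1 * quad M x \<le> quad A x" "quad A x \<le> l n * quad M x"
    unfolding qA qM sum_distrib_left using d_bounds by (auto intro!: sum_mono mult_right_mono)
  assume orth: "x \<bullet> (A *\<^sub>v u) = 0"
  define w where "w = T' *\<^sub>v u"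
  have w: "w \<in> carrier_vec n" using T u by (simp add: w_def)
  have uw: "u = T *\<^sub>v w" using mult_inverse_vec[OF T(1-3) u(1)] by (simp add: w_def)
  have Dw: "T\<^sup>T *\<^sub>v (A *\<^sub>v u) = diagm n d *\<^sub>v w"
    unfolding TA[symmetric] uw using T TT A'(1) w by (simp add: assoc_mult_mat_vec[of _ n n _ n])
  have Mw: "T\<^sup>T *\<^sub>v (M *\<^sub>v u) = w"
  proof -
    have "T\<^sup>T *\<^sub>v (M *\<^sub>v u) = (T\<^sup>T * M * T) *\<^sub>v w"
      unfolding uw using T TT M'(1) w by (simp add: assoc_mult_mat_vec[of _ n n _ n])
    then show ?thesis using w by (simp add: TM)
  qed
  have Dlw: "diagm n d *\<^sub>v w = l 1 \<cdot>\<^sub>v w"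
    using Dw u(3) Mw TT M'(1) u(1) by (simp add: mult_mat_vec[of _ n n])
  have dw: "d i * w $ i = l 1 * w $ i" if "i < n" for i
  proof -
    have "(diagm n d *\<^sub>v w) $ i = (l 1 \<cdot>\<^sub>v w) $ i" using Dlw by simp
    then show ?thesis using that w by (simp add: diagm_mult_vec_index del: index_mult_mat_vec)
  qed
  have w0: "w $ i = 0" if "i < n" "i \<noteq> i0" for i
    using dw[OF that(1)] d2[OF that] l12 by auto
  have "w \<noteq> 0\<^sub>v n" using u(2) uw mult_mat_zero_vec[OF T(1)] by metis
  then obtain i where "i < n" "w $ i \<noteq> 0" using w by (metis eq_vecI carrier_vecD index_zero_vec)
  with w0 have wi0: "w $ i0 \<noteq> 0" by metis
  \<comment> \<open>Here l 1 is known to be nonzero only through the definiteness of A.\<close>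
  have l1: "l 1 \<noteq> 0"
  proof
    assume "l 1 = 0"
    then have "A *\<^sub>v u = 0\<^sub>v n" using u(1) u(3) M'(1) by auto
    then show False using A'(3)[OF u(1,2)] u(1) by (simp add: quad_def)
  qed
  have "0 = y \<bullet> (T\<^sup>T *\<^sub>v (A *\<^sub>v u))"
  proof -
    have Au: "A *\<^sub>v u \<in> carrier_vec n" using A'(1) u(1) by (rule mult_mat_vec_carrier)
    have "(T\<^sup>T *\<^sub>v (A *\<^sub>v u)) \<bullet> y = (A *\<^sub>v u) \<bullet> x"
      unfolding xy by (rule transpose_vec_mult_scalar[OF T(1) y Au])
    also have "\<dots> = 0" using orth comm_scalar_prod[OF x Au] by simp
    finally show ?thesis using comm_scalar_prod[of y n "T\<^sup>T *\<^sub>v (A *\<^sub>v u)"] y TT Au by simp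
  qed
  also have "\<dots> = (\<Sum>i<n. y $ i * (l 1 * w $ i))"
    unfolding Dw Dlw using w y by (simp add: scalar_prod_def atLeast0LessThan)
  also have "\<dots> = (\<Sum>i\<in>{i0}. y $ i * (l 1 * w $ i))"
    by (rule sum.mono_neutral_right) (use i0 w0 in auto)
  finally have y0: "y $ i0 = 0" using wi0 l1 by simp
  show "l 2 * quad M x \<le> quad A x"
    unfolding qA qM sum_distrib_left
  proof (rule sum_mono)
    fix i assume "i \<in> {..<n}"
    then show "l 2 * (y $ i)\<^sup>2 \<le> d i * (y $ i)\<^sup>2"
      using d2[of i] y0 by (cases "i = i0") (auto intro: mult_right_mono)
  qed
qed

text \<open>The columns of T are eigenvectors of B^(-1) A = T D T^(-1), where D =
  \<open>diagm n d\<close>. So all d i lie in the finite set \<open>S\<close>, hence between its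
  minimum and maximum, and both bounds follow coordinatewise. The minimum is positive because its
  eigenvector v satisfies A v = Min S B v.\<close>

lemma spectrum_bounds:
  assumes A: "spd n A" and B: "spd n B" and n: "0 < n"
  defines "S \<equiv> spectrum (mat_inv B * A)"
  shows "0 < Min S" "\<And>x. x \<in> carrier_vec n \<Longrightarrow> Min S * quad B x \<le> quad A x"
    "\<And>x. x \<in> carrier_vec n \<Longrightarrow> quad A x \<le> Max S * quad B x"
proof -
  note A' = spdD[OF A] and B' = spdD[OF B] and I = spd_mat_inv[OF B]
  obtain T T' d where T: "T \<in> carrier_mat n n" "T' \<in> carrier_mat n n" "T * T' = 1\<^sub>m n" "T' * T = 1\<^sub>m n"
    and TA: "T\<^sup>T * A * T = diagm n d" and TB: "T\<^sup>T * B * T = 1\<^sub>m n"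
    using simultaneous_diagonalization[OF A'(1,2) B] by blast
  have TT: "T\<^sup>T \<in> carrier_mat n n" using T by simp
  have K: "mat_inv B * A \<in> carrier_mat n n" using I A' by simp
  have fin: "finite S" unfolding S_def by (rule card_finite_spectrum(1)[OF K])
  have "mat_inv B * A = T * diagm n d * T'"
  proof -
    have "mat_inv B = T * T\<^sup>T"
    proof (rule inverse_unique[of B n])
      have TB': "T\<^sup>T * B = T'"
      proof (rule inverse_unique[of T n])
        show "T\<^sup>T * B * T = 1\<^sub>m n" using TB .
      qed (use T TT B' in auto)
      have "B * (T * T\<^sup>T) = (T * T\<^sup>T * B)\<^sup>T"
        using T TT B' by (simp add: transpose_mult[of _ n n _ n] assoc_mult_mat[of _ n n _ n _ n])
      also have "T * T\<^sup>T * B = 1\<^sub>m n" using T TT B' TB' by (simp add: assoc_mult_mat[of _ n n _ n _ n])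
      finally show "B * (T * T\<^sup>T) = 1\<^sub>m n" by simp
    qed (use I T TT B' in auto)
    moreover have "T * diagm n d * T' = T * T\<^sup>T * A * (T * T')"
      unfolding TA[symmetric] using T(1,2) TT A'(1) by (simp add: assoc_mult_mat[of _ n n _ n _ n])
    ultimately show ?thesis using T TT A' by simp
  qed
  then have KT: "mat_inv B * A * T = T * diagm n d"
    using T(1,2,4) diagm_carrier[of n d] by (simp add: assoc_mult_mat[of _ n n _ n _ n] mult_carrier_mat[of _ n n])
  have dS: "d i \<in> S" if i: "i < n" for i
  proof -
    define v where "v = T *\<^sub>v unit_vec n i"
    have v: "v \<in> carrier_vec n" using T by (simp add: v_def)
    have "T' *\<^sub>v v = unit_vec n i" using mult_inverse_vec[OF T(2,1,4)] by (simp add: v_def)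
    then have "v \<noteq> 0\<^sub>v n" using mult_mat_zero_vec[OF T(2)] i unit_vec_nonzero[of i n] by metis
    moreover have "mat_inv B * A *\<^sub>v v = d i \<cdot>\<^sub>v v"
    proof -
      have "mat_inv B * A *\<^sub>v v = (mat_inv B * A * T) *\<^sub>v unit_vec n i"
        unfolding v_def using K T by (simp add: assoc_mult_mat_vec[of "mat_inv B * A" n n T n])
      also have "\<dots> = T *\<^sub>v (d i \<cdot>\<^sub>v unit_vec n i)"
        unfolding KT using T by (simp add: assoc_mult_mat_vec[of _ n n _ n] diagm_unit_vec[OF i])
      also have "\<dots> = d i \<cdot>\<^sub>v v" unfolding v_def using T by (simp add: mult_mat_vec[of _ n n])
      finally show ?thesis .
    qed
    ultimately show ?thesis
      using K I v unfolding S_def spectrum_def eigenvalue_def eigenvector_def by auto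
  qed
  have "S \<noteq> {}" using dS n by blast
  then have "Min S \<in> S" using fin by simp
  then obtain v where v: "v \<in> carrier_vec n" "v \<noteq> 0\<^sub>v n" "mat_inv B * A *\<^sub>v v = Min S \<cdot>\<^sub>v v"
    using I unfolding S_def spectrum_def eigenvalue_def eigenvector_def by auto
  have "B *\<^sub>v (mat_inv B * A *\<^sub>v v) = A *\<^sub>v v"
    using mult_inverse_vec[OF B'(1) I(3,1), of "A *\<^sub>v v"] I(3) A'(1) v
    by (simp add: assoc_mult_mat_vec[of _ n n _ n])
  then have "A *\<^sub>v v = Min S \<cdot>\<^sub>v (B *\<^sub>v v)"
    unfolding v(3) using I(3) A'(1) B'(1) v(1) by (simp add: mult_mat_vec[of _ n n])
  then have "quad A v = Min S * quad B v" unfolding quad_def using B' v by simp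
  then show "0 < Min S" using A'(3)[OF v(1,2)] B'(3)[OF v(1,2)] by (simp add: zero_less_mult_iff)
  fix x :: "real vec" assume x: "x \<in> carrier_vec n"
  define y where "y = T' *\<^sub>v x"
  have y: "y \<in> carrier_vec n" using T x by (simp add: y_def)
  have xy: "x = T *\<^sub>v y" using mult_inverse_vec[OF T(1-3) x] by (simp add: y_def)
  have qA: "quad A x = (\<Sum>i<n. d i * (y $ i)\<^sup>2)"
    using quad_congruence[OF T(1) A'(1) y] quad_diagm[OF y, of d] unfolding TA xy by simp
  have qB: "quad B x = (\<Sum>i<n. (y $ i)\<^sup>2)"
  proof -
    have "quad B x = y \<bullet> y"
      using quad_congruence[OF T(1) B'(1) y] quad_one[OF y] unfolding TB xy by simp
    then show ?thesis using y by (simp add: scalar_prod_def power2_eq_square atLeast0LessThan)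
  qed
  show "Min S * quad B x \<le> quad A x" "quad A x \<le> Max S * quad B x"
    unfolding qA qB sum_distrib_left using dS fin by (auto intro!: sum_mono mult_right_mono)
qed

subsection \<open>Geometry of the sublevel set\<close>

definition bil :: "real mat \<Rightarrow> real vec \<Rightarrow> real vec \<Rightarrow> real" where
  "bil M x y = x \<bullet> (M *\<^sub>v y)"

lemma abs_le_of_square_le: "x\<^sup>2 \<le> y\<^sup>2 \<Longrightarrow> 0 \<le> y \<Longrightarrow> \<bar>x\<bar> \<le> (y :: real)"
  by (metis abs_le_square_iff abs_of_nonneg)

lemma square_le_of_abs_le: "\<bar>x\<bar> \<le> y \<Longrightarrow> x\<^sup>2 \<le> (y :: real)\<^sup>2"
  by (metis abs_le_square_iff abs_ge_self order_trans)

locale vec_dim =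
  fixes n :: nat
begin

abbreviation V :: "real vec set" where "V \<equiv> carrier_vec n"
definition SM :: "real mat set" where "SM = {M \<in> carrier_mat n n. M\<^sup>T = M}"

lemma SM_D: "M \<in> SM \<Longrightarrow> M \<in> carrier_mat n n" "M \<in> SM \<Longrightarrow> M\<^sup>T = M"
  by (auto simp: SM_def)

lemma SM_mult_carrier [simp]: "M \<in> SM \<Longrightarrow> x \<in> V \<Longrightarrow> M *\<^sub>v x \<in> V"
  by (auto dest: SM_D)

lemma bil_add_left [simp]:
  "M \<in> SM \<Longrightarrow> x \<in> V \<Longrightarrow> y \<in> V \<Longrightarrow> z \<in> V \<Longrightarrow> bil M (x + y) z = bil M x z + bil M y z"
  unfolding bil_def by (rule add_scalar_prod_distrib[of _ n]) auto

lemma bil_add_right [simp]: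
  "M \<in> SM \<Longrightarrow> x \<in> V \<Longrightarrow> y \<in> V \<Longrightarrow> z \<in> V \<Longrightarrow> bil M z (x + y) = bil M z x + bil M z y"
  unfolding bil_def by (simp add: SM_D mult_add_distrib_mat_vec[of _ n n] scalar_prod_add_distrib[of _ n])

lemma bil_minus_left [simp]:
  "M \<in> SM \<Longrightarrow> x \<in> V \<Longrightarrow> y \<in> V \<Longrightarrow> z \<in> V \<Longrightarrow> bil M (x - y) z = bil M x z - bil M y z"
  unfolding bil_def by (rule minus_scalar_prod_distrib[of _ n]) auto

lemma bil_minus_right [simp]:
  "M \<in> SM \<Longrightarrow> x \<in> V \<Longrightarrow> y \<in> V \<Longrightarrow> z \<in> V \<Longrightarrow> bil M z (x - y) = bil M z x - bil M z y"
  unfolding bil_def by (simp add: SM_D mult_minus_distrib_mat_vec[of _ n n] scalar_prod_minus_distrib[of _ n])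

lemma bil_smult_left [simp]:
  "M \<in> SM \<Longrightarrow> x \<in> V \<Longrightarrow> z \<in> V \<Longrightarrow> bil M (c \<cdot>\<^sub>v x) z = c * bil M x z"
  unfolding bil_def by (rule smult_scalar_prod_distrib[of _ n]) auto

lemma bil_smult_right [simp]:
  "M \<in> SM \<Longrightarrow> x \<in> V \<Longrightarrow> z \<in> V \<Longrightarrow> bil M z (c \<cdot>\<^sub>v x) = c * bil M z x"
  unfolding bil_def by (simp add: SM_D mult_mat_vec[of _ n n] scalar_prod_smult_distrib[of _ n])

lemma bil_sym: "M \<in> SM \<Longrightarrow> x \<in> V \<Longrightarrow> y \<in> V \<Longrightarrow> bil M x y = bil M y x"
  unfolding bil_def by (rule symmetric_scalar_prod) (auto simp: SM_D)

lemma quad_bil: "quad M x = bil M x x"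
  by (simp add: quad_def bil_def)

lemma quad_comb:
  assumes "M \<in> SM" "x \<in> V" "y \<in> V"
  shows "quad M (c \<cdot>\<^sub>v x + d \<cdot>\<^sub>v y) = c\<^sup>2 * quad M x + 2 * c * d * bil M x y + d\<^sup>2 * quad M y"
  using assms bil_sym[OF assms(1,3,2)]
  by (simp add: quad_bil power2_eq_square algebra_simps)

lemma quad_add:
  assumes "M \<in> SM" "x \<in> V" "y \<in> V"
  shows "quad M (x + y) = quad M x + 2 * bil M x y + quad M y"
  using assms bil_sym[OF assms(1,3,2)] by (simp add: quad_bil)

lemma quad_smult: "M \<in> SM \<Longrightarrow> x \<in> V \<Longrightarrow> quad M (c \<cdot>\<^sub>v x) = c\<^sup>2 * quad M x"
  by (simp add: quad_bil power2_eq_square)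

lemma one_SM [simp]: "1\<^sub>m n \<in> SM" by (simp add: SM_def)

lemma dot_bil: "x \<in> V \<Longrightarrow> y \<in> V \<Longrightarrow> x \<bullet> y = bil (1\<^sub>m n) x y"
  by (simp add: bil_def)

lemma cauchy_schwarz_psd:
  assumes M: "M \<in> SM" and psd: "\<And>x. x \<in> V \<Longrightarrow> 0 \<le> quad M x"
    and x: "x \<in> V" and y: "y \<in> V"
  shows "(bil M x y)\<^sup>2 \<le> quad M x * quad M y"
proof -
  have pos: "0 \<le> quad M x + 2 * t * bil M x y + t\<^sup>2 * quad M y" for t
    using psd[of "1 \<cdot>\<^sub>v x + t \<cdot>\<^sub>v y"] quad_comb[OF M x y, of 1 t] x y by simp
  show ?thesis
  proof (cases "quad M y = 0")
    case True
    have "bil M x y = 0"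
    proof (rule ccontr)
      assume nz: "bil M x y \<noteq> 0"
      \<comment> \<open>This t makes the nonnegative expression, which is linear in t when
        \<open>quad M y = 0\<close>, equal to -1.\<close>
      from pos[of "- (quad M x + 1) / (2 * bil M x y)"] nz show False by (simp add: True field_simps)
    qed
    with True show ?thesis by simp
  next
    case False
    with psd[OF y] have qy: "quad M y > 0" by simp
    have "0 \<le> quad M y * (quad M x + 2 * (- bil M x y / quad M y) * bil M x y
        + (- bil M x y / quad M y)\<^sup>2 * quad M y)"
      by (rule mult_nonneg_nonneg[OF less_imp_le[OF qy] pos])
    also have "\<dots> = quad M x * quad M y - (bil M x y)\<^sup>2"
      using qy by (simp add: field_simps power2_eq_square)
    finally show ?thesis by simp
  qed
qed

text \<open>Infima of real sets are meaningful only for nonempty sets, so those over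
  \<open>orth n x\<close> need a witness: swap two coordinates of x, one of them nonzero, and change
  a sign.\<close>

lemma orth_nonempty:
  assumes x: "x \<in> V" "x \<noteq> 0\<^sub>v n" and n: "2 \<le> n"
  shows "orth n x \<noteq> {}"
proof -
  obtain i where i: "i < n" "x $ i \<noteq> 0" using x by (metis eq_vecI carrier_vecD index_zero_vec)
  define j where "j = (if i = 0 then 1 else 0 :: nat)"
  have j: "j < n" "j \<noteq> i" using n by (auto simp: j_def)
  define v where "v = x $ j \<cdot>\<^sub>v unit_vec n i - x $ i \<cdot>\<^sub>v unit_vec n j"
  have v: "v \<in> V" by (simp add: v_def)
  have "v \<bullet> x = 0"
    unfolding v_def using x i j by (simp add: minus_scalar_prod_distrib[of _ n])
  moreover have "v $ j = - x $ i" using i j by (simp add: v_def)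
  then have "v \<noteq> 0\<^sub>v n" using i j by auto
  ultimately have "v \<in> orth n x" using v by (simp add: orth_def)
  then show ?thesis by blast
qed

end

section \<open>Nested infima of real functions\<close>

text \<open>Real infima require sets bounded below. One uniform bound m serves both levels: it
  bounds the inner sets, and through their nonemptiness also the set of inner infima.\<close>

lemma INF2_lower:
  fixes f :: "'a \<Rightarrow> 'b \<Rightarrow> real"
  assumes "\<And>x v. x \<in> X \<Longrightarrow> v \<in> Y x \<Longrightarrow> m \<le> f x v" "\<And>x. x \<in> X \<Longrightarrow> Y x \<noteq> {}"
    and "x \<in> X" "v \<in> Y x"
  shows "(INF x\<in>X. INF v\<in>Y x. f x v) \<le> f x v"
proof -
  have "(INF x\<in>X. INF v\<in>Y x. f x v) \<le> (INF v\<in>Y x. f x v)"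
    by (rule cINF_lower[OF _ assms(3)]) (use assms in \<open>auto intro!: bdd_belowI2 cINF_greatest\<close>)
  also have "\<dots> \<le> f x v"
    by (rule cINF_lower[OF _ assms(4)]) (use assms in \<open>auto intro!: bdd_belowI2\<close>)
  finally show ?thesis .
qed

lemma INF2_greatest:
  fixes f :: "'a \<Rightarrow> 'b \<Rightarrow> real"
  assumes "\<And>x v. x \<in> X \<Longrightarrow> v \<in> Y x \<Longrightarrow> m \<le> f x v" "\<And>x. x \<in> X \<Longrightarrow> Y x \<noteq> {}" "X \<noteq> {}"
  shows "m \<le> (INF x\<in>X. INF v\<in>Y x. f x v)"
  using assms by (auto intro!: cINF_greatest)

section \<open>The preconditioned pencil and its sublevel set\<close>

text \<open>The spectral data enter only as inequalities between quadratic forms and the equation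
  for u. The numbers a and b stand for the extreme eigenvalues of B^(-1) A, and
  \<open>PQ_compl\<close> is the variational bound by the second eigenvalue on the P-orthogonal
  complement of u. Definiteness of Q is a consequence of \<open>PQ_upper\<close>.\<close>

locale rq_pencil = vec_dim +
  fixes P Q :: "real mat" and u :: "real vec" and a b l1 l2 ln \<rho> :: real
  assumes n2: "2 \<le> n" and P: "P \<in> SM" and Q: "Q \<in> SM"
    and u: "u \<in> V" "u \<bullet> u = 1"
    and a_pos: "0 < a" and P_lower: "\<And>x. x \<in> V \<Longrightarrow> a * (x \<bullet> x) \<le> quad P x"
    and P_upper: "\<And>x. x \<in> V \<Longrightarrow> quad P x \<le> b * (x \<bullet> x)"
    and l: "0 < l1" "l1 < l2" "l2 \<le> ln"
    and PQ_lower: "\<And>x. x \<in> V \<Longrightarrow> l1 * quad Q x \<le> quad P x"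
    and PQ_upper: "\<And>x. x \<in> V \<Longrightarrow> quad P x \<le> ln * quad Q x"
    and PQ_compl: "\<And>x. x \<in> V \<Longrightarrow> x \<bullet> (P *\<^sub>v u) = 0 \<Longrightarrow> l2 * quad Q x \<le> quad P x"
    and Pu: "P *\<^sub>v u = l1 \<cdot>\<^sub>v (Q *\<^sub>v u)"
    and \<rho>: "l1 \<le> \<rho>" "\<rho> < (l1 + l2) / 2"
begin

abbreviation "S \<equiv> sublevel n P Q \<rho>"

definition "\<sigma> = quad P u"
definition "\<epsilon> = (1 / l1 - 1 / \<rho>) / (1 / l1 - 1 / l2)"
definition "\<theta> = min_angle n P Q \<rho>"
definition "orq = orth_rq_inf n P Q \<rho>"
definition "smax = sublevel_max n P Q \<rho>"
definition "smin = sublevel_min n P Q \<rho>"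

lemma \<rho>_pos: "0 < \<rho>" and \<rho>_l2: "\<rho> < l2"
  using l \<rho> by auto

lemma P_pos: "x \<in> V \<Longrightarrow> x \<noteq> 0\<^sub>v n \<Longrightarrow> 0 < quad P x"
  using P_lower[of x] scalar_prod_self_pos[of x n] a_pos
  by (meson less_le_trans mult_pos_pos)

lemma P_nonneg: "x \<in> V \<Longrightarrow> 0 \<le> quad P x"
  using P_lower[of x] scalar_prod_self_nonneg[of x] a_pos
  by (meson mult_nonneg_nonneg less_imp_le order_trans)

lemma Q_pos: "x \<in> V \<Longrightarrow> x \<noteq> 0\<^sub>v n \<Longrightarrow> 0 < quad Q x"
  using PQ_upper[of x] P_pos[of x] l by (smt (verit) mult_nonneg_nonpos)

lemma Q_nonneg: "x \<in> V \<Longrightarrow> 0 \<le> quad Q x"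
  using PQ_upper[of x] P_nonneg[of x] l by (smt (verit) mult_pos_neg)

lemma u_nz: "u \<noteq> 0\<^sub>v n" using u by auto

lemma \<sigma>_pos: "0 < \<sigma>" unfolding \<sigma>_def by (rule P_pos[OF u(1) u_nz])

lemma a_le_\<sigma>: "a \<le> \<sigma>" and \<sigma>_le_b: "\<sigma> \<le> b"
  using P_lower[OF u(1)] P_upper[OF u(1)] u(2) by (auto simp: \<sigma>_def)

lemma b_pos: "0 < b" using a_pos a_le_\<sigma> \<sigma>_le_b by linarith

lemma bil_P_u: "x \<in> V \<Longrightarrow> bil P x u = l1 * bil Q x u"
  unfolding bil_def Pu using u Q by (simp add: scalar_prod_smult_distrib[of _ n])

lemma quad_Q_u: "quad Q u = \<sigma> / l1"
  using bil_P_u[OF u(1)] l by (simp add: \<sigma>_def quad_bil)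

lemma P_decomp:
  assumes x: "x \<in> V"
  obtains c z where "z \<in> V" "x = c \<cdot>\<^sub>v u + z" "bil P z u = 0"
proof
  define c where "c = bil P x u / \<sigma>"
  show "x - c \<cdot>\<^sub>v u \<in> V" using x u by simp
  show "x = c \<cdot>\<^sub>v u + (x - c \<cdot>\<^sub>v u)" by (rule eq_vecI) (use x u in auto)
  show "bil P (x - c \<cdot>\<^sub>v u) u = 0"
    using x u P \<sigma>_pos by (simp add: c_def \<sigma>_def quad_bil)
qed

text \<open>Since P u is a multiple of Q u, a vector P-orthogonal to u is also Q-orthogonal to it;
  both forms therefore split along the same decomposition.\<close>

lemma decomp_quad:
  assumes z: "z \<in> V" "bil P z u = 0"
  shows "quad P (c \<cdot>\<^sub>v u + z) = c\<^sup>2 * \<sigma> + quad P z"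
    "quad Q (c \<cdot>\<^sub>v u + z) = c\<^sup>2 * \<sigma> / l1 + quad Q z"
proof -
  have "bil Q z u = 0" using bil_P_u[OF z(1)] z(2) l by simp
  then have "bil Q u z = 0" "bil P u z = 0" using bil_sym z u P Q by metis+
  then show "quad P (c \<cdot>\<^sub>v u + z) = c\<^sup>2 * \<sigma> + quad P z"
    "quad Q (c \<cdot>\<^sub>v u + z) = c\<^sup>2 * \<sigma> / l1 + quad Q z"
    using z u P Q by (simp_all add: quad_add quad_smult \<sigma>_def[symmetric] quad_Q_u)
qed

lemma quad_Q_compl: "z \<in> V \<Longrightarrow> bil P z u = 0 \<Longrightarrow> quad Q z \<le> quad P z / l2"
  using PQ_compl[of z] l by (simp add: bil_def pos_le_divide_eq mult.commute)

lemma S_D: "x \<in> S \<Longrightarrow> x \<in> V" "x \<in> S \<Longrightarrow> x \<noteq> 0\<^sub>v n" "x \<in> S \<Longrightarrow> quad P x \<le> \<rho> * quad Q x"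
  using Q_pos[of x] by (auto simp: sublevel_def rq_def divide_le_eq)

lemma u_S: "u \<in> S"
  using u(1) u_nz \<rho>(1) l(1) \<sigma>_pos by (simp add: sublevel_def rq_def quad_Q_u \<sigma>_def[symmetric])

lemma inv_diff_pos: "0 < 1 / l1 - 1 / l2"
  using l by (simp add: field_simps)

lemma \<epsilon>_nonneg: "0 \<le> \<epsilon>"
  unfolding \<epsilon>_def by (rule divide_nonneg_pos[OF _ inv_diff_pos]) (use l \<rho> in \<open>simp add: field_simps\<close>)

text \<open>The relative distance of \<rho> from l1 is not only of order \<epsilon> but contains the
  factor gap. This is what lets the errors be absorbed into leading terms proportional to
  gap.\<close>

lemma \<epsilon>_gap: "\<epsilon> * ((l2 - l1) / l2) = 1 - l1 / \<rho>"
proof -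
  have "(l2 - l1) / l2 = l1 * (1 / l1 - 1 / l2)" using l by (simp add: field_simps)
  moreover have "\<epsilon> * (1 / l1 - 1 / l2) = 1 / l1 - 1 / \<rho>"
    unfolding \<epsilon>_def using inv_diff_pos by (metis less_irrefl nonzero_eq_divide_eq)
  ultimately have "\<epsilon> * ((l2 - l1) / l2) = l1 * (1 / l1 - 1 / \<rho>)"
    by (metis mult.left_commute)
  then show ?thesis using l by (simp only: right_diff_distrib) simp
qed

text \<open>The reciprocal of the Rayleigh quotient is at most the average of 1 / l1 and 1 / l2
  weighted by the shares of u and z in the P-energy. By its definition \<epsilon> is the weight of 1
  / l2 for which this average equals 1 / \<rho>, so a larger share of z would leave the sublevel
  set.\<close>

lemma sublevel_compl_small:
  assumes x: "c \<cdot>\<^sub>v u + z \<in> S" and z: "z \<in> V" "bil P z u = 0"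
  shows "quad P z \<le> \<epsilon> * quad P (c \<cdot>\<^sub>v u + z)"
proof -
  note d = decomp_quad[OF z]
  let ?p = "quad P (c \<cdot>\<^sub>v u + z)"
  have "?p / \<rho> \<le> quad Q (c \<cdot>\<^sub>v u + z)"
    using S_D(3)[OF x] \<rho>_pos by (simp add: divide_le_eq mult.commute)
  also have "\<dots> \<le> (?p - quad P z) / l1 + quad P z / l2"
    using d quad_Q_compl[OF z] l by (simp add: diff_divide_distrib)
  finally have "quad P z * (1 / l1 - 1 / l2) \<le> ?p * (1 / l1 - 1 / \<rho>)"
    by (simp add: algebra_simps diff_divide_distrib)
  then show ?thesis
    unfolding \<epsilon>_def using inv_diff_pos by (simp add: pos_le_divide_eq mult.commute)
qed

text \<open>Subtracting from v its P-projection onto x cannot decrease the Euclidean norm, as v and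
  x are Euclidean-orthogonal. The P-energy of the difference is thus at least a (v v), hence at
  least a / b times that of v, and Pythagoras in P turns this into a bound for the cosine.\<close>

lemma orth_P_angle:
  assumes x: "x \<in> V" "x \<noteq> 0\<^sub>v n" and v: "v \<in> V" "v \<bullet> x = 0"
  shows "(bil P v x)\<^sup>2 \<le> (1 - a / b) * quad P v * quad P x"
proof -
  define t where "t = bil P v x / quad P x"
  define w where "w = 1 \<cdot>\<^sub>v v + (- t) \<cdot>\<^sub>v x"
  have w: "w \<in> V" using x v by (simp add: w_def)
  have px: "quad P x > 0" by (rule P_pos[OF x])
  have "w \<bullet> w = v \<bullet> v + t\<^sup>2 * (x \<bullet> x)"
    using quad_comb[OF one_SM v(1) x(1), of 1 "- t"] v(2) w x v(1)
    by (simp add: quad_one w_def dot_bil)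
  then have "v \<bullet> v \<le> w \<bullet> w" using scalar_prod_self_nonneg[of x] by simp
  then have "a / b * quad P v \<le> a * (w \<bullet> w)"
    using P_upper[OF v(1)] a_pos b_pos
    by (smt (verit, best) mult.commute mult_left_mono pos_divide_le_eq times_divide_eq_left times_divide_eq_right)
  also have "\<dots> \<le> quad P w" by (rule P_lower[OF w])
  also have "\<dots> = quad P v - (bil P v x)\<^sup>2 / quad P x"
    unfolding w_def quad_comb[OF P v(1) x(1)] using px by (simp add: t_def power2_eq_square field_simps)
  finally show ?thesis using px by (simp add: field_simps)
qed

text \<open>The constant k stands for the cosine of an a priori bound on the angle, in the inner product
  of P, between Euclidean-orthogonal vectors one of which lies in the sublevel set.\<close>

lemma orth_coefficient:
  assumes k: "0 \<le> k" and K: "(bil P v x)\<^sup>2 \<le> k\<^sup>2 * quad P v * quad P x"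
    and x: "x \<in> S" and v: "c \<cdot>\<^sub>v u + z = v" "z \<in> V" "bil P z u = 0"
    and \<epsilon>1: "\<epsilon> < 1"
  shows "c\<^sup>2 * \<sigma> \<le> (k + sqrt \<epsilon>)\<^sup>2 / (1 - \<epsilon>) * quad P v"
proof -
  obtain d y where y: "y \<in> V" "x = d \<cdot>\<^sub>v u + y" "bil P y u = 0" using P_decomp S_D(1)[OF x] by metis
  have vV: "v \<in> V" using v u by auto
  note dv = decomp_quad[OF v(2,3), of c, unfolded v(1)] and dx = decomp_quad[OF y(1,3), of d, folded y(2)]
  have sm: "quad P y \<le> \<epsilon> * quad P x" using sublevel_compl_small[of d y] x y by simp
  have px: "quad P x > 0" by (rule P_pos[OF S_D(1,2)[OF x]])
  let ?N = "sqrt (quad P v * quad P x)"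
  have N: "?N\<^sup>2 = quad P v * quad P x" using P_nonneg[OF vV] px by simp
  have "(bil P v x)\<^sup>2 \<le> (k * ?N)\<^sup>2"
    using K unfolding power_mult_distrib N by (simp add: mult.assoc)
  then have 1: "\<bar>bil P v x\<bar> \<le> k * ?N"
    using k P_nonneg[OF vV] px by (intro abs_le_of_square_le) auto
  have "(bil P z y)\<^sup>2 \<le> quad P z * quad P y"
    by (rule cauchy_schwarz_psd[OF P P_nonneg v(2) y(1)])
  also have "\<dots> \<le> quad P v * (\<epsilon> * quad P x)"
    by (rule mult_mono) (use dv sm \<sigma>_pos P_nonneg vV y v in auto)
  also have "\<dots> = (sqrt \<epsilon> * ?N)\<^sup>2" unfolding power_mult_distrib N using \<epsilon>_nonneg by simp
  finally have 2: "\<bar>bil P z y\<bar> \<le> sqrt \<epsilon> * ?N"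
    using \<epsilon>_nonneg P_nonneg[OF vV] px by (intro abs_le_of_square_le) auto
  have uy: "bil P u y = 0" using bil_sym[OF P u(1) y(1)] y(3) by simp
  \<comment> \<open>The mixed terms vanish by P-orthogonality. As \<open>bil P v x\<close> and
    \<open>bil P z y\<close> are both small, so is the product of the coefficients; and since x lies
    almost along u, the coefficient d cannot be small, so c has to be.\<close>
  have "bil P v x = c * d * \<sigma> + bil P z y"
    unfolding v(1)[symmetric] y(2) using u v(2,3) y(1,3) P uy by (simp add: \<sigma>_def quad_bil)
  then have "\<bar>c * d * \<sigma>\<bar> \<le> (k + sqrt \<epsilon>) * ?N" using 1 2 by (simp add: algebra_simps)
  then have "(c * d * \<sigma>)\<^sup>2 \<le> ((k + sqrt \<epsilon>) * ?N)\<^sup>2" by (rule square_le_of_abs_le)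
  then have "(c\<^sup>2 * \<sigma>) * (d\<^sup>2 * \<sigma>) \<le> (k + sqrt \<epsilon>)\<^sup>2 * (quad P v * quad P x)"
    unfolding power_mult_distrib N by (simp add: power2_eq_square mult_ac)
  moreover have "d\<^sup>2 * \<sigma> \<ge> (1 - \<epsilon>) * quad P x" using dx sm by (simp add: algebra_simps)
  then have "(c\<^sup>2 * \<sigma>) * ((1 - \<epsilon>) * quad P x) \<le> (c\<^sup>2 * \<sigma>) * (d\<^sup>2 * \<sigma>)"
    by (rule mult_left_mono) (use \<sigma>_pos in simp)
  ultimately have "((c\<^sup>2 * \<sigma>) * (1 - \<epsilon>)) * quad P x \<le> ((k + sqrt \<epsilon>)\<^sup>2 * quad P v) * quad P x"
    by (simp add: mult_ac)
  then have "(c\<^sup>2 * \<sigma>) * (1 - \<epsilon>) \<le> (k + sqrt \<epsilon>)\<^sup>2 * quad P v" using px by simp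
  then show ?thesis using \<epsilon>1 by (simp add: pos_le_divide_eq)
qed

text \<open>The averaging of reciprocals used for the sublevel set, with the roles reversed: now the
  share of u in the P-energy is small, so the reciprocal of the Rayleigh quotient of v stays near 1
  / l2.\<close>

lemma orth_rq_bound:
  assumes k: "0 \<le> k" and K: "(bil P v x)\<^sup>2 \<le> k\<^sup>2 * quad P v * quad P x"
    and x: "x \<in> S" and v: "v \<in> orth n x" and \<epsilon>1: "\<epsilon> < 1"
  shows "quad Q v \<le> (1 / l2 + (k + sqrt \<epsilon>)\<^sup>2 / (1 - \<epsilon>) * (1 / l1 - 1 / l2)) * quad P v"
proof -
  have vV: "v \<in> V" using v by (simp add: orth_def)
  obtain c z where z: "z \<in> V" "v = c \<cdot>\<^sub>v u + z" "bil P z u = 0" using P_decomp vV by metis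
  have c: "c\<^sup>2 * \<sigma> \<le> (k + sqrt \<epsilon>)\<^sup>2 / (1 - \<epsilon>) * quad P v"
    by (rule orth_coefficient[OF k K x z(2)[symmetric] z(1,3) \<epsilon>1])
  note d = decomp_quad[OF z(1,3), of c, folded z(2)]
  have "quad Q v \<le> c\<^sup>2 * \<sigma> / l1 + (quad P v - c\<^sup>2 * \<sigma>) / l2"
    using d quad_Q_compl[OF z(1,3)] l by (simp add: diff_divide_distrib)
  also have "\<dots> = quad P v / l2 + c\<^sup>2 * \<sigma> * (1 / l1 - 1 / l2)" by (simp add: algebra_simps diff_divide_distrib)
  also have "\<dots> \<le> quad P v / l2 + (k + sqrt \<epsilon>)\<^sup>2 / (1 - \<epsilon>) * quad P v * (1 / l1 - 1 / l2)"
    using mult_right_mono[OF c, of "1 / l1 - 1 / l2"] inv_diff_pos by simp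
  finally show ?thesis by (simp add: algebra_simps)
qed

lemma orq_lower:
  assumes k: "0 \<le> k"
    and K: "\<And>x v. x \<in> S \<Longrightarrow> v \<in> orth n x \<Longrightarrow> (bil P v x)\<^sup>2 \<le> k\<^sup>2 * quad P v * quad P x"
    and \<epsilon>1: "\<epsilon> < 1"
  shows "1 / orq \<le> 1 / l2 + (k + sqrt \<epsilon>)\<^sup>2 / (1 - \<epsilon>) * (1 / l1 - 1 / l2)" "0 < orq"
proof -
  define D where "D = 1 / l2 + (k + sqrt \<epsilon>)\<^sup>2 / (1 - \<epsilon>) * (1 / l1 - 1 / l2)"
  have D: "D > 0" unfolding D_def using l inv_diff_pos \<epsilon>1
    by (intro add_pos_nonneg mult_nonneg_nonneg divide_nonneg_nonneg) auto
  have "1 / D \<le> orq"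
    unfolding orq_def orth_rq_inf_def
  proof (rule INF2_greatest)
    fix x v assume xv: "x \<in> S" "v \<in> orth n x"
    then have v: "v \<in> V" "v \<noteq> 0\<^sub>v n" by (auto simp: orth_def)
    show "1 / D \<le> rq P Q v"
      using orth_rq_bound[OF k K[OF xv] xv \<epsilon>1, folded D_def] Q_pos[OF v] D
      by (simp add: rq_def field_simps)
  qed (use u_S orth_nonempty n2 S_D in auto)
  with D show "0 < orq" by (meson less_le_trans zero_less_divide_1_iff)
  with D \<open>1 / D \<le> orq\<close> show "1 / orq \<le> 1 / l2 + (k + sqrt \<epsilon>)\<^sup>2 / (1 - \<epsilon>) * (1 / l1 - 1 / l2)"
    unfolding D_def[symmetric] by (simp add: field_simps)
qed

lemma orq_le:
  assumes "x \<in> S" "v \<in> orth n x"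
  shows "orq \<le> rq P Q v"
  unfolding orq_def orth_rq_inf_def
proof (rule INF2_lower[of S "orth n" 0 "\<lambda>_. rq P Q" x v])
  fix x v assume "x \<in> S" "v \<in> orth n x"
  then show "0 \<le> rq P Q v" using P_nonneg Q_nonneg by (auto simp: orth_def rq_def)
qed (use assms orth_nonempty n2 S_D in auto)

section \<open>The minimal angle and Euclidean norms on the sublevel set\<close>

lemma mnorm_ratio:
  assumes "x \<in> S" "v \<in> orth n x"
  shows "0 \<le> \<bar>v \<bullet> (P *\<^sub>v x)\<bar> / (mnorm P v * mnorm P x)" "\<bar>v \<bullet> (P *\<^sub>v x)\<bar> / (mnorm P v * mnorm P x) \<le> 1"
proof -
  have x: "x \<in> V" "x \<noteq> 0\<^sub>v n" and v: "v \<in> V" "v \<noteq> 0\<^sub>v n" using assms S_D by (auto simp: orth_def)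
  have pos: "mnorm P v * mnorm P x > 0" using P_pos[OF x] P_pos[OF v] by (simp add: mnorm_def)
  then show "0 \<le> \<bar>v \<bullet> (P *\<^sub>v x)\<bar> / (mnorm P v * mnorm P x)" by (simp add: zero_le_divide_iff)
  have "\<bar>bil P v x\<bar> \<le> sqrt (quad P v * quad P x)"
    using cauchy_schwarz_psd[OF P P_nonneg v(1) x(1)] by (metis real_sqrt_abs real_sqrt_le_iff)
  then show "\<bar>v \<bullet> (P *\<^sub>v x)\<bar> / (mnorm P v * mnorm P x) \<le> 1"
    using pos by (simp add: divide_le_eq mnorm_def bil_def real_sqrt_mult)
qed

text \<open>The range matters twice: on [0, pi] the cosine reverses inequalities between angles, and
  up to pi / 2 it is nonnegative, so that bounds may be squared.\<close>

lemma \<theta>_range: "0 \<le> \<theta>" "\<theta> \<le> pi / 2"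
proof -
  let ?f = "\<lambda>x v. arccos (\<bar>v \<bullet> (P *\<^sub>v x)\<bar> / (mnorm P v * mnorm P x))"
  have f: "0 \<le> ?f x v \<and> ?f x v \<le> pi / 2" if "x \<in> S" "v \<in> orth n x" for x v
    using mnorm_ratio[OF that] by (intro conjI arccos_lbound arccos_le_pi2) auto
  show "0 \<le> \<theta>" unfolding \<theta>_def min_angle_def
    by (rule INF2_greatest) (use f u_S orth_nonempty n2 S_D in auto)
  obtain v where v: "v \<in> orth n u" using orth_nonempty[OF u(1) u_nz n2] by auto
  have "\<theta> \<le> ?f u v" unfolding \<theta>_def min_angle_def
    by (rule INF2_lower[of _ _ 0]) (use f u_S orth_nonempty n2 S_D v in auto)
  also have "\<dots> \<le> pi / 2" using f[OF u_S v] by simp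
  finally show "\<theta> \<le> pi / 2" .
qed

lemma cos_\<theta>: "0 \<le> cos \<theta>" "cos \<theta> \<le> 1"
  using \<theta>_range by (auto intro: cos_ge_zero)

lemma angle_bound:
  assumes "x \<in> S" "v \<in> orth n x"
  shows "(bil P v x)\<^sup>2 \<le> (cos \<theta>)\<^sup>2 * quad P v * quad P x"
proof -
  have x: "x \<in> V" "x \<noteq> 0\<^sub>v n" and v: "v \<in> V" "v \<noteq> 0\<^sub>v n" using assms S_D by (auto simp: orth_def)
  let ?f = "\<lambda>x v. arccos (\<bar>v \<bullet> (P *\<^sub>v x)\<bar> / (mnorm P v * mnorm P x))"
  let ?r = "\<bar>v \<bullet> (P *\<^sub>v x)\<bar> / (mnorm P v * mnorm P x)"
  have "0 \<le> ?f x v" if "x \<in> S" "v \<in> orth n x" for x v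
    using mnorm_ratio[OF that] by (auto intro: arccos_lbound)
  then have "\<theta> \<le> ?f x v" unfolding \<theta>_def min_angle_def
    by (rule INF2_lower[of _ _ 0]) (use orth_nonempty n2 S_D assms in auto)
  then have "cos (arccos ?r) \<le> cos \<theta>"
    using \<theta>_range mnorm_ratio[OF assms] arccos_ubound[of ?r] by (intro cos_monotone_0_pi_le) auto
  then have "?r \<le> cos \<theta>" using mnorm_ratio[OF assms] by (simp add: cos_arccos)
  moreover have pos: "mnorm P v * mnorm P x > 0" using P_pos[OF x] P_pos[OF v] by (simp add: mnorm_def)
  ultimately have "\<bar>bil P v x\<bar> \<le> cos \<theta> * (mnorm P v * mnorm P x)"
    by (simp add: pos_divide_le_eq bil_def)
  then have "(bil P v x)\<^sup>2 \<le> (cos \<theta> * (mnorm P v * mnorm P x))\<^sup>2"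
    by (rule square_le_of_abs_le)
  then show ?thesis using P_pos[OF x] P_pos[OF v] by (simp add: mnorm_def power_mult_distrib mult.assoc)
qed

text \<open>The vector z - (z u) u is Euclidean-orthogonal to u, so that the angle bound applies to it.\<close>

lemma compl_dot_u:
  assumes z: "z \<in> V" "bil P z u = 0" and k: "(cos \<theta>)\<^sup>2 \<le> 1 / 2"
  shows "\<sigma> * (z \<bullet> u)\<^sup>2 \<le> 2 * (cos \<theta>)\<^sup>2 * quad P z"
proof -
  define t where "t = z \<bullet> u"
  define v where "v = 1 \<cdot>\<^sub>v z + (- t) \<cdot>\<^sub>v u"
  have v: "v \<in> V" using z u by (simp add: v_def)
  have vu: "v \<bullet> u = 0" unfolding v_def using z u
    by (simp add: add_scalar_prod_distrib[of _ n] t_def)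
  have pv: "quad P v = quad P z + t\<^sup>2 * \<sigma>"
    unfolding v_def quad_comb[OF P z(1) u(1)] using z by (simp add: \<sigma>_def)
  have bv: "bil P v u = - t * \<sigma>" unfolding v_def using z u P by (simp add: \<sigma>_def quad_bil)
  show ?thesis
  \<comment> \<open>\<open>orth\<close> contains nonzero vectors only, so the angle bound says
    nothing about v = 0.\<close>
  proof (cases "v = 0\<^sub>v n")
    case True
    then have "bil P v u = 0" using u P by (simp add: bil_def)
    then have "t = 0" using bv \<sigma>_pos by simp
    then show ?thesis using P_nonneg[OF z(1)] by (simp add: t_def)
  next
    case False
    then have "v \<in> orth n u" using v vu by (simp add: orth_def)
    from angle_bound[OF u_S this] have "\<sigma> * (t\<^sup>2 * \<sigma>) \<le> \<sigma> * ((cos \<theta>)\<^sup>2 * quad P v)"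
      unfolding bv by (simp add: \<sigma>_def[symmetric] power2_eq_square mult_ac)
    then have "t\<^sup>2 * \<sigma> \<le> (cos \<theta>)\<^sup>2 * quad P z + (cos \<theta>)\<^sup>2 * (t\<^sup>2 * \<sigma>)"
      unfolding mult_le_cancel_left_pos[OF \<sigma>_pos] pv by (simp add: algebra_simps)
    \<comment> \<open>The unknown reappears on the right through the P-norm of v. Absorbing half of
      it on the left produces the factor 2 in the conclusion.\<close>
    moreover have "(cos \<theta>)\<^sup>2 * (t\<^sup>2 * \<sigma>) \<le> 1 / 2 * (t\<^sup>2 * \<sigma>)"
      by (rule mult_right_mono[OF k]) (use \<sigma>_pos in simp)
    ultimately show ?thesis by (simp add: t_def mult.commute)
  qed
qed

text \<open>In the expansion of x x for x = c u + z, the term c^2 carries all the P-energy up to the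
  fraction \<epsilon>, and the mixed term is controlled by \<open>compl_dot_u\<close>. The term z z
  is simply dropped in the lower bound; in the upper bound it can be compared with P only through a,
  which is the origin of the factor \<sigma> / a.\<close>

lemma sublevel_norm_bounds:
  assumes x: "x \<in> S" and k: "(cos \<theta>)\<^sup>2 \<le> 1 / 2"
  shows "(1 - 2 * \<epsilon> - 2 * (cos \<theta>)\<^sup>2) * quad P x \<le> \<sigma> * (x \<bullet> x)"
    "\<sigma> * (x \<bullet> x) \<le> (1 + 2 * (cos \<theta>)\<^sup>2 + \<epsilon> + \<sigma> / a * \<epsilon>) * quad P x"
proof -
  obtain c z where z: "z \<in> V" "x = c \<cdot>\<^sub>v u + z" "bil P z u = 0" using P_decomp S_D(1)[OF x] by metis
  note d = decomp_quad[OF z(1,3), of c, folded z(2)]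
  have sm: "quad P z \<le> \<epsilon> * quad P x" using sublevel_compl_small[of c z] x z by simp
  have px: "quad P x > 0" by (rule P_pos[OF S_D(1,2)[OF x]])
  let ?k = "(cos \<theta>)\<^sup>2"
  have xx: "x \<bullet> x = c\<^sup>2 + 2 * c * (z \<bullet> u) + z \<bullet> z"
    using quad_comb[OF one_SM u(1) z(1), of c 1] u z comm_scalar_prod[OF u(1) z(1)]
    by (simp add: quad_one bil_def)
  have cs: "c\<^sup>2 * \<sigma> \<le> quad P x" using d P_nonneg[OF z(1)] by simp
  have zz: "0 \<le> z \<bullet> z" "a * (z \<bullet> z) \<le> quad P z" using P_lower[OF z(1)] scalar_prod_self_nonneg by auto
  have "\<sigma> * (z \<bullet> u)\<^sup>2 \<le> 2 * ?k * (\<epsilon> * quad P x)"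
    using compl_dot_u[OF z(1,3) k] mult_left_mono[OF sm, of "2 * ?k"] by simp
  then have "(c\<^sup>2 * \<sigma>) * (\<sigma> * (z \<bullet> u)\<^sup>2) \<le> quad P x * (2 * ?k * (\<epsilon> * quad P x))"
    by (rule mult_mono[OF cs]) (use px \<sigma>_pos in auto)
  then have "(2 * (\<sigma> * (c * (z \<bullet> u))))\<^sup>2 \<le> 4 * (2 * ?k * \<epsilon>) * (quad P x)\<^sup>2"
    by (simp add: power2_eq_square mult_ac)
  \<comment> \<open>Arithmetic-geometric mean inequality for 2 (cos \<theta>)^2 and \<epsilon>; it
    replaces a geometric mean by a sum linear in both small quantities.\<close>
  also have "\<dots> \<le> (2 * ?k + \<epsilon>)\<^sup>2 * (quad P x)\<^sup>2"
    using zero_le_power2[of "2 * ?k - \<epsilon>"]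
    by (intro mult_right_mono) (simp_all add: power2_eq_square algebra_simps)
  finally have "\<bar>2 * (\<sigma> * (c * (z \<bullet> u)))\<bar> \<le> (2 * ?k + \<epsilon>) * quad P x"
    using \<epsilon>_nonneg px unfolding power_mult_distrib[symmetric] by (intro abs_le_of_square_le) simp_all
  then have m: "\<bar>\<sigma> * (2 * c * (z \<bullet> u))\<bar> \<le> (2 * ?k + \<epsilon>) * quad P x" by (simp add: mult_ac)
  have s: "\<sigma> * (x \<bullet> x) = c\<^sup>2 * \<sigma> + \<sigma> * (2 * c * (z \<bullet> u)) + \<sigma> * (z \<bullet> z)"
    unfolding xx by (simp add: algebra_simps)
  have "(1 - \<epsilon>) * quad P x \<le> c\<^sup>2 * \<sigma>" using sm d by (simp add: algebra_simps)
  moreover have "0 \<le> \<sigma> * (z \<bullet> z)" using zz \<sigma>_pos by simp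
  ultimately show "(1 - 2 * \<epsilon> - 2 * ?k) * quad P x \<le> \<sigma> * (x \<bullet> x)"
    unfolding s using m by (simp add: algebra_simps abs_le_iff)
  have "z \<bullet> z \<le> \<epsilon> * quad P x / a" using zz sm a_pos by (simp add: pos_le_divide_eq mult.commute)
  then have "\<sigma> * (z \<bullet> z) \<le> \<sigma> * (\<epsilon> * quad P x / a)" by (rule mult_left_mono) (use \<sigma>_pos in simp)
  then show "\<sigma> * (x \<bullet> x) \<le> (1 + 2 * ?k + \<epsilon> + \<sigma> / a * \<epsilon>) * quad P x"
    unfolding s using m cs by (simp add: algebra_simps abs_le_iff)
qed

lemma sublevel_ratio:
  assumes "x \<in> S"
  shows "quad P x / (x \<bullet> x) \<le> smax" "smin \<le> quad P x / (x \<bullet> x)"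
proof -
  have r: "a \<le> quad P x / (x \<bullet> x) \<and> quad P x / (x \<bullet> x) \<le> b" if "x \<in> S" for x
    using P_lower[OF S_D(1)[OF that]] P_upper[OF S_D(1)[OF that]] scalar_prod_self_pos[OF S_D(1,2)[OF that]]
    by (simp add: pos_le_divide_eq pos_divide_le_eq)
  show "quad P x / (x \<bullet> x) \<le> smax" unfolding smax_def sublevel_max_def
    by (rule cSUP_upper[OF assms]) (use r in \<open>auto intro!: bdd_aboveI2\<close>)
  show "smin \<le> quad P x / (x \<bullet> x)" unfolding smin_def sublevel_min_def
    by (rule cINF_lower[OF _ assms]) (use r in \<open>auto intro!: bdd_belowI2\<close>)
qed

lemma smin_pos: "0 < smin" and smin_le_\<sigma>: "smin \<le> \<sigma>" and \<sigma>_le_smax: "\<sigma> \<le> smax"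
proof -
  have "a \<le> smin" unfolding smin_def sublevel_min_def
    using P_lower scalar_prod_self_pos[OF S_D(1,2)] S_D(1) u_S
    by (intro cINF_greatest) (auto simp: pos_le_divide_eq)
  then show "0 < smin" using a_pos by simp
  show "smin \<le> \<sigma>" "\<sigma> \<le> smax" using sublevel_ratio[OF u_S] u(2) by (auto simp: \<sigma>_def)
qed

lemma smax_bound:
  assumes k: "(cos \<theta>)\<^sup>2 \<le> 1 / 2" and "0 < 1 - 2 * \<epsilon> - 2 * (cos \<theta>)\<^sup>2"
  shows "(1 - 2 * \<epsilon> - 2 * (cos \<theta>)\<^sup>2) / \<sigma> \<le> 1 / smax"
proof -
  have "smax \<le> \<sigma> / (1 - 2 * \<epsilon> - 2 * (cos \<theta>)\<^sup>2)"
    unfolding smax_def sublevel_max_def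
  proof (rule cSUP_least)
    fix x assume x: "x \<in> S"
    show "quad P x / (x \<bullet> x) \<le> \<sigma> / (1 - 2 * \<epsilon> - 2 * (cos \<theta>)\<^sup>2)"
      using sublevel_norm_bounds(1)[OF x k] scalar_prod_self_pos[OF S_D(1,2)[OF x]] assms(2)
      by (simp add: pos_divide_le_eq pos_le_divide_eq mult.commute)
  qed (use u_S in auto)
  then have "smax * (1 - 2 * \<epsilon> - 2 * (cos \<theta>)\<^sup>2) \<le> \<sigma>" using assms(2) by (simp add: pos_le_divide_eq)
  moreover have "smax > 0" using \<sigma>_pos \<sigma>_le_smax by linarith
  ultimately show ?thesis using \<sigma>_pos by (simp add: field_simps)
qed

lemma smin_bound:
  assumes k: "(cos \<theta>)\<^sup>2 \<le> 1 / 2"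
  shows "1 / smin \<le> (1 + 2 * (cos \<theta>)\<^sup>2 + \<epsilon> + \<sigma> / a * \<epsilon>) / \<sigma>"
proof -
  let ?c = "1 + 2 * (cos \<theta>)\<^sup>2 + \<epsilon> + \<sigma> / a * \<epsilon>"
  have c: "?c > 0" using \<epsilon>_nonneg \<sigma>_pos a_pos
    by (intro add_pos_nonneg mult_nonneg_nonneg divide_nonneg_nonneg) auto
  have "\<sigma> / ?c \<le> smin"
    unfolding smin_def sublevel_min_def
  proof (rule cINF_greatest)
    fix x assume x: "x \<in> S"
    show "\<sigma> / ?c \<le> quad P x / (x \<bullet> x)"
      using sublevel_norm_bounds(2)[OF x k] scalar_prod_self_pos[OF S_D(1,2)[OF x]] c
      by (simp add: pos_divide_le_eq pos_le_divide_eq mult.commute)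
  qed (use u_S in auto)
  then have "\<sigma> \<le> smin * ?c" using c by (simp only: pos_divide_le_eq)
  then show ?thesis using smin_pos \<sigma>_pos by (simp add: pos_divide_le_eq pos_le_divide_eq mult.commute)
qed

end

subsection \<open>Second-order estimates along great circles\<close>

text \<open>Taylor's formula by monotonicity used twice: the bound on h'' makes h' t - m t
  nondecreasing, and this in turn makes h minus its quadratic comparison function
  nondecreasing.\<close>

lemma second_order_lower:
  fixes h h' h'' :: "real \<Rightarrow> real"
  assumes \<phi>: "0 \<le> \<phi>"
    and d1: "\<And>t. 0 \<le> t \<Longrightarrow> t \<le> \<phi> \<Longrightarrow> (h has_real_derivative h' t) (at t)"
    and d2: "\<And>t. 0 \<le> t \<Longrightarrow> t \<le> \<phi> \<Longrightarrow> (h' has_real_derivative h'' t) (at t)"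
    and low: "\<And>t. 0 \<le> t \<Longrightarrow> t \<le> \<phi> \<Longrightarrow> m \<le> h'' t"
  shows "h 0 + \<phi> * h' 0 + m / 2 * \<phi>\<^sup>2 \<le> h \<phi>"
proof -
  have 1: "h' 0 + m * t \<le> h' t" if t: "0 \<le> t" "t \<le> \<phi>" for t
  proof -
    have "h' 0 - m * 0 \<le> h' t - m * t"
    proof (rule DERIV_nonneg_imp_nondecreasing[OF t(1)])
      fix x assume x: "0 \<le> x" "x \<le> t"
      have "((\<lambda>t. h' t - m * t) has_real_derivative h'' x - m) (at x)"
        by (rule derivative_eq_intros d2 refl | use x t in simp)+
      moreover have "0 \<le> h'' x - m" using low[of x] x t by simp
      ultimately show "\<exists>y. ((\<lambda>t. h' t - m * t) has_real_derivative y) (at x) \<and> 0 \<le> y" by blast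
    qed
    then show ?thesis by simp
  qed
  have "h 0 - h' 0 * 0 - m / 2 * 0\<^sup>2 \<le> h \<phi> - h' 0 * \<phi> - m / 2 * \<phi>\<^sup>2"
  proof (rule DERIV_nonneg_imp_nondecreasing[OF \<phi>])
    fix x assume x: "0 \<le> x" "x \<le> \<phi>"
    have "((\<lambda>t. h t - h' 0 * t - m / 2 * t\<^sup>2) has_real_derivative h' x - h' 0 - m * x) (at x)"
      by (rule derivative_eq_intros d1 refl | use x in simp)+
    moreover have "0 \<le> h' x - h' 0 - m * x" using 1[OF x] by simp
    ultimately show "\<exists>y. ((\<lambda>t. h t - h' 0 * t - m / 2 * t\<^sup>2) has_real_derivative y) (at x) \<and> 0 \<le> y" by blast
  qed
  then show ?thesis by (simp add: mult.commute)
qed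

lemma second_order_upper:
  fixes h h' h'' :: "real \<Rightarrow> real"
  assumes \<phi>: "0 \<le> \<phi>"
    and d1: "\<And>t. 0 \<le> t \<Longrightarrow> t \<le> \<phi> \<Longrightarrow> (h has_real_derivative h' t) (at t)"
    and d2: "\<And>t. 0 \<le> t \<Longrightarrow> t \<le> \<phi> \<Longrightarrow> (h' has_real_derivative h'' t) (at t)"
    and up: "\<And>t. 0 \<le> t \<Longrightarrow> t \<le> \<phi> \<Longrightarrow> h'' t \<le> m"
  shows "h \<phi> \<le> h 0 + \<phi> * h' 0 + m / 2 * \<phi>\<^sup>2"
proof -
  have "- h 0 + \<phi> * - h' 0 + - m / 2 * \<phi>\<^sup>2 \<le> - h \<phi>"
    by (rule second_order_lower[where h = "\<lambda>t. - h t" and h' = "\<lambda>t. - h' t" and h'' = "\<lambda>t. - h'' t"])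
      (use assms in \<open>auto intro: DERIV_minus\<close>)
  then show ?thesis by simp
qed

text \<open>The derivatives of the quotient p / q along a unit-speed great circle, on which quadratic forms
  p and q satisfy p' = 2 r, q' = 2 s, where r' = p2 - p and s' = q2 - q.\<close>

lemma quotient_derivs:
  fixes p q r s :: "real \<Rightarrow> real"
  assumes "(p has_real_derivative 2 * r t) (at t)" "(q has_real_derivative 2 * s t) (at t)"
    and "(r has_real_derivative p2 - p t) (at t)" "(s has_real_derivative q2 - q t) (at t)" "q t \<noteq> 0"
  shows "((\<lambda>t. p t / q t) has_real_derivative 2 / q t * (r t - p t / q t * s t)) (at t)"
    "((\<lambda>t. 2 / q t * (r t - p t / q t * s t)) has_real_derivative
      2 / q t * (p2 - p t / q t * q2 - 4 * s t * (r t - p t / q t * s t) / q t)) (at t)"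
proof -
  show 1: "((\<lambda>t. p t / q t) has_real_derivative 2 / q t * (r t - p t / q t * s t)) (at t)"
    by (rule derivative_eq_intros assms refl)+ (use assms(5) in \<open>simp add: field_simps power2_eq_square\<close>)
  show "((\<lambda>t. 2 / q t * (r t - p t / q t * s t)) has_real_derivative
      2 / q t * (p2 - p t / q t * q2 - 4 * s t * (r t - p t / q t * s t) / q t)) (at t)"
    by (rule derivative_eq_intros assms 1 refl)+ (use assms(5) in \<open>simp add: field_simps power2_eq_square\<close>)
qed

section \<open>The second derivative of the Rayleigh quotient\<close>

context rq_pencil
begin

text \<open>The second derivative along the unit-speed great circle through x with velocity v, in
  the form that \<open>quotient_derivs\<close> delivers. The contributions of the acceleration,
  which is -x, have cancelled because P(x) - Rq(x) Q(x) = 0.\<close>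

definition "hess x v = 2 / quad Q x * (quad P v - rq P Q x * quad Q v
  - 4 * bil Q v x * (bil P v x - rq P Q x * bil Q v x) / quad Q x)"

definition "CX = 8 * b * \<rho> / smin * ((\<rho> - l1) / l1 + sqrt ((\<rho> - l1) / l1) * cos \<theta>)"
definition "\<mu>B = 2 * a * l1 / smax * (1 - \<rho> / orq) - CX"
definition "LB = 2 * b * \<rho> / smin * (1 - l1 / ln) + CX"

lemma rq_ge: "x \<in> V \<Longrightarrow> x \<noteq> 0\<^sub>v n \<Longrightarrow> l1 \<le> rq P Q x"
  using PQ_lower[of x] Q_pos[of x] by (simp add: rq_def pos_le_divide_eq)

lemma rq_mult: "x \<in> V \<Longrightarrow> x \<noteq> 0\<^sub>v n \<Longrightarrow> rq P Q x * quad Q x = quad P x"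
  using Q_pos[of x] by (simp add: rq_def)

lemma spd_P: "spd n P"
  using P P_pos by (simp add: spd_def SM_D quad_def)

text \<open>The Cauchy--Schwarz inequality in the inner product of P, applied to v and x - f y, where
  P y = Q x.\<close>

lemma residual_bound:
  assumes x: "x \<in> V" "x \<noteq> 0\<^sub>v n" and v: "v \<in> V"
  shows "(bil P v x - rq P Q x * bil Q v x)\<^sup>2 \<le> (rq P Q x / l1 - 1) * (quad P v * quad P x)"
proof -
  define f where "f = rq P Q x"
  define y where "y = mat_inv P *\<^sub>v (Q *\<^sub>v x)"
  note I = spd_mat_inv[OF spd_P]
  have Qx: "Q *\<^sub>v x \<in> V" using Q x by simp
  have y: "y \<in> V" unfolding y_def using I(3) Qx by (rule mult_mat_vec_carrier)
  have Py: "P *\<^sub>v y = Q *\<^sub>v x" unfolding y_def by (rule mult_inverse_vec[OF SM_D(1)[OF P] I(3,1) Qx])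
  have bPy: "bil P z y = bil Q z x" for z by (simp add: bil_def Py)
  have f: "f * quad Q x = quad P x" "f > 0"
    using rq_mult[OF x] rq_ge[OF x] l by (auto simp: f_def)
  \<comment> \<open>As P y = Q x, the number \<open>quad P y\<close> equals
    \<open>bil Q y x\<close>. The Cauchy--Schwarz inequality for Q, followed by
    \<open>PQ_lower\<close>, bounds its square by itself times the right-hand side.\<close>
  have "quad P y \<le> quad Q x / l1"
  proof -
    have "quad P y * quad P y = (bil Q y x)\<^sup>2" by (simp add: quad_bil bPy power2_eq_square)
    also have "\<dots> \<le> quad Q y * quad Q x" by (rule cauchy_schwarz_psd[OF Q Q_nonneg y x(1)])
    also have "\<dots> \<le> quad P y / l1 * quad Q x"
      using PQ_lower[OF y] l Q_nonneg[OF x(1)] by (intro mult_right_mono) (simp_all add: pos_le_divide_eq mult.commute)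
    finally have "quad P y * quad P y \<le> quad P y * (quad Q x / l1)" by simp
    then show ?thesis
      using P_nonneg[OF y] Q_nonneg[OF x(1)] l mult_le_cancel_left_pos[of "quad P y" "quad P y" "quad Q x / l1"]
      by (cases "quad P y = 0") auto
  qed
  then have "f\<^sup>2 * quad P y \<le> f * (quad P x / l1)"
    using mult_left_mono[of "quad P y" "quad Q x / l1" "f\<^sup>2"] f by (simp add: power2_eq_square mult.assoc)
  define w where "w = 1 \<cdot>\<^sub>v x + (- f) \<cdot>\<^sub>v y"
  have w: "w \<in> V" using x y by (simp add: w_def)
  have bw: "bil P v w = bil P v x - f * bil Q v x"
    unfolding w_def using x y v P by (simp add: bPy)
  have "quad P w = quad P x - 2 * f * quad Q x + f\<^sup>2 * quad P y"
    unfolding w_def quad_comb[OF P x(1) y] by (simp add: bPy quad_bil)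
  then have "quad P w \<le> (f / l1 - 1) * quad P x"
    using \<open>f\<^sup>2 * quad P y \<le> _\<close> f by (simp add: algebra_simps)
  then have "quad P v * quad P w \<le> (f / l1 - 1) * (quad P v * quad P x)"
    using mult_left_mono[OF _ P_nonneg[OF v]] by (metis mult.left_commute)
  moreover have "(bil P v w)\<^sup>2 \<le> quad P v * quad P w" by (rule cauchy_schwarz_psd[OF P P_nonneg v w])
  ultimately show ?thesis unfolding bw f_def by linarith
qed

text \<open>Multiplying by f replaces \<open>bil Q v x\<close> by \<open>bil P v x\<close> minus the
  residual \<beta>. The former is at most cos \<theta>, the latter at most s = (f / l1 - 1)^(1/2),
  both relative to N; so the product with \<beta> gives s cos \<theta> + s^2, the shape of the
  bracket in \<open>CX\<close>. The outer factor arises from P(v) \<le> b and 1 / Q(x) = f / P(x)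
  \<le> \<rho> / smin.\<close>

lemma cross_term_bound:
  assumes x: "x \<in> S" and v: "v \<in> orth n x" and xx: "x \<bullet> x = 1" and vv: "v \<bullet> v = 1"
  shows "\<bar>8 * bil Q v x * (bil P v x - rq P Q x * bil Q v x) / (quad Q x)\<^sup>2\<bar> \<le> CX"
proof -
  have xV: "x \<in> V" "x \<noteq> 0\<^sub>v n" and vV: "v \<in> V" "v \<noteq> 0\<^sub>v n" using x v S_D by (auto simp: orth_def)
  define f where "f = rq P Q x"
  define \<beta> where "\<beta> = bil P v x - f * bil Q v x"
  define s where "s = sqrt (f / l1 - 1)"
  define s\<rho> where "s\<rho> = sqrt (\<rho> / l1 - 1)"
  define k where "k = cos \<theta>"
  define N where "N = sqrt (quad P v * quad P x)"
  have qP: "quad P v > 0" "quad P x > 0" and qQ: "quad Q x > 0"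
    using P_pos[OF xV] P_pos[OF vV] Q_pos[OF xV] by auto
  have f: "l1 \<le> f" "f \<le> \<rho>" "f > 0" "f * quad Q x = quad P x"
    using rq_ge[OF xV] x rq_mult[OF xV] l by (auto simp: f_def sublevel_def)
  have s: "0 \<le> s" "s\<^sup>2 = f / l1 - 1" "s \<le> s\<rho>" "s\<rho>\<^sup>2 = \<rho> / l1 - 1"
    using f \<rho> l by (auto simp: s_def s\<rho>_def divide_right_mono)
  have N: "0 \<le> N" "N\<^sup>2 = quad P v * quad P x" using qP by (auto simp: N_def)
  have k: "0 \<le> k" using cos_\<theta> by (simp add: k_def)
  have \<beta>: "\<bar>\<beta>\<bar> \<le> s * N"
    using residual_bound[OF xV vV(1)] s N
    by (intro abs_le_of_square_le) (simp_all add: power_mult_distrib \<beta>_def f_def)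
  have bP: "\<bar>bil P v x\<bar> \<le> k * N"
    using angle_bound[OF x v] k N
    by (intro abs_le_of_square_le) (simp_all add: power_mult_distrib k_def mult.assoc)
  have "f * \<bar>bil Q v x * \<beta>\<bar> = \<bar>(bil P v x - \<beta>) * \<beta>\<bar>"
    using f(3) by (simp add: \<beta>_def abs_mult)
  also have "\<dots> \<le> (\<bar>bil P v x\<bar> + \<bar>\<beta>\<bar>) * \<bar>\<beta>\<bar>"
    unfolding abs_mult by (rule mult_right_mono) auto
  also have "\<dots> \<le> (k * N + s * N) * (s * N)"
    by (rule mult_mono) (use \<beta> bP k s N in auto)
  also have "\<dots> = f * ((k * s + s\<^sup>2) * quad P v * quad Q x)"
  proof -
    have "(k * N + s * N) * (s * N) = (k * s + s\<^sup>2) * N\<^sup>2" by (simp add: algebra_simps power2_eq_square)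
    then show ?thesis unfolding N(2) f(4)[symmetric] by (simp add: mult_ac)
  qed
  finally have "\<bar>bil Q v x * \<beta>\<bar> \<le> (k * s + s\<^sup>2) * quad P v * quad Q x"
    using f(3) by simp
  then have "8 * \<bar>bil Q v x * \<beta>\<bar> / (quad Q x)\<^sup>2 \<le> 8 * ((k * s + s\<^sup>2) * quad P v * quad Q x) / (quad Q x)\<^sup>2"
    by (intro divide_right_mono) auto
  also have "\<dots> = 8 * quad P v * (1 / quad Q x) * (k * s + s\<^sup>2)"
    using qQ by (simp add: power2_eq_square)
  also have "\<dots> \<le> 8 * b * (\<rho> / smin) * (k * s\<rho> + s\<rho>\<^sup>2)"
  proof (intro mult_mono)
    show "quad P v \<le> b" using P_upper[OF vV(1)] vv by simp
    have "1 / quad Q x = f / quad P x" unfolding f(4)[symmetric] using f(3) qQ by simp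
    also have "\<dots> \<le> \<rho> / smin"
      using sublevel_ratio(2)[OF x] xx f smin_pos by (intro frac_le) auto
    finally show "1 / quad Q x \<le> \<rho> / smin" .
    show "k * s + s\<^sup>2 \<le> k * s\<rho> + s\<rho>\<^sup>2"
      using s k by (intro add_mono mult_left_mono power_mono) auto
  qed (use qP qQ b_pos \<rho>_pos smin_pos k s(1,3) in auto)
  also have "\<dots> = CX"
  proof -
    have "\<rho> / l1 - 1 = (\<rho> - l1) / l1" using l by (simp add: diff_divide_distrib)
    then show ?thesis unfolding CX_def s(4) unfolding s\<rho>_def k_def by (simp add: algebra_simps)
  qed
  finally show ?thesis by (simp add: \<beta>_def f_def abs_mult mult.assoc)
qed

lemma hess_alt:
  "hess x v = 2 / quad Q x * (quad P v - rq P Q x * quad Q v)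
    - 8 * bil Q v x * (bil P v x - rq P Q x * bil Q v x) / (quad Q x)\<^sup>2"
proof -
  have *: "2 / q * (A - 4 * s * r / q) = 2 / q * A - 8 * s * r / q\<^sup>2" for q A s r :: real
    by (cases "q = 0") (simp_all add: field_simps power2_eq_square)
  show ?thesis unfolding hess_def by (rule *)
qed

text \<open>Up to the cross term the second derivative is a product. Its factor 2 / Q(x) = 2 f /
  P(x) lies between 2 l1 / smax and 2 \<rho> / smin, its factor P(v) - f Q(v) between a (1 - \<rho>
  / orq) and b (1 - l1 / ln). Multiplying the lower bounds requires both to be nonnegative, which is
  where \<rho> < orq enters.\<close>

lemma hess_bounds:
  assumes x: "x \<in> S" and v: "v \<in> orth n x" and xx: "x \<bullet> x = 1" and vv: "v \<bullet> v = 1" and orq: "\<rho> < orq"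
  shows "\<mu>B \<le> hess x v" "hess x v \<le> LB"
proof -
  have xV: "x \<in> V" "x \<noteq> 0\<^sub>v n" and vV: "v \<in> V" "v \<noteq> 0\<^sub>v n" using x v S_D by (auto simp: orth_def)
  define f where "f = rq P Q x"
  have qP: "quad P v > 0" "quad P x > 0" and qQ: "quad Q x > 0" "quad Q v > 0"
    using P_pos[OF xV] P_pos[OF vV] Q_pos[OF xV] Q_pos[OF vV] by auto
  have f: "l1 \<le> f" "f \<le> \<rho>" "f > 0" "f * quad Q x = quad P x"
    using rq_ge[OF xV] x rq_mult[OF xV] l by (auto simp: f_def sublevel_def)
  have r: "quad P x \<le> smax" "smin \<le> quad P x" using sublevel_ratio[OF x] xx by auto
  have ab: "a \<le> quad P v" "quad P v \<le> b" using P_lower[OF vV(1)] P_upper[OF vV(1)] vv by auto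
  have q: "2 / quad Q x = 2 * f / quad P x" unfolding f(4)[symmetric] using f(3) qQ by simp
  define cr where "cr = 8 * bil Q v x * (bil P v x - f * bil Q v x) / (quad Q x)\<^sup>2"
  have cr: "\<bar>cr\<bar> \<le> CX" unfolding cr_def f_def by (rule cross_term_bound[OF x v xx vv])
  have hess: "hess x v = 2 * f / quad P x * (quad P v - f * quad Q v) - cr"
    unfolding hess_alt cr_def f_def[symmetric] q by simp
  have "a * (1 - \<rho> / orq) \<le> quad P v * (1 - \<rho> / orq)"
    using ab orq \<rho>_pos by (intro mult_right_mono) auto
  also have "\<dots> \<le> quad P v - f * quad Q v"
  proof -
    have "orq * quad Q v \<le> quad P v" using orq_le[OF x v] qQ by (simp add: rq_def pos_le_divide_eq)
    then have "quad Q v \<le> quad P v / orq" using orq \<rho>_pos by (simp add: pos_le_divide_eq mult.commute)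
    then have "f * quad Q v \<le> \<rho> * (quad P v / orq)" using f qQ \<rho>_pos by (intro mult_mono) auto
    then show ?thesis by (simp add: algebra_simps)
  qed
  finally have m: "a * (1 - \<rho> / orq) \<le> quad P v - f * quad Q v" .
  have "0 \<le> a * (1 - \<rho> / orq)" using orq \<rho>_pos a_pos by (intro mult_nonneg_nonneg) auto
  with m have m0: "0 \<le> quad P v - f * quad Q v" by linarith
  have "2 * l1 / smax * (a * (1 - \<rho> / orq)) \<le> 2 * f / quad P x * (quad P v - f * quad Q v)"
    by (rule mult_mono[OF _ m], rule frac_le) (use f l r qP orq \<rho>_pos a_pos in auto)
  then show "\<mu>B \<le> hess x v"
    using cr unfolding hess \<mu>B_def by (simp add: mult_ac abs_le_iff)
  have "quad P v - f * quad Q v \<le> quad P v * (1 - l1 / ln)"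
  proof -
    have "quad P v / ln \<le> quad Q v" using PQ_upper[OF vV(1)] l by (simp add: pos_divide_le_eq mult.commute)
    then have "l1 * (quad P v / ln) \<le> f * quad Q v" using f qP l by (intro mult_mono) auto
    then show ?thesis by (simp add: algebra_simps)
  qed
  also have "\<dots> \<le> b * (1 - l1 / ln)"
    using ab l by (intro mult_right_mono) auto
  finally have M: "quad P v - f * quad Q v \<le> b * (1 - l1 / ln)" .
  have "2 * f / quad P x * (quad P v - f * quad Q v) \<le> 2 * \<rho> / smin * (b * (1 - l1 / ln))"
    by (rule mult_mono[OF _ M], rule frac_le)
      (use f l r qP smin_pos b_pos \<rho>_pos m0 in auto)
  then show "hess x v \<le> LB"
    using cr unfolding hess LB_def by (simp add: mult_ac abs_le_iff)
qed

section \<open>Geodesic convexity of the spherical sublevel set\<close>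

abbreviation "X \<equiv> sphere_sublevel n P Q u \<rho>"

lemma X_D:
  assumes "x \<in> X"
  shows "x \<in> V" "x \<bullet> x = 1" "x \<noteq> 0\<^sub>v n" "0 < x \<bullet> u" "x \<in> S"
proof -
  show x: "x \<in> V" and xx: "x \<bullet> x = 1" and "0 < x \<bullet> u"
    using assms by (auto simp: sphere_sublevel_def usphere_def vnorm_def)
  show "x \<noteq> 0\<^sub>v n" using xx x by auto
  with x assms show "x \<in> S" by (simp add: sphere_sublevel_def sublevel_def)
qed

lemma X_I: "x \<in> V \<Longrightarrow> x \<bullet> x = 1 \<Longrightarrow> 0 < x \<bullet> u \<Longrightarrow> quad P x \<le> \<rho> * quad Q x \<Longrightarrow> x \<in> X"
  using Q_pos[of x] by (cases "x = 0\<^sub>v n") (auto simp: sphere_sublevel_def usphere_def vnorm_def rq_def pos_divide_le_eq)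

text \<open>The set is cut out by a Euclidean half-space, but the convex half cone is cut out by a
  P-half-space. On the sublevel set the two agree: for \<epsilon> < 1 / 2 more than half of the
  P-energy lies along u, and then the coefficient c outweighs z u in x u = c + z u.\<close>

lemma bil_P_u_pos:
  assumes x: "x \<in> S" and xu: "0 < x \<bullet> u" and k: "(cos \<theta>)\<^sup>2 \<le> 1 / 2" and \<epsilon>2: "\<epsilon> < 1 / 2"
  shows "0 < bil P x u"
proof -
  obtain c z where z: "z \<in> V" "x = c \<cdot>\<^sub>v u + z" "bil P z u = 0" using P_decomp S_D(1)[OF x] by metis
  have d: "quad P x = c\<^sup>2 * \<sigma> + quad P z" using decomp_quad(1)[OF z(1,3), of c] z(2) by simp
  have sm: "quad P z \<le> \<epsilon> * quad P x" using sublevel_compl_small[of c z] x z by simp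
  have px: "quad P x > 0" by (rule P_pos[OF S_D(1,2)[OF x]])
  have "\<epsilon> * quad P x < 1 / 2 * quad P x" using \<epsilon>2 px by (intro mult_strict_right_mono)
  then have "quad P z < c\<^sup>2 * \<sigma>" using sm d by simp
  moreover have "\<sigma> * (z \<bullet> u)\<^sup>2 \<le> quad P z"
    using compl_dot_u[OF z(1,3) k] mult_right_mono[OF k P_nonneg[OF z(1)]] by simp
  ultimately have "\<sigma> * (z \<bullet> u)\<^sup>2 < \<sigma> * c\<^sup>2" by (simp add: mult.commute)
  then have "(z \<bullet> u)\<^sup>2 < c\<^sup>2" using \<sigma>_pos by simp
  then have zc: "\<bar>z \<bullet> u\<bar> < \<bar>c\<bar>" by (simp add: abs_square_le_1 power2_less_imp_less abs_le_square_iff not_le[symmetric])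
  have "x \<bullet> u = c + z \<bullet> u" unfolding z(2) using z(1) u by (simp add: add_scalar_prod_distrib[of _ n])
  with xu zc have "c > 0" by linarith
  moreover have "bil P x u = c * \<sigma>" unfolding z(2) using z(1,3) u P by (simp add: \<sigma>_def quad_bil)
  ultimately show ?thesis using \<sigma>_pos by simp
qed

text \<open>The form P - \<open>\<rho>\<close> Q has at most one negative direction, so one half of the double cone on which it
  is nonpositive is convex: it is nonnegative on the combination of x and y that is P-orthogonal
  to u.\<close>

lemma cone_convex:
  assumes x: "x \<in> S" "0 < bil P x u" and y: "y \<in> S" "0 < bil P y u" and st: "0 \<le> s" "0 \<le> t"
  shows "quad P (s \<cdot>\<^sub>v x + t \<cdot>\<^sub>v y) \<le> \<rho> * quad Q (s \<cdot>\<^sub>v x + t \<cdot>\<^sub>v y)"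
proof -
  note xV = S_D(1)[OF x(1)] and yV = S_D(1)[OF y(1)]
  define F where "F w = quad P w - \<rho> * quad Q w" for w
  define G where "G = bil P x y - \<rho> * bil Q x y"
  define c where "c = bil P x u"
  define d where "d = bil P y u"
  have Fc: "F (s \<cdot>\<^sub>v x + t \<cdot>\<^sub>v y) = s\<^sup>2 * F x + 2 * s * t * G + t\<^sup>2 * F y" for s t
    unfolding F_def G_def quad_comb[OF P xV yV] quad_comb[OF Q xV yV] by (simp add: algebra_simps)
  have F: "F x \<le> 0" "F y \<le> 0" using S_D(3)[OF x(1)] S_D(3)[OF y(1)] by (auto simp: F_def)
  define w where "w = d \<cdot>\<^sub>v x + (- c) \<cdot>\<^sub>v y"
  have w: "w \<in> V" using xV yV by (simp add: w_def)
  have "bil P w u = 0" unfolding w_def using xV yV u P by (simp add: c_def d_def)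
  then have "l2 * quad Q w \<le> quad P w" using PQ_compl[OF w] by (simp add: bil_def)
  moreover have "\<rho> * quad Q w \<le> l2 * quad Q w" using \<rho>_l2 Q_nonneg[OF w] by (intro mult_right_mono) auto
  ultimately have "0 \<le> F w" by (simp add: F_def)
  then have "2 * (c * d) * G \<le> d\<^sup>2 * F x + c\<^sup>2 * F y" unfolding w_def Fc by (simp add: algebra_simps)
  also have "\<dots> \<le> 0" using F by (intro add_nonpos_nonpos mult_nonneg_nonpos) auto
  finally have "(c * d) * G \<le> 0" by linarith
  moreover have "c * d > 0" using x(2) y(2) by (simp add: c_def d_def)
  ultimately have "G \<le> 0" by (metis linorder_not_le mult_pos_pos)
  have "s\<^sup>2 * F x + 2 * s * t * G + t\<^sup>2 * F y \<le> 0"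
    using F \<open>G \<le> 0\<close> st by (intro add_nonpos_nonpos mult_nonneg_nonpos) auto
  then show ?thesis using Fc[of s t] by (simp add: F_def)
qed

definition circ :: "real vec \<Rightarrow> real vec \<Rightarrow> real \<Rightarrow> real vec" where
  "circ x v t = cos t \<cdot>\<^sub>v x + sin t \<cdot>\<^sub>v v"

text \<open>Rewriting the arc in terms of its end points gives the coefficients sin (\<phi> - t) /
  sin \<phi> and sin t / sin \<phi>. They are nonnegative because \<phi> < pi, so that
  \<open>cone_convex\<close> applies to each point of the arc. Antipodal end points, for which sin
  \<phi> would vanish, are excluded by the half-space condition.\<close>

lemma geodesic:
  assumes x: "x \<in> X" and y: "y \<in> X" and xy: "x \<noteq> y" and k: "(cos \<theta>)\<^sup>2 \<le> 1 / 2" and \<epsilon>2: "\<epsilon> < 1 / 2"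
  obtains \<phi> v where "0 < \<phi>" "v \<in> V" "v \<bullet> x = 0" "v \<bullet> v = 1" "sphere_log x y = \<phi> \<cdot>\<^sub>v v"
    "circ x v \<phi> = y" "\<And>t. 0 \<le> t \<Longrightarrow> t \<le> \<phi> \<Longrightarrow> circ x v t \<in> X"
proof -
  note x' = X_D[OF x] and y' = X_D[OF y]
  define c where "c = x \<bullet> y"
  define p where "p = y - c \<cdot>\<^sub>v x"
  define \<phi> where "\<phi> = arccos c"
  have p: "p \<in> V" using x' y' by (simp add: p_def)
  have yx: "y \<bullet> x = c" unfolding c_def by (rule comm_scalar_prod[OF y'(1) x'(1)])
  have pp: "p \<bullet> p = 1 - c\<^sup>2" and px: "p \<bullet> x = 0"
    unfolding p_def using x' y' yx
    by (simp_all add: minus_scalar_prod_distrib[of _ n] scalar_prod_minus_distrib[of _ n]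
        c_def[symmetric] power2_eq_square algebra_simps)
  have p0: "p \<noteq> 0\<^sub>v n"
  proof
    assume p0: "p = 0\<^sub>v n"
    have y_eq: "y = c \<cdot>\<^sub>v x"
    proof (rule eq_vecI)
      fix i assume "i < dim_vec (c \<cdot>\<^sub>v x)"
      then have i: "i < n" using x'(1) by simp
      have "p $ i = 0" using p0 i by simp
      then show "y $ i = (c \<cdot>\<^sub>v x) $ i" using i x'(1) y'(1) by (simp add: p_def)
    qed (use x' y' in auto)
    have "c\<^sup>2 = 1" using pp p0 by simp
    then have "c = 1 \<or> c = - 1" by (simp add: power2_eq_1_iff)
    then show False
    proof
      assume "c = 1" then show False using y_eq xy by simp
    next
      assume "c = - 1"
      then have "y \<bullet> u = - (x \<bullet> u)" using y_eq x' u by simp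
      then show False using x'(4) y'(4) by simp
    qed
  qed
  then have "c\<^sup>2 < 1" using scalar_prod_self_pos[OF p] pp by simp
  then have c: "- 1 < c" "c < 1" by (auto simp: abs_square_less_1 abs_less_iff)
  have \<phi>: "0 < \<phi>" "\<phi> < pi" "cos \<phi> = c" using arccos_lt_bounded[OF c] c by (auto simp: \<phi>_def)
  have sin\<phi>: "0 < sin \<phi>" using \<phi> by (intro sin_gt_zero)
  have pn: "p \<bullet> p = (sin \<phi>)\<^sup>2" unfolding pp \<phi>(3)[symmetric] by (simp add: sin_squared_eq)
  then have vn: "vnorm p = sin \<phi>" using sin\<phi> by (simp add: vnorm_def)
  define v where "v = (1 / sin \<phi>) \<cdot>\<^sub>v p"
  have v: "v \<in> V" using p by (simp add: v_def)
  have vx: "v \<bullet> x = 0" unfolding v_def using p x' px by simp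
  have vv: "v \<bullet> v = 1" unfolding v_def using p pn sin\<phi> by (simp add: power2_eq_square)
  have log: "sphere_log x y = \<phi> \<cdot>\<^sub>v v"
    unfolding sphere_log_def Let_def c_def[symmetric] p_def[symmetric] vn \<phi>_def[symmetric] v_def
    by (simp add: smult_smult_assoc)
  have circ: "circ x v t = (sin (\<phi> - t) / sin \<phi>) \<cdot>\<^sub>v x + (sin t / sin \<phi>) \<cdot>\<^sub>v y" for t
  proof (rule eq_vecI)
    fix i assume "i < dim_vec ((sin (\<phi> - t) / sin \<phi>) \<cdot>\<^sub>v x + (sin t / sin \<phi>) \<cdot>\<^sub>v y)"
    then have i: "i < n" using y'(1) by simp
    have "cos t * x $ i + sin t * (1 / sin \<phi> * (y $ i - cos \<phi> * x $ i))
      = sin (\<phi> - t) / sin \<phi> * x $ i + sin t / sin \<phi> * y $ i"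
      using sin\<phi> by (simp add: sin_diff field_simps)
    then show "circ x v t $ i = ((sin (\<phi> - t) / sin \<phi>) \<cdot>\<^sub>v x + (sin t / sin \<phi>) \<cdot>\<^sub>v y) $ i"
      using i x'(1) y'(1) by (simp add: circ_def v_def p_def \<phi>(3))
  qed (use x'(1) y'(1) v in \<open>auto simp: circ_def\<close>)
  have cy: "circ x v \<phi> = y"
    unfolding circ by (rule eq_vecI) (use sin\<phi> x'(1) y'(1) in auto)
  have "circ x v t \<in> X" if t: "0 \<le> t" "t \<le> \<phi>" for t
  proof (rule X_I)
    have s1: "0 \<le> sin (\<phi> - t) / sin \<phi>" and s2: "0 \<le> sin t / sin \<phi>"
      using t \<phi> sin\<phi> by (auto intro!: divide_nonneg_pos sin_ge_zero)
    show cV: "circ x v t \<in> V" using x' v by (simp add: circ_def)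
    have "quad (1\<^sub>m n) (circ x v t) = (cos t)\<^sup>2 + (sin t)\<^sup>2"
      unfolding circ_def quad_comb[OF one_SM x'(1) v] using x' v vv vx comm_scalar_prod[OF x'(1) v]
      by (simp add: quad_one dot_bil[symmetric])
    then show "circ x v t \<bullet> circ x v t = 1" using quad_one[OF cV] by simp
    show "quad P (circ x v t) \<le> \<rho> * quad Q (circ x v t)"
      unfolding circ using x' y' s1 s2 k \<epsilon>2 by (intro cone_convex bil_P_u_pos) auto
    have eq: "circ x v t \<bullet> u = sin (\<phi> - t) / sin \<phi> * (x \<bullet> u) + sin t / sin \<phi> * (y \<bullet> u)"
      unfolding circ using x'(1) y'(1) u by (simp add: add_scalar_prod_distrib[of _ n])
    show "0 < circ x v t \<bullet> u"
    proof (cases "t = 0")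
      case True
      then show ?thesis unfolding eq using x' sin\<phi> by simp
    next
      case False
      then have "0 < sin t" using t \<phi> by (intro sin_gt_zero) auto
      then have "0 < sin t / sin \<phi> * (y \<bullet> u)" using sin\<phi> y' by simp
      moreover have "0 \<le> sin (\<phi> - t) / sin \<phi> * (x \<bullet> u)" using s1 x' by (intro mult_nonneg_nonneg) auto
      ultimately show ?thesis unfolding eq by linarith
    qed
  qed
  from that[OF \<phi>(1) v vx vv log cy this] show ?thesis .
qed

lemma vnorm_smult_unit: "v \<in> V \<Longrightarrow> v \<bullet> v = 1 \<Longrightarrow> vnorm (c \<cdot>\<^sub>v v) = \<bar>c\<bar>"
  by (simp add: vnorm_def)

text \<open>Division by zero is harmless here, as the resulting scalar multiplies the zero
  vector.\<close>

lemma sphere_log_self: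
  assumes "x \<in> V" "x \<bullet> x = 1"
  shows "sphere_log x x = 0\<^sub>v n"
proof -
  have "x - 1 \<cdot>\<^sub>v x = 0\<^sub>v n" using assms(1) by (intro eq_vecI) auto
  moreover have "0 \<cdot>\<^sub>v 0\<^sub>v n = (0\<^sub>v n :: real vec)" by auto
  ultimately show ?thesis using assms by (simp add: sphere_log_def)
qed

lemma geod_convex_X:
  assumes k: "(cos \<theta>)\<^sup>2 \<le> 1 / 2" and \<epsilon>2: "\<epsilon> < 1 / 2"
  shows "geod_convex_set n X"
  unfolding geod_convex_set_def
proof (intro conjI ballI)
  show "X \<subseteq> usphere n" by (auto simp: sphere_sublevel_def)
  fix x y assume x: "x \<in> X" and y: "y \<in> X"
  note x' = X_D[OF x] and y' = X_D[OF y]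
  show "y \<noteq> - x"
  proof
    assume "y = - x"
    then have "y \<bullet> u = - (x \<bullet> u)" using x' u by simp
    then show False using x'(4) y'(4) by simp
  qed
  fix t :: real assume t: "t \<in> {0..1}"
  show "sphere_exp x (t \<cdot>\<^sub>v sphere_log x y) \<in> X"
  proof (cases "x = y")
    case True
    have "t \<cdot>\<^sub>v 0\<^sub>v n = (0\<^sub>v n :: real vec)" by auto
    moreover have "sphere_exp x (0\<^sub>v n) = x"
      using x' by (auto simp: sphere_exp_def vnorm_def)
    ultimately show ?thesis using True sphere_log_self[OF x'(1,2)] x by simp
  next
    case False
    obtain \<phi> v where g: "0 < \<phi>" "v \<in> V" "v \<bullet> v = 1" "sphere_log x y = \<phi> \<cdot>\<^sub>v v"
      "\<And>t. 0 \<le> t \<Longrightarrow> t \<le> \<phi> \<Longrightarrow> circ x v t \<in> X"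
      using geodesic[OF x y False k \<epsilon>2] by metis
    have tp: "0 \<le> t * \<phi>" "t * \<phi> \<le> \<phi>" using t g(1) by auto
    \<comment> \<open>For t \<phi> = 0 the quotient sin 0 / 0 takes the default value 0 instead of
      the limit 1, but it multiplies a zero vector and both sides are x.\<close>
    have "sphere_exp x ((t * \<phi>) \<cdot>\<^sub>v v) = circ x v (t * \<phi>)"
      using tp g(2,3) x' by (cases "t * \<phi> = 0") (auto simp: sphere_exp_def circ_def vnorm_smult_unit smult_smult_assoc)
    moreover have "t \<cdot>\<^sub>v sphere_log x y = (t * \<phi>) \<cdot>\<^sub>v v" unfolding g(4) by (simp add: smult_smult_assoc)
    ultimately show ?thesis using g(5)[OF tp] by simp
  qed
qed

section \<open>Riemannian gradient and second-order expansion\<close>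

text \<open>This is the Euclidean gradient. Since the Rayleigh quotient is homogeneous of degree 0,
  it is already orthogonal to x and no projection onto the tangent space occurs.\<close>

definition grad :: "real vec \<Rightarrow> real vec" where
  "grad x = (2 / quad Q x) \<cdot>\<^sub>v (P *\<^sub>v x - rq P Q x \<cdot>\<^sub>v (Q *\<^sub>v x))"

lemma grad_carrier: "x \<in> V \<Longrightarrow> grad x \<in> V"
  using P Q by (simp add: grad_def)

lemma grad_dot:
  assumes x: "x \<in> V" and w: "w \<in> V"
  shows "grad x \<bullet> w = 2 / quad Q x * (bil P w x - rq P Q x * bil Q w x)"
proof -
  have c: "P *\<^sub>v x \<in> V" "Q *\<^sub>v x \<in> V" using P Q x by auto
  have "(P *\<^sub>v x) \<bullet> w = bil P w x" "(Q *\<^sub>v x) \<bullet> w = bil Q w x"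
    unfolding bil_def using c w by (auto intro: comm_scalar_prod)
  moreover have "P *\<^sub>v x - rq P Q x \<cdot>\<^sub>v (Q *\<^sub>v x) \<in> V" using c by simp
  ultimately show ?thesis unfolding grad_def using c w
    by (simp add: minus_scalar_prod_distrib[of _ n] smult_scalar_prod_distrib[of _ n])
qed

lemma bil_bound:
  assumes M: "M \<in> SM" and M_bd: "\<And>x. x \<in> V \<Longrightarrow> 0 \<le> quad M x \<and> quad M x \<le> c * (x \<bullet> x)"
    and x: "x \<in> V" "x \<bullet> x = 1" and d: "d \<in> V"
  shows "\<bar>bil M d x\<bar> \<le> c * vnorm d"
proof (rule abs_le_of_square_le)
  have c: "0 \<le> c" using M_bd[OF x(1)] x(2) by simp
  have "(bil M d x)\<^sup>2 \<le> quad M d * quad M x"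
    by (rule cauchy_schwarz_psd[OF M _ d x(1)]) (use M_bd in blast)
  also have "\<dots> \<le> (c * (d \<bullet> d)) * (c * 1)"
    using M_bd[OF d] M_bd[OF x(1)] x(2) c scalar_prod_self_nonneg[of d] by (intro mult_mono) auto
  also have "\<dots> = (c * vnorm d)\<^sup>2"
    using scalar_prod_self_nonneg[of d] by (simp add: vnorm_def power2_eq_square)
  finally show "(bil M d x)\<^sup>2 \<le> (c * vnorm d)\<^sup>2" .
  show "0 \<le> c * vnorm d" using c scalar_prod_self_nonneg[of d] by (simp add: vnorm_def)
qed

text \<open>An explicit remainder of the form K |y - x|^2 makes e / K an admissible radius for the
  error e. It is obtained by expanding both forms at x, and the constants are uniform because Q is
  at least a / ln on the unit sphere.\<close>

lemma has_sphere_grad_rq: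
  assumes x: "x \<in> V" and xx: "x \<bullet> x = 1"
  shows "has_sphere_grad n (rq P Q) x (grad x)"
proof -
  have xn: "x \<noteq> 0\<^sub>v n" using x xx by auto
  have bQ: "0 \<le> quad Q z \<and> quad Q z \<le> b / l1 * (z \<bullet> z)" if "z \<in> V" for z
    using Q_nonneg[OF that] PQ_lower[OF that] P_upper[OF that] l
    by (auto simp: pos_le_divide_eq mult.commute)
  have bP: "0 \<le> quad P z \<and> quad P z \<le> b * (z \<bullet> z)" if "z \<in> V" for z
    using P_nonneg[OF that] P_upper[OF that] by simp
  define f where "f = rq P Q x"
  define B where "B = b / l1"
  define m where "m = a / ln"
  \<comment> \<open>The first summand collects the error of exchanging the denominators Q(x) and
    Q(y), the second the terms quadratic in y - x; the final division by m accounts for the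
    denominator Q(y).\<close>
  define K where "K = (2 * (b + f * B) * (4 * B) / m + (b + f * B)) / m"
  have f: "f > 0" "f * quad Q x = quad P x" using rq_ge[OF x xn] rq_mult[OF x xn] l by (auto simp: f_def)
  have B: "B > 0" and m: "m > 0" using b_pos a_pos l by (auto simp: B_def m_def)
  have K: "K > 0" unfolding K_def using b_pos f B m
    by (intro divide_pos_pos add_pos_pos mult_pos_pos) auto
  have qm: "m \<le> quad Q z" if "z \<in> V" "z \<bullet> z = 1" for z
    using PQ_upper[OF that(1)] P_lower[OF that(1)] that(2) l by (simp add: m_def pos_divide_le_eq mult.commute)
  have main: "\<bar>rq P Q y - rq P Q x - grad x \<bullet> (y - x)\<bar> \<le> K * (vnorm (y - x))\<^sup>2"
    if y: "y \<in> V" "y \<bullet> y = 1" for y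
  proof -
    define d where "d = y - x"
    define N where "N = vnorm d"
    have d: "d \<in> V" using x y by (simp add: d_def)
    have yd: "y = x + d" unfolding d_def by (rule eq_vecI) (use x y in auto)
    have yn: "y \<noteq> 0\<^sub>v n" using y by auto
    have N: "0 \<le> N" "N\<^sup>2 = d \<bullet> d" using scalar_prod_self_nonneg[of d] by (auto simp: N_def vnorm_def)
    \<comment> \<open>Unit vectors are at distance at most 2. This makes the quadratic term of Q(y)
      - Q(x) at most linear in N, so that the whole difference is at most 4 B N.\<close>
    have "d \<bullet> d = 2 - 2 * (x \<bullet> y)"
      unfolding d_def using x y xx comm_scalar_prod[OF y(1) x]
      by (simp add: minus_scalar_prod_distrib[of _ n] scalar_prod_minus_distrib[of _ n])
    moreover have "(x \<bullet> y)\<^sup>2 \<le> 1"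
      using cauchy_schwarz_psd[OF one_SM _ x y(1)] x y xx scalar_prod_self_nonneg
      by (simp add: quad_one dot_bil[symmetric])
    then have "- 1 \<le> x \<bullet> y" using abs_le_of_square_le[of "x \<bullet> y" 1] by simp
    ultimately have "N\<^sup>2 \<le> 2\<^sup>2" using N by simp
    then have N2: "N \<le> 2" by (rule power2_le_imp_le) simp
    have bPd: "\<bar>bil P d x\<bar> \<le> b * N" unfolding N_def by (rule bil_bound[OF P bP x xx d])
    have bQd: "\<bar>bil Q d x\<bar> \<le> B * N" unfolding N_def B_def by (rule bil_bound[OF Q bQ x xx d])
    define \<beta> where "\<beta> = bil P d x - f * bil Q d x"
    have "f * \<bar>bil Q d x\<bar> \<le> f * (B * N)" using bQd f by simp
    then have "\<bar>f * bil Q d x\<bar> \<le> f * (B * N)" using f by (simp add: abs_mult)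
    then have \<beta>: "\<bar>\<beta>\<bar> \<le> (b + f * B) * N" using bPd unfolding \<beta>_def by (simp add: algebra_simps)
    have qPy: "quad P y = quad P x + 2 * bil P d x + quad P d"
      unfolding yd quad_add[OF P x d] using bil_sym[OF P x d] by simp
    have qQy: "quad Q y = quad Q x + 2 * bil Q d x + quad Q d"
      unfolding yd quad_add[OF Q x d] using bil_sym[OF Q x d] by simp
    have "quad Q d \<le> B * N * N" using bQ[OF d] N by (simp add: B_def power2_eq_square mult.assoc)
    also have "\<dots> \<le> B * N * 2" using N2 N B by (intro mult_left_mono) auto
    finally have "\<bar>quad Q x - quad Q y\<bar> \<le> 4 * B * N" unfolding qQy using bQd bQ[OF d] by (simp add: abs_le_iff)
    then have 1: "\<bar>2 * \<beta> * (quad Q x - quad Q y)\<bar> \<le> 2 * ((b + f * B) * N) * (4 * B * N)"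
      unfolding abs_mult using \<beta> b_pos f B N by (intro mult_mono) auto
    have "\<bar>2 * \<beta> * (quad Q x - quad Q y) / quad Q x\<bar> \<le> 2 * ((b + f * B) * N) * (4 * B * N) / m"
      unfolding abs_divide using 1 qm[OF x xx] m by (intro frac_le) auto
    moreover have "\<bar>quad P d - f * quad Q d\<bar> \<le> (b + f * B) * N\<^sup>2"
    proof -
      have "f * quad Q d \<le> f * (B * N\<^sup>2)" using bQ[OF d] N f by (intro mult_left_mono) (simp_all add: B_def)
      moreover have "0 \<le> f * quad Q d" using bQ[OF d] f by simp
      moreover have "0 \<le> quad P d" "quad P d \<le> b * N\<^sup>2" using bP[OF d] N by auto
      moreover have "0 \<le> b * N\<^sup>2" "0 \<le> f * (B * N\<^sup>2)" using b_pos f B by auto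
      ultimately show ?thesis by (simp add: abs_le_iff algebra_simps)
    qed
    ultimately have "\<bar>2 * \<beta> * (quad Q x - quad Q y) / quad Q x + (quad P d - f * quad Q d)\<bar>
        \<le> 2 * ((b + f * B) * N) * (4 * B * N) / m + (b + f * B) * N\<^sup>2" by linarith
    also have "\<dots> = K * m * N\<^sup>2" unfolding K_def using m by (simp add: power2_eq_square field_simps)
    finally have num: "\<bar>2 * \<beta> * (quad Q x - quad Q y) / quad Q x + (quad P d - f * quad Q d)\<bar> \<le> K * N\<^sup>2 * m"
      by (simp add: mult_ac)
    have qQ: "quad Q x > 0" "quad Q y > 0" using Q_pos[OF x xn] Q_pos[OF y(1) yn] by auto
    \<comment> \<open>The first-order term is divided by Q(y) in the quotient but by Q(x) in the
      gradient; the mismatch is the summand with \<open>quad Q x - quad Q y\<close>.\<close>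
    have "rq P Q y - f - 2 / quad Q x * \<beta>
        = (2 * \<beta> * (quad Q x - quad Q y) / quad Q x + (quad P d - f * quad Q d)) / quad Q y"
    proof -
      have "quad P y - f * quad Q y = 2 * \<beta> + (quad P d - f * quad Q d)"
        unfolding qPy qQy \<beta>_def using f(2) by (simp add: algebra_simps)
      then have *: "rq P Q y - f = (2 * \<beta> + (quad P d - f * quad Q d)) / quad Q y"
        using qQ by (simp add: rq_def field_simps)
      show ?thesis unfolding * using qQ by (simp add: field_simps)
    qed
    moreover have "grad x \<bullet> d = 2 / quad Q x * \<beta>" unfolding grad_dot[OF x d] \<beta>_def f_def by simp
    ultimately have "\<bar>rq P Q y - f - grad x \<bullet> d\<bar> \<le> K * N\<^sup>2 * m / quad Q y"
      using num qQ by (simp add: abs_divide divide_right_mono)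
    also have "\<dots> \<le> K * N\<^sup>2"
    proof -
      have "K * N\<^sup>2 * m \<le> K * N\<^sup>2 * quad Q y" using qm[OF y] K by (intro mult_left_mono) auto
      then show ?thesis using qQ by (simp add: pos_divide_le_eq)
    qed
    finally show ?thesis unfolding f_def N_def d_def .
  qed
  show ?thesis unfolding has_sphere_grad_def
  proof (intro conjI allI impI)
    show "grad x \<in> V" by (rule grad_carrier[OF x])
    show "grad x \<bullet> x = 0" unfolding grad_dot[OF x x] quad_bil[symmetric] rq_mult[OF x xn] by simp
    fix e :: real assume e: "e > 0"
    show "\<exists>\<delta>>0. \<forall>y\<in>usphere n. vnorm (y - x) < \<delta> \<longrightarrow>
      \<bar>rq P Q y - rq P Q x - grad x \<bullet> (y - x)\<bar> \<le> e * vnorm (y - x)"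
    proof (intro exI[of _ "e / K"] conjI ballI impI)
      show "0 < e / K" using e K by simp
      fix y assume y: "y \<in> usphere n" and small: "vnorm (y - x) < e / K"
      have yV: "y \<in> V" "y \<bullet> y = 1" using y by (auto simp: usphere_def vnorm_def)
      have N0: "0 \<le> vnorm (y - x)" using scalar_prod_self_nonneg[of "y - x"] by (simp add: vnorm_def)
      have "K * (vnorm (y - x))\<^sup>2 = (K * vnorm (y - x)) * vnorm (y - x)" by (simp add: power2_eq_square)
      also have "\<dots> \<le> e * vnorm (y - x)"
        using small K N0 by (intro mult_right_mono) (auto simp: pos_less_divide_eq mult.commute less_imp_le)
      finally show "\<bar>rq P Q y - rq P Q x - grad x \<bullet> (y - x)\<bar> \<le> e * vnorm (y - x)"
        using main[OF yV] by simp
    qed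
  qed
qed

text \<open>On a unit-speed great circle the acceleration is minus the position, so the derivative
  of the bilinear form of velocity and position is a difference of two values of the quadratic
  form.\<close>

lemma circ_derivs:
  assumes M: "M \<in> SM" and x: "x \<in> V" and v: "v \<in> V"
  defines "\<gamma>' \<equiv> \<lambda>t. (- sin t) \<cdot>\<^sub>v x + cos t \<cdot>\<^sub>v v"
  shows "((\<lambda>t. quad M (circ x v t)) has_real_derivative 2 * bil M (\<gamma>' t) (circ x v t)) (at t)"
    "((\<lambda>t. bil M (\<gamma>' t) (circ x v t)) has_real_derivative quad M (\<gamma>' t) - quad M (circ x v t)) (at t)"
proof -
  have vx: "bil M v x = bil M x v" by (rule bil_sym[OF M v x])
  have q: "quad M (circ x v t) = (cos t)\<^sup>2 * quad M x + 2 * cos t * sin t * bil M x v + (sin t)\<^sup>2 * quad M v" for t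
    unfolding circ_def by (rule quad_comb[OF M x v])
  have q': "quad M (\<gamma>' t) = (sin t)\<^sup>2 * quad M x - 2 * sin t * cos t * bil M x v + (cos t)\<^sup>2 * quad M v" for t
    unfolding \<gamma>'_def by (subst quad_comb[OF M x v]) simp
  have b: "bil M (\<gamma>' t) (circ x v t) = sin t * cos t * (quad M v - quad M x) + ((cos t)\<^sup>2 - (sin t)\<^sup>2) * bil M x v" for t
    unfolding \<gamma>'_def circ_def using M x v vx by (simp add: quad_bil power2_eq_square algebra_simps)
  show "((\<lambda>t. quad M (circ x v t)) has_real_derivative 2 * bil M (\<gamma>' t) (circ x v t)) (at t)"
    unfolding q b by (auto intro!: derivative_eq_intros simp: power2_eq_square algebra_simps)
  show "((\<lambda>t. bil M (\<gamma>' t) (circ x v t)) has_real_derivative quad M (\<gamma>' t) - quad M (circ x v t)) (at t)"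
    unfolding q q' b by (auto intro!: derivative_eq_intros simp: power2_eq_square algebra_simps)
qed

text \<open>Position and velocity of the connecting geodesic stay unit and Euclidean-orthogonal, and
  its points stay in the set. Hence \<open>hess_bounds\<close> holds along the whole arc, and the
  one-variable Taylor estimates apply with arc length as parameter.\<close>

lemma rq_second_order:
  assumes x: "x \<in> X" and y: "y \<in> X" and k: "(cos \<theta>)\<^sup>2 \<le> 1 / 2" and \<epsilon>2: "\<epsilon> < 1 / 2" and orq: "\<rho> < orq"
  shows "rq P Q x + grad x \<bullet> sphere_log x y + \<mu>B / 2 * (vnorm (sphere_log x y))\<^sup>2 \<le> rq P Q y"
    "rq P Q y \<le> rq P Q x + grad x \<bullet> sphere_log x y + LB / 2 * (vnorm (sphere_log x y))\<^sup>2"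
proof -
  note x' = X_D[OF x]
  have "rq P Q x + grad x \<bullet> sphere_log x y + \<mu>B / 2 * (vnorm (sphere_log x y))\<^sup>2 \<le> rq P Q y \<and>
    rq P Q y \<le> rq P Q x + grad x \<bullet> sphere_log x y + LB / 2 * (vnorm (sphere_log x y))\<^sup>2"
  proof (cases "x = y")
    case True
    have "sphere_log x y = 0\<^sub>v n" using sphere_log_self[OF x'(1,2)] True by simp
    then show ?thesis using True grad_carrier[OF x'(1)] by (simp add: vnorm_def)
  next
    case False
    obtain \<phi> v where g: "0 < \<phi>" "v \<in> V" "v \<bullet> x = 0" "v \<bullet> v = 1" "sphere_log x y = \<phi> \<cdot>\<^sub>v v"
      "circ x v \<phi> = y" "\<And>t. 0 \<le> t \<Longrightarrow> t \<le> \<phi> \<Longrightarrow> circ x v t \<in> X"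
      using geodesic[OF x y False k \<epsilon>2] by blast
    define c' where "c' t = (- sin t) \<cdot>\<^sub>v x + cos t \<cdot>\<^sub>v v" for t
    define h where "h t = quad P (circ x v t) / quad Q (circ x v t)" for t
    define h' where "h' t = 2 / quad Q (circ x v t) *
      (bil P (c' t) (circ x v t) - h t * bil Q (c' t) (circ x v t))" for t
    have h_rq: "h t = rq P Q (circ x v t)" for t by (simp add: h_def rq_def)
    have cV: "circ x v t \<in> V" "c' t \<in> V" for t using x' g by (auto simp: circ_def c'_def)
    have xv: "x \<bullet> v = 0" using comm_scalar_prod[OF x'(1) g(2)] g(3) by simp
    have c'1: "c' t \<bullet> c' t = 1" for t
      using quad_comb[OF one_SM x'(1) g(2), of "- sin t" "cos t"] x' g xv cV(2)[of t]
      by (simp add: quad_one c'_def[symmetric] dot_bil[symmetric])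
    have orth: "c' t \<bullet> circ x v t = 0" for t
      unfolding dot_bil[OF cV(2) cV(1)] unfolding c'_def circ_def using x' g xv
      by (simp add: dot_bil[symmetric])
    have c'_orth: "c' t \<in> orth n (circ x v t)" for t
      using cV orth[of t] c'1[of t] by (auto simp: orth_def)
    have derivs: "(h has_real_derivative h' t) (at t)"
      "(h' has_real_derivative hess (circ x v t) (c' t)) (at t)" if t: "0 \<le> t" "t \<le> \<phi>" for t
    proof -
      have q: "quad Q (circ x v t) \<noteq> 0" using Q_pos X_D[OF g(7)[OF t]] by force
      note D = circ_derivs[OF P x'(1) g(2), of t, folded c'_def] circ_derivs[OF Q x'(1) g(2), of t, folded c'_def]
      note E = quotient_derivs[OF D(1,3,2,4) q]
      show "(h has_real_derivative h' t) (at t)" using E(1) unfolding h_def h'_def .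
      show "(h' has_real_derivative hess (circ x v t) (c' t)) (at t)"
        using E(2) unfolding h'_def h_def hess_def rq_def .
    qed
    have hs: "\<mu>B \<le> hess (circ x v t) (c' t)" "hess (circ x v t) (c' t) \<le> LB" if t: "0 \<le> t" "t \<le> \<phi>" for t
      using hess_bounds[OF X_D(5)[OF g(7)[OF t]] c'_orth X_D(2)[OF g(7)[OF t]] c'1 orq] by auto
    have c0: "circ x v 0 = x" "c' 0 = v" using x' g by (auto simp: circ_def c'_def)
    have h0: "h 0 = rq P Q x" "h \<phi> = rq P Q y" unfolding h_rq c0 g(6) by auto
    have h'0: "\<phi> * h' 0 = grad x \<bullet> sphere_log x y"
      unfolding g(5) using grad_carrier[OF x'(1)] g(2) grad_dot[OF x'(1) g(2)]
      by (simp add: h'_def h_rq c0)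
    have vn: "(vnorm (sphere_log x y))\<^sup>2 = \<phi>\<^sup>2" unfolding g(5) using g by (simp add: vnorm_smult_unit)
    have "h 0 + \<phi> * h' 0 + \<mu>B / 2 * \<phi>\<^sup>2 \<le> h \<phi>"
      using g(1) derivs hs by (intro second_order_lower[where h'' = "\<lambda>t. hess (circ x v t) (c' t)"]) auto
    moreover have "h \<phi> \<le> h 0 + \<phi> * h' 0 + LB / 2 * \<phi>\<^sup>2"
      using g(1) derivs hs by (intro second_order_upper[where h'' = "\<lambda>t. hess (circ x v t) (c' t)"]) auto
    ultimately show ?thesis unfolding h0 h'0 vn by simp
  qed
  then show "rq P Q x + grad x \<bullet> sphere_log x y + \<mu>B / 2 * (vnorm (sphere_log x y))\<^sup>2 \<le> rq P Q y"
    "rq P Q y \<le> rq P Q x + grad x \<bullet> sphere_log x y + LB / 2 * (vnorm (sphere_log x y))\<^sup>2" by auto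
qed

lemma rq_geod_convex:
  assumes "(cos \<theta>)\<^sup>2 \<le> 1 / 2" "\<epsilon> < 1 / 2" "\<rho> < orq" "0 < \<mu>B"
  shows "geod_convex_fun n X (rq P Q) \<mu>B"
  unfolding geod_convex_fun_def
  using assms geod_convex_X has_sphere_grad_rq X_D(1,2) rq_second_order(1) by metis

lemma rq_geod_smooth:
  assumes "(cos \<theta>)\<^sup>2 \<le> 1 / 2" "\<epsilon> < 1 / 2" "\<rho> < orq"
  shows "geod_smooth_fun n X (rq P Q) LB"
  unfolding geod_smooth_fun_def
  using assms geod_convex_X has_sphere_grad_rq X_D(1,2) rq_second_order(2) by metis

end

subsection \<open>Asymptotic form of the bounds\<close>

context rq_pencil
begin

definition "gap = (l2 - l1) / l2"

lemma gap: "0 < gap" "gap < 1"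
  using l by (auto simp: gap_def)

lemma gap_alt: "gap = 1 - l1 / l2"
  using l by (simp add: gap_def diff_divide_distrib)

lemma \<rho>_eq: "l1 = \<rho> * (1 - \<epsilon> * gap)"
  using \<epsilon>_gap \<rho>_pos by (simp add: gap_def)

lemma \<rho>_eq': "\<rho> = l1 + \<epsilon> * gap * \<rho>"
proof -
  have "\<rho> * (1 - \<epsilon> * gap) = \<rho> - \<epsilon> * gap * \<rho>" by (simp add: algebra_simps)
  then show ?thesis using \<rho>_eq by linarith
qed

lemma \<epsilon>_gap_le: "\<epsilon> * gap \<le> \<epsilon>"
  using gap \<epsilon>_nonneg mult_left_le[of gap \<epsilon>] by simp

text \<open>The bound for 1 / orq, multiplied by \<rho>, contributes an error proportional to \<rho>
  / l1 - \<rho> / l2 = gap \<rho> / l1, and replacing \<rho> / l2 by l1 / l2 costs at most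
  \<epsilon> gap. So gap can be factored out of everything.\<close>

lemma gap_bound:
  assumes k: "0 \<le> k"
    and K: "\<And>x v. x \<in> S \<Longrightarrow> v \<in> orth n x \<Longrightarrow> (bil P v x)\<^sup>2 \<le> k\<^sup>2 * quad P v * quad P x"
    and \<epsilon>1: "\<epsilon> < 1"
  shows "gap * (1 - \<epsilon> - (k + sqrt \<epsilon>)\<^sup>2 / (1 - \<epsilon>)\<^sup>2) \<le> 1 - \<rho> / orq"
proof -
  define \<tau> where "\<tau> = (k + sqrt \<epsilon>)\<^sup>2 / (1 - \<epsilon>)"
  have \<tau>: "0 \<le> \<tau>" using \<epsilon>1 by (simp add: \<tau>_def)
  have "\<rho> * (1 / orq) \<le> \<rho> * (1 / l2 + \<tau> * (1 / l1 - 1 / l2))"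
    unfolding \<tau>_def by (rule mult_left_mono[OF orq_lower(1)[OF k K \<epsilon>1]]) (use \<rho>_pos in auto)
  also have "\<dots> = \<rho> / l2 + \<tau> * (gap * (\<rho> / l1))"
    using l by (simp add: gap_def field_simps)
  also have "\<dots> \<le> \<rho> / l2 + \<tau> * (gap * (1 / (1 - \<epsilon>)))"
  proof -
    have "\<rho> * (1 - \<epsilon>) \<le> \<rho> * (1 - \<epsilon> * gap)"
      using \<epsilon>_gap_le \<rho>_pos by (intro mult_left_mono) auto
    also have "\<dots> = l1" by (rule \<rho>_eq[symmetric])
    finally have "\<rho> / l1 \<le> 1 / (1 - \<epsilon>)" using l \<epsilon>1 by (simp add: field_simps)
    then show ?thesis using \<tau> gap by (intro add_left_mono mult_left_mono) auto
  qed
  finally have 1: "\<rho> / orq \<le> \<rho> / l2 + gap * (\<tau> / (1 - \<epsilon>))" by (simp add: mult_ac)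
  have "\<rho> / l2 = (l1 + \<epsilon> * gap * \<rho>) / l2" using \<rho>_eq' by (rule arg_cong)
  also have "\<dots> = l1 / l2 + \<epsilon> * gap * (\<rho> / l2)" by (simp add: add_divide_distrib)
  also have "\<epsilon> * gap * (\<rho> / l2) \<le> \<epsilon> * gap * 1"
    using \<epsilon>_nonneg gap \<rho>_l2 l by (intro mult_left_mono) auto
  finally have "gap - \<epsilon> * gap \<le> 1 - \<rho> / l2" unfolding gap_alt by simp
  with 1 have "gap * (1 - \<epsilon> - \<tau> / (1 - \<epsilon>)) \<le> 1 - \<rho> / orq" by (simp add: algebra_simps)
  then show ?thesis by (simp add: \<tau>_def power2_eq_square)
qed

text \<open>The bound \<open>1 - a / b\<close> on the squared cosine stems from the condition number \<open>b / a\<close> of P alone.\<close>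

lemma orq_gt_\<rho>:
  assumes \<epsilon>: "\<epsilon> \<le> 1 / (64 * (b / a)\<^sup>2)"
  shows "\<rho> < orq"
proof -
  define m where "m = a / b"
  have m: "0 < m" "m \<le> 1" using a_pos b_pos a_le_\<sigma> \<sigma>_le_b by (auto simp: m_def)
  have \<epsilon>m: "\<epsilon> \<le> (m / 8)\<^sup>2" using \<epsilon> by (simp add: m_def power_divide)
  \<comment> \<open>A rational k with 1 - m \<le> k^2, by completing the square. The bound for
    \<epsilon> is chosen so that its root is at most m / 8; this leaves k + sqrt \<epsilon> \<le> 1
    - 3 m / 8, still further below 1 than 3 \<epsilon> \<le> 3 m / 64.\<close>
  define k where "k = 1 - m / 2"
  have k: "0 \<le> k" using m by (simp add: k_def)
  have km: "1 - m \<le> k\<^sup>2" by (simp add: k_def power2_eq_square algebra_simps)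
  have K: "(bil P v x)\<^sup>2 \<le> k\<^sup>2 * quad P v * quad P x" if "x \<in> S" "v \<in> orth n x" for x v
  proof -
    have v: "v \<in> V" "v \<bullet> x = 0" using that by (auto simp: orth_def)
    have "(bil P v x)\<^sup>2 \<le> (1 - m) * quad P v * quad P x"
      unfolding m_def by (rule orth_P_angle[OF S_D(1,2)[OF that(1)] v])
    also have "\<dots> \<le> k\<^sup>2 * quad P v * quad P x"
      using km P_nonneg[OF v(1)] P_nonneg[OF S_D(1)[OF that(1)]] by (intro mult_right_mono) auto
    finally show ?thesis .
  qed
  have m2: "m\<^sup>2 \<le> m" using m by (simp add: power2_eq_square mult_left_le)
  have \<epsilon>m': "\<epsilon> \<le> m / 64" using \<epsilon>m m2 by (simp add: power_divide)
  have \<epsilon>1: "\<epsilon> < 1" using \<epsilon>m' m by linarith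
  have "sqrt \<epsilon> \<le> m / 8" by (rule real_le_lsqrt) (use \<epsilon>m m in auto)
  then have "k + sqrt \<epsilon> \<le> 1 - 3 * m / 8" by (simp add: k_def)
  then have "(k + sqrt \<epsilon>)\<^sup>2 \<le> (1 - 3 * m / 8)\<^sup>2" using k \<epsilon>_nonneg by (intro power_mono) auto
  also have "\<dots> \<le> 1 - 3 * m / 8" using m by (simp add: power2_eq_square mult_left_le)
  also have "\<dots> < 1 - 3 * \<epsilon>" using \<epsilon>m' m by linarith
  also have "\<dots> \<le> (1 - \<epsilon>) * (1 - \<epsilon>)\<^sup>2"
  proof -
    have "(1 - \<epsilon>) * (1 - \<epsilon>)\<^sup>2 - (1 - 3 * \<epsilon>) = \<epsilon>\<^sup>2 * (3 - \<epsilon>)" by (simp add: power2_eq_square algebra_simps)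
    also have "\<dots> \<ge> 0" using \<epsilon>1 by (intro mult_nonneg_nonneg) auto
    finally show ?thesis by simp
  qed
  finally have "(k + sqrt \<epsilon>)\<^sup>2 / (1 - \<epsilon>)\<^sup>2 < 1 - \<epsilon>" using \<epsilon>1 by (simp add: pos_divide_less_eq)
  then have "0 < gap * (1 - \<epsilon> - (k + sqrt \<epsilon>)\<^sup>2 / (1 - \<epsilon>)\<^sup>2)" using gap by simp
  also have "\<dots> \<le> 1 - \<rho> / orq" by (rule gap_bound[OF k K \<epsilon>1])
  finally show ?thesis using orq_lower(2)[OF k K \<epsilon>1] by simp
qed

definition "q = (cos \<theta>)\<^sup>2 / gap\<^sup>2 + \<epsilon>"

lemma q_bounds: "(cos \<theta>)\<^sup>2 \<le> (cos \<theta>)\<^sup>2 / gap\<^sup>2" "(cos \<theta>)\<^sup>2 + \<epsilon> \<le> q" "0 \<le> q" "\<epsilon> \<le> q"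
proof -
  have "gap\<^sup>2 \<le> 1" using gap by (simp add: power_le_one)
  then show 1: "(cos \<theta>)\<^sup>2 \<le> (cos \<theta>)\<^sup>2 / gap\<^sup>2" using gap by (simp add: pos_le_divide_eq mult_left_le)
  then show "(cos \<theta>)\<^sup>2 + \<epsilon> \<le> q" by (simp add: q_def)
  show "0 \<le> q" "\<epsilon> \<le> q" using \<epsilon>_nonneg by (auto simp: q_def)
qed

lemma \<kappa>_ge: "1 \<le> \<sigma> / a" "\<sigma> / a \<le> b / a" "1 \<le> b / a"
  using a_le_\<sigma> \<sigma>_le_b a_pos by (auto simp: divide_right_mono)

context
  assumes small: "b / a * q \<le> 1 / 110"
begin

text \<open>The threshold 1 / 110 is half of 1 / 55: with the error constant 55 of
  \<open>\<mu>B_bound\<close>, at least half of the leading term of \<open>\<mu>B\<close>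
  survives.\<close>

lemma small_facts: "\<sigma> / a * q \<le> 1 / 110" "q \<le> \<sigma> / a * q" "q \<le> b / a * q" "\<sigma> / a * q \<le> b / a * q"
  "q \<le> 1 / 110" "(cos \<theta>)\<^sup>2 \<le> 1 / 2" "\<epsilon> < 1 / 2"
proof -
  show *: "q \<le> \<sigma> / a * q" "q \<le> b / a * q" "\<sigma> / a * q \<le> b / a * q"
    using mult_right_mono[OF \<kappa>_ge(1) q_bounds(3)] mult_right_mono[OF \<kappa>_ge(3) q_bounds(3)]
      mult_right_mono[OF \<kappa>_ge(2) q_bounds(3)] by auto
  show "\<sigma> / a * q \<le> 1 / 110" and **: "q \<le> 1 / 110" using * small by linarith+
  show "(cos \<theta>)\<^sup>2 \<le> 1 / 2" "\<epsilon> < 1 / 2" using ** q_bounds \<epsilon>_nonneg by auto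
qed

lemma inv_smin: "1 / smin \<le> (1 + 3 * (\<sigma> / a * q)) / \<sigma>"
proof -
  have "\<sigma> / a * \<epsilon> \<le> \<sigma> / a * q"
    using q_bounds(4) \<kappa>_ge(1) by (intro mult_left_mono) auto
  moreover have "2 * (cos \<theta>)\<^sup>2 + \<epsilon> \<le> 2 * q" using q_bounds(2) \<epsilon>_nonneg by linarith
  ultimately have "1 + 2 * (cos \<theta>)\<^sup>2 + \<epsilon> + \<sigma> / a * \<epsilon> \<le> 1 + 3 * (\<sigma> / a * q)"
    using small_facts(2) by linarith
  then show ?thesis
    using smin_bound[OF small_facts(6)] \<sigma>_pos by (meson divide_right_mono less_imp_le order_trans)
qed

lemma \<rho>_upper: "\<rho> \<le> l1 * (1 + 2 * \<epsilon>)"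
proof -
  have "\<rho> * 1 \<le> \<rho> * ((1 - \<epsilon>) * (1 + 2 * \<epsilon>))"
  proof (rule mult_left_mono)
    have "\<epsilon> * \<epsilon> \<le> \<epsilon> * (1 / 2)" using small_facts(7) \<epsilon>_nonneg by (intro mult_left_mono) auto
    then show "1 \<le> (1 - \<epsilon>) * (1 + 2 * \<epsilon>)" by (simp add: algebra_simps)
  qed (use \<rho>_pos in simp)
  also have "\<dots> \<le> \<rho> * ((1 - \<epsilon> * gap) * (1 + 2 * \<epsilon>))"
    using \<epsilon>_gap_le \<epsilon>_nonneg \<rho>_pos by (intro mult_left_mono mult_right_mono) auto
  finally show ?thesis unfolding mult.assoc[symmetric] \<rho>_eq[symmetric] by simp
qed

text \<open>With t = (\<rho> - l1) / l1, the term t is at most 2 \<epsilon> gap, but the square root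
  of t supplies only the square root of gap. Writing cos \<theta> as gap times cos \<theta> / gap
  and applying the arithmetic-geometric mean inequality restores a full factor gap at the price of
  (cos \<theta> / gap)^2. The constant is 8 * 2 * 2 * 3 / 2 = 48, from \<rho> \<le> 2 l1, 1 / smin
  \<le> 2 / \<sigma> and the bracket 3 gap q.\<close>

lemma CX_bound: "CX \<le> 2 * b * l1 / \<sigma> * gap * (48 * q)"
proof -
  define t where "t = (\<rho> - l1) / l1"
  have t0: "0 \<le> t" using \<rho> l by (simp add: t_def)
  have \<rho>2: "\<rho> \<le> 2 * l1"
  proof -
    have "l1 * (1 + 2 * \<epsilon>) \<le> l1 * 2" using small_facts(7) l by (intro mult_left_mono) auto
    then show ?thesis using \<rho>_upper by simp
  qed
  have "t = \<epsilon> * gap * (\<rho> / l1)" unfolding t_def using \<rho>_eq l by (simp add: field_simps)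
  also have "\<dots> \<le> \<epsilon> * gap * 2"
    using \<rho>2 l \<epsilon>_nonneg gap by (intro mult_left_mono) (auto simp: pos_divide_le_eq)
  finally have t: "t \<le> 2 * (\<epsilon> * gap)" by simp
  have "sqrt t * cos \<theta> = gap * (sqrt t * (cos \<theta> / gap))" using gap by simp
  also have "\<dots> \<le> gap * q"
  proof (rule mult_left_mono)
    have "2 * sqrt t * (cos \<theta> / gap) \<le> (sqrt t)\<^sup>2 + (cos \<theta> / gap)\<^sup>2" by (rule sum_squares_bound)
    also have "\<dots> = t + (cos \<theta>)\<^sup>2 / gap\<^sup>2" using t0 by (simp add: power_divide)
    also have "\<dots> \<le> 2 * q"
    proof -
      have t2: "t \<le> 2 * \<epsilon>" using t \<epsilon>_gap_le by linarith
      have *: "t + W \<le> 2 * (W + \<epsilon>)" if "0 \<le> W" for W using t2 that by simp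
      show ?thesis unfolding q_def by (rule *) simp
    qed
    finally show "sqrt t * (cos \<theta> / gap) \<le> q" by simp
  qed (use gap in simp)
  moreover have "\<epsilon> * gap \<le> gap * q" using q_bounds(4) gap by (simp add: mult.commute)
  ultimately have ts: "t + sqrt t * cos \<theta> \<le> 3 * (gap * q)" using t by linarith
  have "1 / smin \<le> 2 / \<sigma>"
  proof -
    have "(1 + 3 * (\<sigma> / a * q)) / \<sigma> \<le> 2 / \<sigma>" using small_facts(1) \<sigma>_pos by (intro divide_right_mono) auto
    then show ?thesis using inv_smin by linarith
  qed
  then have "8 * b * \<rho> * (1 / smin) \<le> 8 * b * (2 * l1) * (2 / \<sigma>)"
    using \<rho>2 b_pos \<rho>_pos smin_pos by (intro mult_mono) auto
  then have "8 * b * \<rho> / smin * (t + sqrt t * cos \<theta>) \<le> 8 * b * (2 * l1) * (2 / \<sigma>) * (3 * (gap * q))"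
    using ts b_pos \<rho>_pos smin_pos l \<sigma>_pos t0 cos_\<theta> by (intro mult_mono) auto
  then show ?thesis unfolding CX_def t_def by (simp add: mult_ac)
qed

text \<open>The losses are 2 q from \<open>smax\<close>, 5 q from 1 - \<rho> / orq (one for
  \<epsilon> and four for the share of u), and 48 q from \<open>CX\<close>, where exchanging b for a
  costs the factor b / a. Since q \<le> b / a q, they add up to 55.\<close>

lemma \<mu>B_bound: "2 * a * l1 / \<sigma> * gap * (1 - 55 * (b / a * q)) \<le> \<mu>B"
proof -
  have c: "(cos \<theta>)\<^sup>2 + \<epsilon> \<le> q" by (rule q_bounds)
  have \<epsilon>1: "\<epsilon> < 1" using small_facts(7) by simp
  have "(cos \<theta> + sqrt \<epsilon>)\<^sup>2 \<le> 2 * q"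
    using sum_squares_bound[of "cos \<theta>" "sqrt \<epsilon>"] c \<epsilon>_nonneg by (simp add: power2_sum)
  moreover have "1 / 2 \<le> (1 - \<epsilon>)\<^sup>2"
  proof -
    have "\<epsilon> \<le> 1 / 110" using q_bounds(4) small_facts(5) by linarith
    then have "(109 / 110)\<^sup>2 \<le> (1 - \<epsilon>)\<^sup>2" by (intro power_mono) auto
    then show ?thesis by (simp add: power2_eq_square)
  qed
  ultimately have "(cos \<theta> + sqrt \<epsilon>)\<^sup>2 / (1 - \<epsilon>)\<^sup>2 \<le> 2 * q / (1 / 2)"
    using q_bounds(3) by (intro frac_le) auto
  then have "1 - 5 * q \<le> 1 - \<epsilon> - (cos \<theta> + sqrt \<epsilon>)\<^sup>2 / (1 - \<epsilon>)\<^sup>2" using q_bounds(4) by simp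
  then have "gap * (1 - 5 * q) \<le> gap * (1 - \<epsilon> - (cos \<theta> + sqrt \<epsilon>)\<^sup>2 / (1 - \<epsilon>)\<^sup>2)"
    using gap by (intro mult_left_mono) auto
  also have "\<dots> \<le> 1 - \<rho> / orq" by (rule gap_bound[OF cos_\<theta>(1) angle_bound \<epsilon>1])
  finally have g: "gap * (1 - 5 * q) \<le> 1 - \<rho> / orq" .
  have "(1 - 2 * q) / \<sigma> \<le> (1 - 2 * \<epsilon> - 2 * (cos \<theta>)\<^sup>2) / \<sigma>"
    using c \<sigma>_pos by (intro divide_right_mono) auto
  also have "\<dots> \<le> 1 / smax"
    using c small_facts(5,6) by (intro smax_bound) auto
  finally have s: "(1 - 2 * q) / \<sigma> \<le> 1 / smax" .
  have q0: "0 \<le> q * q" by simp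
  have "2 * a * l1 / \<sigma> * gap * (1 - 7 * q) \<le> 2 * a * l1 / \<sigma> * gap * ((1 - 2 * q) * (1 - 5 * q))"
    using a_pos l \<sigma>_pos gap q0 by (intro mult_left_mono) (auto simp: algebra_simps)
  also have "\<dots> = 2 * a * l1 * ((1 - 2 * q) / \<sigma> * (gap * (1 - 5 * q)))" by simp
  also have "\<dots> \<le> 2 * a * l1 * (1 / smax * (1 - \<rho> / orq))"
    using s g a_pos l small_facts(5) gap \<sigma>_le_smax \<sigma>_pos
    by (intro mult_left_mono mult_mono) auto
  finally have 1: "2 * a * l1 / \<sigma> * gap * (1 - 7 * q) - CX \<le> \<mu>B" by (simp add: \<mu>B_def)
  have "2 * b * l1 / \<sigma> * gap * (48 * q) = 2 * a * l1 / \<sigma> * gap * (48 * (b / a * q))"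
    using a_pos by simp
  then have "2 * a * l1 / \<sigma> * gap * (1 - 7 * q) - 2 * a * l1 / \<sigma> * gap * (48 * (b / a * q)) \<le> \<mu>B"
    using 1 CX_bound by linarith
  moreover have "2 * a * l1 / \<sigma> * gap * (1 - 55 * (b / a * q))
      \<le> 2 * a * l1 / \<sigma> * gap * (1 - 7 * q - 48 * (b / a * q))"
    using a_pos l \<sigma>_pos gap small_facts(3) by (intro mult_left_mono) auto
  ultimately show ?thesis by (simp only: right_diff_distrib)
qed

text \<open>The product of the errors in \<rho> and 1 / smin is at most 1 + 8 s, and
  \<open>CX\<close> contributes 48 s, because gap \<le> 1 - l1 / ln lets it be absorbed into the
  leading term. Both share the factor b, so no ratio b / a appears.\<close>

lemma LB_bound: "LB \<le> 2 * b * l1 / \<sigma> * (1 - l1 / ln) * (1 + 56 * (\<sigma> / a * q))"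
proof -
  define s where "s = \<sigma> / a * q"
  have s: "0 \<le> s" "q \<le> s" "\<epsilon> \<le> s" using small_facts(2) q_bounds by (auto simp: s_def)
  define G where "G = 1 - l1 / ln"
  have G: "0 \<le> G" "gap \<le> G" using l by (auto simp: G_def gap_alt frac_le)
  have "\<rho> * (1 / smin) \<le> (l1 * (1 + 2 * \<epsilon>)) * ((1 + 3 * s) / \<sigma>)"
    using inv_smin \<rho>_upper \<rho>_pos smin_pos l \<epsilon>_nonneg by (intro mult_mono) (auto simp: s_def)
  also have "\<dots> = l1 / \<sigma> * ((1 + 2 * \<epsilon>) * (1 + 3 * s))" by simp
  also have "\<dots> \<le> l1 / \<sigma> * (1 + 8 * s)"
  proof (rule mult_left_mono)
    have "\<epsilon> * s \<le> 1 / 2 * s" using small_facts(7) s by (intro mult_right_mono) auto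
    then show "(1 + 2 * \<epsilon>) * (1 + 3 * s) \<le> 1 + 8 * s" using s by (simp add: algebra_simps)
  qed (use l \<sigma>_pos in auto)
  finally have "2 * b * G * (\<rho> * (1 / smin)) \<le> 2 * b * G * (l1 / \<sigma> * (1 + 8 * s))"
    using b_pos G by (intro mult_left_mono) auto
  then have 1: "2 * b * \<rho> / smin * G \<le> 2 * b * l1 / \<sigma> * G * (1 + 8 * s)" by (simp add: mult_ac)
  have "CX \<le> 2 * b * l1 / \<sigma> * (gap * (48 * q))" using CX_bound by simp
  also have "\<dots> \<le> 2 * b * l1 / \<sigma> * (G * (48 * s))"
    using b_pos l \<sigma>_pos G s gap q_bounds(3) by (intro mult_left_mono mult_mono) auto
  finally have "LB \<le> 2 * b * l1 / \<sigma> * G * (1 + 8 * s) + 2 * b * l1 / \<sigma> * (G * (48 * s))"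
    using 1 unfolding LB_def G_def[symmetric] by linarith
  also have "\<dots> = 2 * b * l1 / \<sigma> * G * (1 + 56 * s)" by (simp add: algebra_simps add_divide_distrib)
  finally show ?thesis unfolding s_def G_def .
qed

lemma \<mu>B_pos: "0 < \<mu>B"
proof -
  have "0 < 2 * a * l1 / \<sigma> * gap * (1 - 55 * (b / a * q))"
    using a_pos l \<sigma>_pos gap small by (intro mult_pos_pos divide_pos_pos) auto
  then show ?thesis using \<mu>B_bound by linarith
qed

text \<open>The constant 222 is the least c with 1 + 56 z \<le> (1 + c z) (1 - 55 z) for all 0 \<le>
  z \<le> 1 / 110; equality holds at z = 1 / 110.\<close>

lemma condition_bound: "LB / \<mu>B \<le> b / a * ((1 - l1 / ln) / (1 - l1 / l2)) * (1 + 222 * (b / a * q))"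
proof -
  define z where "z = b / a * q"
  have z: "0 \<le> z" "z \<le> 1 / 110" "\<sigma> / a * q \<le> z" using small small_facts(3,4) q_bounds(3) by (auto simp: z_def)
  define G where "G = 1 - l1 / ln"
  have G: "0 \<le> G" using l by (simp add: G_def)
  have "1 + 56 * z \<le> (1 + 222 * z) * (1 - 55 * z)"
  proof -
    have "z * z \<le> 1 / 110 * z" using z by (intro mult_right_mono) auto
    then show ?thesis using z by (simp add: algebra_simps)
  qed
  moreover have c: "0 \<le> 2 * b * l1 / \<sigma> * G" using b_pos l \<sigma>_pos G by (intro mult_nonneg_nonneg divide_nonneg_pos) auto
  ultimately have "2 * b * l1 / \<sigma> * G * (1 + 56 * z) \<le> 2 * b * l1 / \<sigma> * G * ((1 + 222 * z) * (1 - 55 * z))"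
    by (intro mult_left_mono)
  moreover have "LB \<le> 2 * b * l1 / \<sigma> * G * (1 + 56 * z)"
  proof -
    have "2 * b * l1 / \<sigma> * G * (1 + 56 * (\<sigma> / a * q)) \<le> 2 * b * l1 / \<sigma> * G * (1 + 56 * z)"
      using c z by (intro mult_left_mono) auto
    then show ?thesis using LB_bound unfolding G_def by linarith
  qed
  ultimately have "LB \<le> 2 * b * l1 / \<sigma> * G * ((1 + 222 * z) * (1 - 55 * z))" by linarith
  also have "\<dots> = b / a * (G / gap) * (1 + 222 * z) * (2 * a * l1 / \<sigma> * gap * (1 - 55 * z))"
    using a_pos gap by simp
  also have "\<dots> \<le> b / a * (G / gap) * (1 + 222 * z) * \<mu>B"
    using \<mu>B_bound b_pos a_pos G gap z unfolding z_def[symmetric]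
    by (intro mult_left_mono mult_nonneg_nonneg divide_nonneg_pos) auto
  finally show ?thesis
    using \<mu>B_pos unfolding z_def G_def gap_alt by (simp add: pos_divide_le_eq)
qed

end

section \<open>Choice of the thresholds\<close>

text \<open>The thresholds make K \<epsilon> and K (cos \<theta> / gap)^2 at most 1 / 1000 each, and
  b / a \<le> K. In the second claim the angle contributes at most 8 / 1000 and the root at most 1 /
  2, so the sum is below 7 / 10, whose square is 49 / 100.\<close>

lemma gap_q_small:
  assumes K: "1 + b / a \<le> K" and \<epsilon>: "\<epsilon> < 1 / (1000 * K\<^sup>2)" and c: "cos \<theta> < gap / (1000 * K)"
  shows "b / a * q \<le> 1 / 110" "(8 * l2 / (l2 - l1) * cos \<theta> + sqrt (2 * \<epsilon>))\<^sup>2 \<le> 1 / 2"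
proof -
  define w where "w = cos \<theta> / gap"
  have K1: "1 \<le> K" "b / a \<le> K" using K \<kappa>_ge(3) by auto
  have w: "0 \<le> w" "w \<le> 1 / (1000 * K)"
    using c cos_\<theta>(1) gap K1 by (auto simp: w_def field_simps)
  have w1: "w \<le> 1 / 1000" using w K1 by (smt (verit) frac_le)
  have "w\<^sup>2 \<le> (1 / (1000 * K))\<^sup>2" using w by (intro power_mono) auto
  then have w2: "K * w\<^sup>2 \<le> 1 / 1000"
  proof -
    assume "w\<^sup>2 \<le> (1 / (1000 * K))\<^sup>2"
    then have "K * w\<^sup>2 \<le> K * (1 / (1000 * K))\<^sup>2" using K1 by (intro mult_left_mono) auto
    also have "\<dots> = 1 / (1000000 * K)" using K1 by (simp add: power2_eq_square)
    also have "\<dots> \<le> 1 / 1000" using K1 by (intro frac_le) auto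
    finally show ?thesis .
  qed
  have \<epsilon>K: "K * \<epsilon> \<le> 1 / 1000"
  proof -
    have "K * \<epsilon> \<le> K * (1 / (1000 * K\<^sup>2))" using \<epsilon> K1 by (intro mult_left_mono) auto
    also have "\<dots> = 1 / (1000 * K)" using K1 by (simp add: power2_eq_square)
    also have "\<dots> \<le> 1 / 1000" using K1 by (intro frac_le) auto
    finally show ?thesis .
  qed
  have q_w: "q = w\<^sup>2 + \<epsilon>" by (simp add: q_def w_def power_divide)
  have "b / a * q \<le> K * q" using K1 q_bounds(3) by (intro mult_right_mono) auto
  also have "\<dots> \<le> 1 / 110" unfolding q_w using w2 \<epsilon>K by (simp add: distrib_left)
  finally show "b / a * q \<le> 1 / 110" .
  have "\<epsilon> \<le> K * \<epsilon>" using K1 \<epsilon>_nonneg by (simp add: mult_le_cancel_right1)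
  then have e1: "\<epsilon> \<le> 1 / 1000" using \<epsilon>K by simp
  have "8 * l2 / (l2 - l1) * cos \<theta> = 8 * w" by (simp add: w_def gap_def)
  moreover have "sqrt (2 * \<epsilon>) \<le> 1 / 2" using e1 by (intro real_le_lsqrt) (auto simp: power2_eq_square)
  ultimately have "8 * l2 / (l2 - l1) * cos \<theta> + sqrt (2 * \<epsilon>) \<le> 7 / 10" using w1 by simp
  moreover have "0 \<le> 8 * l2 / (l2 - l1) * cos \<theta> + sqrt (2 * \<epsilon>)"
    using \<open>8 * l2 / (l2 - l1) * cos \<theta> = 8 * w\<close> w \<epsilon>_nonneg by simp
  ultimately have "(8 * l2 / (l2 - l1) * cos \<theta> + sqrt (2 * \<epsilon>))\<^sup>2 \<le> (7 / 10)\<^sup>2" by (rule power_mono)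
  also have "\<dots> \<le> 1 / 2" by (simp add: power2_eq_square)
  finally show "(8 * l2 / (l2 - l1) * cos \<theta> + sqrt (2 * \<epsilon>))\<^sup>2 \<le> 1 / 2" .
qed

lemma orq_gt_\<rho>':
  assumes K: "1 + b / a \<le> K" and \<epsilon>: "\<epsilon> < 1 / (1000 * K\<^sup>2)"
  shows "\<rho> < orq"
proof (rule orq_gt_\<rho>)
  have 1: "(b / a)\<^sup>2 \<le> K\<^sup>2" using K \<kappa>_ge(3) by (intro power_mono) auto
  have 2: "0 < (b / a)\<^sup>2" using a_pos b_pos by simp
  have "64 * (b / a)\<^sup>2 \<le> 1000 * K\<^sup>2" using 1 2 by linarith
  then have "1 / (1000 * K\<^sup>2) \<le> 1 / (64 * (b / a)\<^sup>2)" by (rule frac_le[rotated 3]) (use 2 in simp_all)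
  then show "\<epsilon> \<le> 1 / (64 * (b / a)\<^sup>2)" using \<epsilon> by linarith
qed

end

section \<open>Preconditioning and the final statement\<close>

text \<open>The substitution x \<mapsto> X x, with X the inverse square root of B, turns the forms
  of A and M into those of the preconditioned matrices and the form of B into the Euclidean one. It
  maps u to a multiple of u1, so all locale assumptions are the pencil bounds at X x; normalizing u
  divides by \<open>quad B u1\<close>, which identifies \<open>\<sigma>\<close>.\<close>

lemma precond_pencil:
  assumes n: "2 \<le> n" and A: "spd n A" and M: "spd n M" and B: "spd n B"
    and ev: "pencil_eigenvalues n A M l" and l1: "0 < l 1" and l12: "l 1 < l 2"
    and mono: "\<And>i j. 1 \<le> i \<Longrightarrow> i \<le> j \<Longrightarrow> j \<le> n \<Longrightarrow> l i \<le> l j"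
    and u: "u1 \<in> carrier_vec n" "u1 \<noteq> 0\<^sub>v n" "A *\<^sub>v u1 = l 1 \<cdot>\<^sub>v (M *\<^sub>v u1)"
    and \<rho>: "l 1 \<le> \<rho>" "\<rho> < (l 1 + l 2) / 2"
  defines "w \<equiv> spd_sqrt n B *\<^sub>v u1"
  defines "u \<equiv> (1 / vnorm w) \<cdot>\<^sub>v w"
  shows "rq_pencil n (precond n B A) (precond n B M) u (Min (spectrum (mat_inv B * A)))
      (Max (spectrum (mat_inv B * A))) (l 1) (l 2) (l n) \<rho>"
    and "rq_pencil.\<sigma> (precond n B A) u = quad A u1 / quad B u1"
proof -
  note A' = spdD[OF A] and M' = spdD[OF M] and B' = spdD[OF B]
  define R where "R = spd_sqrt n B"
  have spdR: "spd n R" and RR: "R * R = B" using spd_sqrt[OF B] by (auto simp: R_def)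
  note R = spdD[OF spdR]
  define X where "X = mat_inv R"
  have X: "X \<in> carrier_mat n n" "X\<^sup>T = X" "R * X = 1\<^sub>m n" "X * R = 1\<^sub>m n"
    using spd_mat_inv[OF spdR] spd_mat_inv_symmetric[OF spdR] by (auto simp: X_def)
  have pc: "precond n B Y = X * Y * X" for Y by (simp add: precond_def X_def R_def)
  have pc_carrier: "precond n B Y \<in> carrier_mat n n" if "Y \<in> carrier_mat n n" for Y
    unfolding pc using X that by simp
  have pc_sym: "(precond n B Y)\<^sup>T = precond n B Y" if "Y \<in> carrier_mat n n" "Y\<^sup>T = Y" for Y
    unfolding pc using X that by (simp add: transpose_mult[of _ n n _ n] assoc_mult_mat[of _ n n _ n _ n])
  have pc_quad: "quad (precond n B Y) x = quad Y (X *\<^sub>v x)" if "Y \<in> carrier_mat n n" "x \<in> carrier_vec n" for Y x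
    using quad_congruence[OF X(1) that] X(2) unfolding pc by simp
  have XV: "X *\<^sub>v x \<in> carrier_vec n" if "x \<in> carrier_vec n" for x using X that by simp
  have quad_BX: "quad B (X *\<^sub>v x) = x \<bullet> x" if x: "x \<in> carrier_vec n" for x
  proof -
    have "R *\<^sub>v (X *\<^sub>v x) = x" by (rule mult_inverse_vec[OF R(1) X(1,3) x])
    moreover have "quad B y = (R *\<^sub>v y) \<bullet> (R *\<^sub>v y)" if y: "y \<in> carrier_vec n" for y
      using quad_congruence[OF R(1) one_carrier_mat y] R(1,2) RR y by (simp add: quad_def)
    ultimately show ?thesis using XV[OF x] by simp
  qed
  have wV: "w \<in> carrier_vec n" using R u by (simp add: w_def R_def[symmetric])
  have Xw: "X *\<^sub>v w = u1" unfolding w_def R_def[symmetric] by (rule mult_inverse_vec[OF X(1) R(1) X(4) u(1)])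
  have ww: "w \<bullet> w = quad B u1" using quad_BX[OF wV] by (simp add: Xw)
  have Bu: "quad B u1 > 0" by (rule B'(3)[OF u(1,2)])
  define c where "c = 1 / vnorm w"
  have c: "c > 0" "c\<^sup>2 = 1 / quad B u1" using ww Bu by (auto simp: c_def vnorm_def power_divide)
  have u_c: "u = c \<cdot>\<^sub>v w" by (simp add: u_def c_def)
  have uV: "u \<in> carrier_vec n" using wV by (simp add: u_c)
  have Xu: "X *\<^sub>v u = c \<cdot>\<^sub>v u1" unfolding u_c using X wV by (simp add: mult_mat_vec[of _ n n] Xw)
  have Pu: "precond n B A *\<^sub>v u = l 1 \<cdot>\<^sub>v (precond n B M *\<^sub>v u)"
  proof -
    have ap: "precond n B Y *\<^sub>v u = c \<cdot>\<^sub>v (X *\<^sub>v (Y *\<^sub>v u1))" if Y: "Y \<in> carrier_mat n n" for Y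
    proof -
      have "precond n B Y *\<^sub>v u = X *\<^sub>v (Y *\<^sub>v (X *\<^sub>v u))"
        unfolding pc using X(1) Y uV by (simp add: assoc_mult_mat_vec[of _ n n _ n])
      then show ?thesis unfolding Xu using X(1) Y u(1) by (simp add: mult_mat_vec[of _ n n])
    qed
    have Mu: "M *\<^sub>v u1 \<in> carrier_vec n" using M'(1) u(1) by (rule mult_mat_vec_carrier)
    show ?thesis unfolding ap[OF A'(1)] ap[OF M'(1)] u(3) using X(1) Mu
      by (simp add: mult_mat_vec[of _ n n] smult_smult_assoc mult.commute)
  qed
  have PB: "l 1 * quad M x \<le> quad A x" "quad A x \<le> l n * quad M x"
    "x \<bullet> (A *\<^sub>v u1) = 0 \<Longrightarrow> l 2 * quad M x \<le> quad A x" if "x \<in> carrier_vec n" for x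
    using pencil_bounds[OF A M n ev l12 _ u that] mono by blast+
  have qAu: "quad A (c \<cdot>\<^sub>v u1) = c\<^sup>2 * quad A u1"
    unfolding quad_def using A'(1) u(1) mult_mat_vec_carrier[OF A'(1) u(1)]
    by (simp add: mult_mat_vec[of _ n n] power2_eq_square scalar_prod_smult_distrib[of _ n])
  have n0: "0 < n" using n by simp
  note SB = spectrum_bounds[OF A B n0]
  show "rq_pencil n (precond n B A) (precond n B M) u (Min (spectrum (mat_inv B * A)))
      (Max (spectrum (mat_inv B * A))) (l 1) (l 2) (l n) \<rho>"
  proof (unfold_locales)
    show "precond n B A \<in> vec_dim.SM n" "precond n B M \<in> vec_dim.SM n"
      unfolding vec_dim.SM_def using pc_carrier pc_sym A' M' by auto
    show "u \<bullet> u = 1" unfolding u_c using wV ww Bu c by (simp add: power2_eq_square[symmetric] mult.assoc[symmetric])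
    fix x :: "real vec" assume x: "x \<in> carrier_vec n"
    show "Min (spectrum (mat_inv B * A)) * (x \<bullet> x) \<le> quad (precond n B A) x"
      "quad (precond n B A) x \<le> Max (spectrum (mat_inv B * A)) * (x \<bullet> x)"
      using SB(2,3)[OF XV[OF x]] unfolding quad_BX[OF x] pc_quad[OF A'(1) x] by auto
    show "l 1 * quad (precond n B M) x \<le> quad (precond n B A) x"
      "quad (precond n B A) x \<le> l n * quad (precond n B M) x"
      using PB(1,2)[OF XV[OF x]] unfolding pc_quad[OF A'(1) x] pc_quad[OF M'(1) x] by auto
    assume orth: "x \<bullet> (precond n B A *\<^sub>v u) = 0"
    have "x \<bullet> (precond n B A *\<^sub>v u) = c * ((X *\<^sub>v x) \<bullet> (A *\<^sub>v u1))"
    proof -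
      have Au: "A *\<^sub>v u1 \<in> carrier_vec n" using A'(1) u(1) by (rule mult_mat_vec_carrier)
      have "precond n B A *\<^sub>v u = X *\<^sub>v (A *\<^sub>v (c \<cdot>\<^sub>v u1))"
        unfolding pc Xu[symmetric] using X(1) A'(1) uV by (simp add: assoc_mult_mat_vec[of _ n n _ n])
      also have "\<dots> = c \<cdot>\<^sub>v (X *\<^sub>v (A *\<^sub>v u1))" using X(1) A'(1) Au u(1) by (simp add: mult_mat_vec[of _ n n])
      finally have "x \<bullet> (precond n B A *\<^sub>v u) = c * (x \<bullet> (X *\<^sub>v (A *\<^sub>v u1)))"
        using x XV[OF Au] by (simp add: scalar_prod_smult_distrib[of _ n])
      also have "x \<bullet> (X *\<^sub>v (A *\<^sub>v u1)) = (A *\<^sub>v u1) \<bullet> (X *\<^sub>v x)" by (rule symmetric_scalar_prod[OF X(1,2) x Au])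
      also have "\<dots> = (X *\<^sub>v x) \<bullet> (A *\<^sub>v u1)" by (rule comm_scalar_prod[OF Au XV[OF x]])
      finally show ?thesis .
    qed
    with orth c have "(X *\<^sub>v x) \<bullet> (A *\<^sub>v u1) = 0" by simp
    from PB(3)[OF XV[OF x] this]
    show "l 2 * quad (precond n B M) x \<le> quad (precond n B A) x"
      unfolding pc_quad[OF A'(1) x] pc_quad[OF M'(1) x] .
  qed (use n uV SB(1) l1 l12 mono[of 2 n] Pu \<rho> in auto)
  then interpret rq_pencil n "precond n B A" "precond n B M" u "Min (spectrum (mat_inv B * A))"
      "Max (spectrum (mat_inv B * A))" "l 1" "l 2" "l n" \<rho> .
  show "rq_pencil.\<sigma> (precond n B A) u = quad A u1 / quad B u1"
    unfolding \<sigma>_def pc_quad[OF A'(1) uV] Xu qAu by (simp add: c)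
qed

theorem corollary17:
  shows "\<exists>(C::real) (\<delta> :: real \<Rightarrow> real \<Rightarrow> real) (\<eta> :: real \<Rightarrow> real \<Rightarrow> real).
    C > 0 \<and> (\<forall>k g. \<delta> k g > 0 \<and> \<eta> k g > 0) \<and>
    (\<forall>(n::nat) (A::real mat) (M::real mat) (B::real mat) (l :: nat \<Rightarrow> real) (u1 :: real vec) (\<rho>::real).
      2 \<le> n \<and> spd n A \<and> spd n M \<and> spd n B \<and>
      pencil_eigenvalues n A M l \<and> 0 < l 1 \<and> l 1 < l 2 \<and>
      (\<forall>i j. 1 \<le> i \<and> i \<le> j \<and> j \<le> n \<longrightarrow> l i \<le> l j) \<and>
      u1 \<in> carrier_vec n \<and> u1 \<noteq> 0\<^sub>v n \<and> A *\<^sub>v u1 = l 1 \<cdot>\<^sub>v (M *\<^sub>v u1) \<and>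
      l 1 \<le> \<rho> \<and> \<rho> < (l 1 + l 2) / 2 \<longrightarrow>
      (let \<nu>min = Min (spectrum (mat_inv B * A));
           \<nu>max = Max (spectrum (mat_inv B * A));
           AB = precond n B A;
           MB = precond n B M;
           w = spd_sqrt n B *\<^sub>v u1;
           uB = (1 / vnorm w) \<cdot>\<^sub>v w;
           XB = sphere_sublevel n AB MB uB \<rho>;
           \<theta> = min_angle n AB MB \<rho>;
           orthrq = orth_rq_inf n AB MB \<rho>;
           smax = sublevel_max n AB MB \<rho>;
           smin = sublevel_min n AB MB \<rho>;
           CX = 8 * \<nu>max * \<rho> / smin * ((\<rho> - l 1) / l 1 + sqrt ((\<rho> - l 1) / l 1) * cos \<theta>);
           \<mu>B = 2 * \<nu>min * l 1 / smax * (1 - \<rho> / orthrq) - CX;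
           LB = 2 * \<nu>max * \<rho> / smin * (1 - l 1 / l n) + CX;
           \<epsilon> = (1 / l 1 - 1 / \<rho>) / (1 / l 1 - 1 / l 2);
           gap = (l 2 - l 1) / l 2;
           \<kappa> = \<nu>max / \<nu>min;
           \<sigma> = quad A u1 / quad B u1;
           q = (cos \<theta>)\<^sup>2 / gap\<^sup>2 + \<epsilon>
       in \<epsilon> < \<delta> \<kappa> gap \<longrightarrow>
          orthrq > \<rho> \<and>
          (cos \<theta> < \<eta> \<kappa> gap \<longrightarrow>
             (8 * l 2 / (l 2 - l 1) * cos \<theta> + sqrt (2 * \<epsilon>))\<^sup>2 \<le> 1 / 2 \<and>
             (\<exists>r. \<bar>r\<bar> \<le> C * (\<kappa> * q) \<and>
                \<mu>B \<ge> 2 * \<nu>min * l 1 / \<sigma> * (1 - l 1 / l 2) * (1 - r)) \<and>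
             (\<exists>r. \<bar>r\<bar> \<le> C * (\<sigma> / \<nu>min * q) \<and>
                LB \<le> 2 * \<nu>max * l 1 / \<sigma> * (1 - l 1 / l n) * (1 + r)) \<and>
             geod_convex_fun n XB (rq AB MB) \<mu>B \<and>
             geod_smooth_fun n XB (rq AB MB) LB \<and>
             (\<exists>r. \<bar>r\<bar> \<le> C * (\<kappa> * q) \<and>
                LB / \<mu>B \<le> \<kappa> * ((1 - l 1 / l n) / (1 - l 1 / l 2)) * (1 + r)))))"
proof -
  \<comment> \<open>The square in this threshold is what \<open>orq_gt_\<rho>'\<close> requires. The
    absolute values, and the case g \<le> 0 in the other threshold, keep both functions positive at
    all real arguments; at the actual ratio and gap they disappear.\<close>
  define \<delta> :: "real \<Rightarrow> real \<Rightarrow> real" where "\<delta> k g = 1 / (1000 * (1 + \<bar>k\<bar>)\<^sup>2)" for k g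
  define \<eta> :: "real \<Rightarrow> real \<Rightarrow> real" where "\<eta> k g = (if g \<le> 0 then 1 else g / (1000 * (1 + \<bar>k\<bar>)))" for k g
  have pos: "\<delta> k g > 0 \<and> \<eta> k g > 0" for k g
    by (auto simp: \<delta>_def \<eta>_def intro!: divide_pos_pos mult_pos_pos zero_less_power add_pos_nonneg)
  show ?thesis
  \<comment> \<open>The largest of the three error constants 55, 56 and 222.\<close>
  proof (rule exI[of _ 222], rule exI[of _ \<delta>], rule exI[of _ \<eta>], intro conjI allI impI)
    fix n :: nat and A M B :: "real mat" and l :: "nat \<Rightarrow> real" and u1 :: "real vec" and \<rho> :: real
    let ?a = "Min (spectrum (mat_inv B * A))"
    let ?b = "Max (spectrum (mat_inv B * A))"
    let ?w = "spd_sqrt n B *\<^sub>v u1"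
    let ?u = "(1 / vnorm ?w) \<cdot>\<^sub>v ?w"
    assume H: "2 \<le> n \<and> spd n A \<and> spd n M \<and> spd n B \<and>
      pencil_eigenvalues n A M l \<and> 0 < l 1 \<and> l 1 < l 2 \<and>
      (\<forall>i j. 1 \<le> i \<and> i \<le> j \<and> j \<le> n \<longrightarrow> l i \<le> l j) \<and>
      u1 \<in> carrier_vec n \<and> u1 \<noteq> 0\<^sub>v n \<and> A *\<^sub>v u1 = l 1 \<cdot>\<^sub>v (M *\<^sub>v u1) \<and>
      l 1 \<le> \<rho> \<and> \<rho> < (l 1 + l 2) / 2"
    interpret rq_pencil n "precond n B A" "precond n B M" ?u ?a ?b "l 1" "l 2" "l n" \<rho>
      by (rule precond_pencil(1)) (use H in auto)
    have \<sigma>: "quad A u1 / quad B u1 = \<sigma>"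
      by (rule precond_pencil(2)[symmetric, of n A M B l u1 \<rho>]) (use H in auto)
    have abs_\<kappa>: "\<bar>?b / ?a\<bar> = ?b / ?a" using \<kappa>_ge(3) by (intro abs_of_nonneg) linarith
    have \<delta>: "\<delta> (?b / ?a) gap = 1 / (1000 * (1 + ?b / ?a)\<^sup>2)"
      and \<eta>: "\<eta> (?b / ?a) gap = gap / (1000 * (1 + ?b / ?a))"
      using gap unfolding \<delta>_def \<eta>_def abs_\<kappa> by auto
    have C0: "0 \<le> \<sigma> / ?a * q" "0 \<le> ?b / ?a * q"
      using mult_nonneg_nonneg[OF order_trans[OF zero_le_one \<kappa>_ge(1)] q_bounds(3)]
        mult_nonneg_nonneg[OF order_trans[OF zero_le_one \<kappa>_ge(3)] q_bounds(3)] by blast+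
    have gt: "\<rho> < orq" if "\<epsilon> < \<delta> (?b / ?a) gap"
      using orq_gt_\<rho>'[OF order_refl] that unfolding \<delta> .
    have conclusion: "(8 * l 2 / (l 2 - l 1) * cos \<theta> + sqrt (2 * \<epsilon>))\<^sup>2 \<le> 1 / 2 \<and>
       (\<exists>r. \<bar>r\<bar> \<le> 222 * (?b / ?a * q) \<and> \<mu>B \<ge> 2 * ?a * l 1 / \<sigma> * (1 - l 1 / l 2) * (1 - r)) \<and>
       (\<exists>r. \<bar>r\<bar> \<le> 222 * (\<sigma> / ?a * q) \<and> LB \<le> 2 * ?b * l 1 / \<sigma> * (1 - l 1 / l n) * (1 + r)) \<and>
       geod_convex_fun n X (rq (precond n B A) (precond n B M)) \<mu>B \<and>
       geod_smooth_fun n X (rq (precond n B A) (precond n B M)) LB \<and>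
       (\<exists>r. \<bar>r\<bar> \<le> 222 * (?b / ?a * q) \<and>
          LB / \<mu>B \<le> ?b / ?a * ((1 - l 1 / l n) / (1 - l 1 / l 2)) * (1 + r))"
      if *: "\<epsilon> < \<delta> (?b / ?a) gap" "cos \<theta> < \<eta> (?b / ?a) gap"
    proof -
      note sm = gap_q_small[OF order_refl *[unfolded \<delta> \<eta>]]
      note f = small_facts[OF sm(1)]
      show ?thesis
      proof (intro conjI)
        show "\<exists>r. \<bar>r\<bar> \<le> 222 * (?b / ?a * q) \<and> \<mu>B \<ge> 2 * ?a * l 1 / \<sigma> * (1 - l 1 / l 2) * (1 - r)"
          using \<mu>B_bound[OF sm(1)] C0 unfolding gap_alt by (intro exI[of _ "55 * (?b / ?a * q)"]) auto
        show "\<exists>r. \<bar>r\<bar> \<le> 222 * (\<sigma> / ?a * q) \<and> LB \<le> 2 * ?b * l 1 / \<sigma> * (1 - l 1 / l n) * (1 + r)"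
          using LB_bound[OF sm(1)] C0 by (intro exI[of _ "56 * (\<sigma> / ?a * q)"]) auto
        show "\<exists>r. \<bar>r\<bar> \<le> 222 * (?b / ?a * q) \<and>
            LB / \<mu>B \<le> ?b / ?a * ((1 - l 1 / l n) / (1 - l 1 / l 2)) * (1 + r)"
          using condition_bound[OF sm(1)] C0 by (intro exI[of _ "222 * (?b / ?a * q)"]) auto
        show "geod_convex_fun n X (rq (precond n B A) (precond n B M)) \<mu>B"
          by (rule rq_geod_convex[OF f(6,7) gt[OF *(1)] \<mu>B_pos[OF sm(1)]])
        show "geod_smooth_fun n X (rq (precond n B A) (precond n B M)) LB"
          by (rule rq_geod_smooth[OF f(6,7) gt[OF *(1)]])
      qed (rule sm(2))
    qed
    from gt conclusion
    have "\<epsilon> < \<delta> (?b / ?a) gap \<longrightarrow> \<rho> < orq \<and> (cos \<theta> < \<eta> (?b / ?a) gap \<longrightarrow>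
       (8 * l 2 / (l 2 - l 1) * cos \<theta> + sqrt (2 * \<epsilon>))\<^sup>2 \<le> 1 / 2 \<and>
       (\<exists>r. \<bar>r\<bar> \<le> 222 * (?b / ?a * q) \<and> \<mu>B \<ge> 2 * ?a * l 1 / \<sigma> * (1 - l 1 / l 2) * (1 - r)) \<and>
       (\<exists>r. \<bar>r\<bar> \<le> 222 * (\<sigma> / ?a * q) \<and> LB \<le> 2 * ?b * l 1 / \<sigma> * (1 - l 1 / l n) * (1 + r)) \<and>
       geod_convex_fun n X (rq (precond n B A) (precond n B M)) \<mu>B \<and>
       geod_smooth_fun n X (rq (precond n B A) (precond n B M)) LB \<and>
       (\<exists>r. \<bar>r\<bar> \<le> 222 * (?b / ?a * q) \<and>
          LB / \<mu>B \<le> ?b / ?a * ((1 - l 1 / l n) / (1 - l 1 / l 2)) * (1 + r)))"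
      by blast
    then show "let \<nu>min = ?a; \<nu>max = ?b; AB = precond n B A; MB = precond n B M;
           w = ?w; uB = (1 / vnorm w) \<cdot>\<^sub>v w; XB = sphere_sublevel n AB MB uB \<rho>;
           \<theta> = min_angle n AB MB \<rho>; orthrq = orth_rq_inf n AB MB \<rho>;
           smax = sublevel_max n AB MB \<rho>; smin = sublevel_min n AB MB \<rho>;
           CX = 8 * \<nu>max * \<rho> / smin * ((\<rho> - l 1) / l 1 + sqrt ((\<rho> - l 1) / l 1) * cos \<theta>);
           \<mu>B = 2 * \<nu>min * l 1 / smax * (1 - \<rho> / orthrq) - CX;
           LB = 2 * \<nu>max * \<rho> / smin * (1 - l 1 / l n) + CX;
           \<epsilon> = (1 / l 1 - 1 / \<rho>) / (1 / l 1 - 1 / l 2);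
           gap = (l 2 - l 1) / l 2; \<kappa> = \<nu>max / \<nu>min; \<sigma> = quad A u1 / quad B u1;
           q = (cos \<theta>)\<^sup>2 / gap\<^sup>2 + \<epsilon>
       in \<epsilon> < \<delta> \<kappa> gap \<longrightarrow> orthrq > \<rho> \<and>
          (cos \<theta> < \<eta> \<kappa> gap \<longrightarrow>
             (8 * l 2 / (l 2 - l 1) * cos \<theta> + sqrt (2 * \<epsilon>))\<^sup>2 \<le> 1 / 2 \<and>
             (\<exists>r. \<bar>r\<bar> \<le> 222 * (\<kappa> * q) \<and>
                \<mu>B \<ge> 2 * \<nu>min * l 1 / \<sigma> * (1 - l 1 / l 2) * (1 - r)) \<and>
             (\<exists>r. \<bar>r\<bar> \<le> 222 * (\<sigma> / \<nu>min * q) \<and>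
                LB \<le> 2 * \<nu>max * l 1 / \<sigma> * (1 - l 1 / l n) * (1 + r)) \<and>
             geod_convex_fun n XB (rq AB MB) \<mu>B \<and>
             geod_smooth_fun n XB (rq AB MB) LB \<and>
             (\<exists>r. \<bar>r\<bar> \<le> 222 * (\<kappa> * q) \<and>
                LB / \<mu>B \<le> \<kappa> * ((1 - l 1 / l n) / (1 - l 1 / l 2)) * (1 + r)))"
      unfolding Let_def \<sigma> q_def gap_def \<mu>B_def LB_def CX_def \<epsilon>_def \<theta>_def orq_def smax_def smin_def .
  qed (use pos in auto)
qed

end
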